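(* For every integer $r\ge 2$, $$\alpha^*(K_r)=\alpha_{\mathrm{pan}}^*(K_r)=\rho_r,$$ where $K_r$ is the complete graph on $r$ vertices, $\rho_r$ is the unique positive real solution of $x^r+rx-1=0$, and $\alpha^*$ and $\alpha^*_{\mathrm{pan}}$ are the minimum-degree thresholds of Hamiltonicity and pancyclicity for graphs perturbed by a uniformly random $K_r$-factor.
   Context: All graphs are finite and simple. An $n$-vertex graph is Hamiltonian if it contains a cycle through all its vertices, and pancyclic if it contains a cycle of every length $3,4,\ldots,n$. $\delta(H)$ is the minimum degree of $H$. Random $F$-factor: let $F$ be a fixed connected graph with vertex set $\{1,\ldots,m\}$, $m\ge2$, and let $V$ be an $n$-element set with $m\mid n$. A uniformly random $F$-factor $\mathcal F$ on $V$ is generated by taking a uniformly random ordering $v_1,\ldots,v_n$ of $V$ and, for each $i=0,\ldots,n/m-1$, placing a copy of $F$ on $\{v_{im+1},\ldots,v_{im+m}\}$ by identifying $j\in V(F)$ with $v_{im+j}$. It is regarded as a graph on $V$. For a graph $H$ on $V$, $H\cup\mathcal F$ is the graph on $V$ whose edge set is the union of the edge sets. Thresholds: $\alpha^*(F)$ is the infimum of all $a\in[0,1]$ such that for every $\varepsilon>0$, with high probability $H\cup\mathcal F$ is Hamiltonian for graphs $H$ on $n$ vertices, $m\mid n$, with $\delta(H)\ge(a+\varepsilon)n$. Explicitly: for every $\varepsilon>0$ and every $\eta>0$ there is $n_0$ such that for every $n\ge n_0$ with $m\mid n$ and every $n$-vertex graph $H$ with $\delta(H)\ge (a+\varepsilon)n$,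 one has $\Pr(H\cup\mathcal F\text{ is Hamiltonian})\ge 1-\eta$, where $\mathcal F$ is a uniformly random $F$-factor on $V(H)$. The threshold $\alpha^*_{\mathrm{pan}}(F)$ is defined identically with "Hamiltonian" replaced by "pancyclic". *)

theory Defs
  imports
    "HOL-Probability.Probability_Mass_Function"
    "HOL-Combinatorics.Multiset_Permutations"
    "Graph_Theory.Graph_Theory"
begin

text \<open>
  Finite simple graphs are the finite, loop-free, symmetric pair digraphs
  (\<open>pair_graph\<close>): each edge is present as two opposite arcs, so the degree of a vertex is
  its out-degree. In a symmetric digraph the walk \<open>a, b, a\<close> counts as a \<open>cycle\<close>, but it is
  not a cycle of the underlying graph. Such walks have length 2 and every cycle of length at
  least 3 is a genuine one, hence the length bounds below.
\<close>

definition hamiltonian :: "('a, 'b) pre_digraph \<Rightarrow> bool" where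
  "hamiltonian G \<longleftrightarrow>
    (\<exists>p. pre_digraph.cycle G p \<and> 3 \<le> length p \<and> tail G ` set p = verts G)"

definition pancyclic :: "('a, 'b) pre_digraph \<Rightarrow> bool" where
  "pancyclic G \<longleftrightarrow>
    (\<forall>k\<in>{3..card (verts G)}. \<exists>p. pre_digraph.cycle G p \<and> length p = k)"

text \<open>Meaningful only for graphs with at least one vertex.\<close>

definition min_degree :: "('a, 'b) pre_digraph \<Rightarrow> nat" where
  "min_degree G = Min (out_degree G ` verts G)"

definition complete_graph :: "nat \<Rightarrow> nat pair_pre_digraph" where
  "complete_graph r =
    \<lparr> pverts = {1..r}, parcs = {(u, v). u \<in> {1..r} \<and> v \<in> {1..r} \<and> u \<noteq> v} \<rparr>"

lemma complete_digraph_complete_graph: "complete_digraph r (with_proj (complete_graph r))"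
proof -
  have "finite {(u, v). u \<in> {1..r} \<and> v \<in> {1..r} \<and> u \<noteq> v}"
    by (rule finite_subset[of _ "{1..r} \<times> {1..r}"]) auto
  then interpret pair_graph "complete_graph r"
    by unfold_locales (auto simp: complete_graph_def symmetric_def intro!: symI)
  have "graph (with_proj (complete_graph r))"
    by unfold_locales
  then show ?thesis
    by (auto simp: complete_digraph_def complete_graph_def)
qed

text \<open>
  The vertex set of \<open>F\<close> is \<open>{1..m}\<close>. The ordering \<open>v\<^sub>1, \<dots>, v\<^sub>n\<close> is the list \<open>vs\<close>, indexed
  from 0, so that \<open>v\<^sub>i\<^sub>m\<^sub>+\<^sub>j\<close> is \<open>vs ! (i * m + (j - 1))\<close>.
\<close>

definition factor_of_ordering :: "nat pair_pre_digraph \<Rightarrow> 'a list \<Rightarrow> 'a pair_pre_digraph" where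
  "factor_of_ordering F vs = (let m = card (pverts F) in
    \<lparr> pverts = set vs,
      parcs = {(vs ! (i * m + (j - 1)), vs ! (i * m + (k - 1))) | i j k.
        i < length vs div m \<and> (j, k) \<in> parcs F} \<rparr>)"

definition random_factor :: "nat pair_pre_digraph \<Rightarrow> 'a set \<Rightarrow> 'a pair_pre_digraph pmf" where
  "random_factor F V = map_pmf (factor_of_ordering F) (pmf_of_set (permutations_of_set V))"

text \<open>
  The infimum of all \<open>a\<close> in \<open>[0,1]\<close> such that, for every \<open>\<epsilon> > 0\<close>, graphs \<open>H\<close> on \<open>n\<close>
  vertices of minimum degree at least \<open>(a + \<epsilon>) n\<close> satisfy: the union of \<open>H\<close> with a random
  \<open>F\<close>-factor on its vertex set has property \<open>Q\<close> with high probability. The vertices of \<open>H\<close>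
  are natural numbers; every finite graph is isomorphic to such a graph. The set is bounded
  below by 0 and contains 1 (for \<open>a = 1\<close> and \<open>n > 0\<close> the degree condition is
  unsatisfiable), so the infimum is the intended one.
\<close>

definition perturbed_threshold ::
    "((nat, nat \<times> nat) pre_digraph \<Rightarrow> bool) \<Rightarrow> nat pair_pre_digraph \<Rightarrow> real" where
  "perturbed_threshold Q F = Inf {a \<in> {0..1}. \<forall>\<epsilon>>0. \<forall>\<eta>>0. \<exists>n\<^sub>0. \<forall>n\<ge>n\<^sub>0. card (pverts F) dvd n \<longrightarrow>
    (\<forall>H :: nat pair_pre_digraph.
      pair_graph H \<and> card (pverts H) = n \<and> real (min_degree (with_proj H)) \<ge> (a + \<epsilon>) * real n \<longrightarrow>
      measure_pmf.prob (random_factor F (pverts H))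
        {\<F>. Q (union (with_proj H) (with_proj \<F>))} \<ge> 1 - \<eta>)}"

definition alpha_star :: "nat pair_pre_digraph \<Rightarrow> real" where
  "alpha_star = perturbed_threshold hamiltonian"

definition alpha_star_pan :: "nat pair_pre_digraph \<Rightarrow> real" where
  "alpha_star_pan = perturbed_threshold pancyclic"

definition rho :: "nat \<Rightarrow> real" where
  "rho r = (THE x. 0 < x \<and> x ^ r + real r * x - 1 = 0)"

end

theory Submission
  imports Defs "HOL-Real_Asymp.Real_Asymp"
begin

text \<open>
  Lower bound: let \<open>H\<close> consist of all pairs that meet a set \<open>A\<close> of \<open>z n\<close> vertices, \<open>z < \<rho>\<close>. A
  Hamilton cycle of \<open>H \<union> F\<close> leaves every clique of \<open>F\<close> not contained in \<open>A\<close> towards a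
  different vertex of \<open>A\<close>, so at most \<open>z n\<close> cliques are not contained in \<open>A\<close>. The expected number of
  cliques inside \<open>A\<close> is at most \<open>z ^ r n / r\<close>, and \<open>z ^ r + r z < 1\<close>, so Markov's inequality
  bounds the probability away from 1.

  Upper bound: with high probability, for every vertex \<open>b\<close>, fewer cliques meet the non-neighbourhood
  of \<open>b\<close> than \<open>b\<close> has neighbours, with linear surplus; only the \<open>n\<close> sets \<open>N(b)\<close> are involved
  here, because an independent set \<open>B\<close> with \<open>b \<in> B\<close> avoids \<open>N(b)\<close>. This is Hall's condition for
  covering the vertices by directed cycles made of edges of \<open>H\<close> and of clique edges in increasing
  order, and it persists after deleting few edges. Averaging many edge-disjoint such covers and
  sorting the cliques into random layers turns them into a path cover with at most \<open>\<gamma> n\<close> paths.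
  These paths are absorbed into a short cycle through linearly many clique edges \<open>x y\<close>: for all
  vertices \<open>p, q\<close>, a positive fraction of these edges satisfies \<open>x \<in> N(p)\<close> and \<open>y \<in> N(q)\<close>.
\<close>

section \<open>Hall's theorem and path systems\<close>

text \<open>The equation for \<open>\<rho>\<close> arises as follows: if a vertex has
  \<open>s n\<close> neighbours, about \<open>(n / r) (1 - s ^ r)\<close> cliques meet the rest, and
  this is less than \<open>s n\<close> exactly when \<open>s ^ r + r s > 1\<close>. Restricting
  attention to the sets \<open>N(b)\<close> matters because the failure probability for one set is
  only \<open>exp (- c n)\<close> with a small constant \<open>c\<close>, too large for a union
  bound over all vertex sets. The obstacle in the upper bound is that Hall's condition controls
  single successors: the directed cycles may be as short as an edge of \<open>H\<close> traversed
  both ways, so one cover need not contain long paths. A random layering makes the digraph acyclic,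
  but an arc between cliques survives only with probability about \<open>1 / L\<close>, and a single
  permutation could lose most of its arcs. Hence many permutations without common arcs between
  cliques are averaged: the weight that leaves a clique is then spread over many cliques or is
  small, the surviving weight times \<open>L\<close> is close to its mean, and a defect version of
  Hall's theorem finds an almost perfect matching in the layered digraph.\<close>

lemma card_split: "finite X \<Longrightarrow> Y \<subseteq> X \<Longrightarrow> card X = card Y + card (X - Y)"
  by (simp add: card_Diff_subset card_mono finite_subset)

text \<open>Rado's argument: as long as some \<open>N x\<close> has two different members, one of
  them can be removed without violating Hall's condition. Once all \<open>N x\<close> are
  singletons, the condition makes them pairwise distinct.\<close>

lemma hall:
  fixes N :: "'a \<Rightarrow> 'b set"
  assumes "finite X" "\<And>x. x \<in> X \<Longrightarrow> finite (N x)"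
    and "\<And>S. S \<subseteq> X \<Longrightarrow> card S \<le> card (\<Union>(N ` S))"
  shows "\<exists>f. inj_on f X \<and> (\<forall>x\<in>X. f x \<in> N x)"
  using assms(2,3)
proof (induction "\<Sum>x\<in>X. card (N x)" arbitrary: N rule: less_induct)
  case (less N)
  note fin = less.prems(1) and hall = less.prems(2)
  have ne: "N x \<noteq> {}" if "x \<in> X" for x
    using hall[of "{x}"] that by auto
  show ?case
  proof (cases "\<exists>x\<in>X. \<exists>y\<in>N x. \<exists>z\<in>N x. y \<noteq> z")
    case False
    define f where "f x = (SOME y. y \<in> N x)" for x
    have f: "f x \<in> N x" if "x \<in> X" for x
      using ne[OF that] by (auto simp: f_def intro: someI_ex)
    have N: "N x = {f x}" if "x \<in> X" for x
      using f[OF that] False that by blast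
    have "inj_on f X"
    proof (rule inj_onI, rule ccontr)
      fix x y assume xy: "x \<in> X" "y \<in> X" "f x = f y" "x \<noteq> y"
      then show False using hall[of "{x, y}"] by (simp add: N)
    qed
    with f show ?thesis by blast
  next
    case True
    then obtain x y z where x: "x \<in> X" "y \<in> N x" "z \<in> N x" "y \<noteq> z" by blast
    \<comment> \<open>A set violating the condition after the removal of \<open>w\<close> must
      contain \<open>x\<close>; the witness \<open>A\<close> is this set without
      \<open>x\<close>.\<close>
    have red: "(\<exists>f. inj_on f X \<and> (\<forall>x\<in>X. f x \<in> N x)) \<or>
        (\<exists>A\<subseteq>X - {x}. card (\<Union>(N ` A) \<union> (N x - {w})) \<le> card A)" if w: "w \<in> N x" for w
    proof -
      let ?N = "N(x := N x - {w})"
      have fin': "finite (?N u)" if "u \<in> X" for u using fin that by auto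
      have pos: "0 < card (N x)" using fin[OF x(1)] w by (auto simp: card_gt_0_iff)
      have lt: "(\<Sum>u\<in>X. card (?N u)) < (\<Sum>u\<in>X. card (N u))"
        by (rule sum_strict_mono_ex1) (use assms(1) fin x(1) w pos in \<open>auto intro!: card_mono bexI[of _ x]\<close>)
      show ?thesis
      proof (cases "\<forall>S\<subseteq>X. card S \<le> card (\<Union>(?N ` S))")
        case True
        then obtain f where "inj_on f X" "\<forall>u\<in>X. f u \<in> ?N u"
          using less.hyps[OF lt] fin' by blast
        then have "inj_on f X \<and> (\<forall>u\<in>X. f u \<in> N u)"
          by (auto split: if_splits)
        then show ?thesis by blast
      next
        case False
        then obtain S where S: "S \<subseteq> X" "card (\<Union>(?N ` S)) < card S" by (auto simp: not_le)
        have "x \<in> S"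
        proof (rule ccontr)
          assume "x \<notin> S"
          then have "\<Union>(?N ` S) = \<Union>(N ` S)" by auto
          with S hall[of S] show False by simp
        qed
        have U: "\<Union>(?N ` S) = \<Union>(N ` (S - {x})) \<union> (N x - {w})" using \<open>x \<in> S\<close> by auto
        have "card (S - {x}) = card S - 1" using \<open>x \<in> S\<close> S(1) assms(1)
          by (simp add: finite_subset)
        then have "card (\<Union>(N ` (S - {x})) \<union> (N x - {w})) \<le> card (S - {x})"
          using S(2) unfolding U by linarith
        moreover have "S - {x} \<subseteq> X - {x}" using S(1) by blast
        ultimately show ?thesis by blast
      qed
    qed
    show ?thesis
    proof (rule ccontr)
      assume no: "\<not> ?thesis"
      \<comment> \<open>Submodularity: as \<open>y\<close> and \<open>z\<close> differ,
        \<open>?P \<union> ?Q\<close> contains all neighbours of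
        \<open>insert x (A \<union> B)\<close>, and \<open>?P \<inter> ?Q\<close> contains those of
        \<open>A \<inter> B\<close>. Adding both counts contradicts the bounds for \<open>A\<close>
        and \<open>B\<close>.\<close>
      from red[OF x(2)] no obtain A where A: "A \<subseteq> X - {x}" "card (\<Union>(N ` A) \<union> (N x - {y})) \<le> card A" by blast
      from red[OF x(3)] no obtain B where B: "B \<subseteq> X - {x}" "card (\<Union>(N ` B) \<union> (N x - {z})) \<le> card B" by blast
      let ?P = "\<Union>(N ` A) \<union> (N x - {y})" and ?Q = "\<Union>(N ` B) \<union> (N x - {z})"
      have fA: "finite A" "finite B" using A(1) B(1) assms(1) by (auto intro: finite_subset)
      have fPQ: "finite ?P" "finite ?Q" using A(1) B(1) assms(1) fin x(1) fA by auto
      have "card (A \<inter> B) \<le> card (?P \<inter> ?Q)"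
      proof -
        have "A \<inter> B \<subseteq> X" using A by auto
        then have "card (A \<inter> B) \<le> card (\<Union>(N ` (A \<inter> B)))" by (rule hall)
        also have "\<dots> \<le> card (?P \<inter> ?Q)" by (rule card_mono) (use fPQ in auto)
        finally show ?thesis .
      qed
      moreover have "Suc (card (A \<union> B)) \<le> card (?P \<union> ?Q)"
      proof -
        have "insert x (A \<union> B) \<subseteq> X" using A B x by auto
        then have "card (insert x (A \<union> B)) \<le> card (\<Union>(N ` insert x (A \<union> B)))" by (rule hall)
        also have "\<dots> \<le> card (?P \<union> ?Q)" by (rule card_mono) (use fPQ x in auto)
        finally show ?thesis using A B fA by (subst (asm) card_insert_disjoint) auto
      qed
      moreover have "card ?P + card ?Q = card (?P \<union> ?Q) + card (?P \<inter> ?Q)"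
        by (rule card_Un_Int) (use fPQ in auto)
      moreover have "card A + card B = card (A \<union> B) + card (A \<inter> B)"
        by (rule card_Un_Int) (use fA in auto)
      ultimately show False using A(2) B(2) by linarith
    qed
  qed
qed

text \<open>Hall's theorem after adding \<open>d\<close> common dummy elements (\<open>Inr\<close>)
  to every \<open>N x\<close>; \<open>Y\<close> consists of the members of \<open>X\<close> that are
  not matched to a dummy.\<close>

lemma hall_defect:
  fixes N :: "'a \<Rightarrow> 'b set"
  assumes X: "finite X" and fin: "\<And>x. x \<in> X \<Longrightarrow> finite (N x)"
    and cond: "\<And>S. S \<subseteq> X \<Longrightarrow> card S \<le> card (\<Union>(N ` S)) + d"
  shows "\<exists>f Y. Y \<subseteq> X \<and> card X \<le> card Y + d \<and> inj_on f Y \<and> (\<forall>x\<in>Y. f x \<in> N x)"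
proof -
  let ?N = "\<lambda>x. Inl ` N x \<union> Inr ` {..<d} :: ('b + nat) set"
  have "\<exists>f. inj_on f X \<and> (\<forall>x\<in>X. f x \<in> ?N x)"
  proof (rule hall)
    fix S assume S: "S \<subseteq> X"
    show "card S \<le> card (\<Union> (?N ` S))"
    proof (cases "S = {}")
      case False
      have fU: "finite (\<Union> (N ` S))" using S X fin by (auto intro: finite_subset)
      have "\<Union> (?N ` S) = Inl ` \<Union> (N ` S) \<union> Inr ` {..<d}" using False by auto
      moreover have "card (Inl ` \<Union> (N ` S) \<union> Inr ` {..<d} :: ('b + nat) set) = card (\<Union> (N ` S)) + d"
        by (subst card_Un_disjoint) (use fU in \<open>auto simp: card_image\<close>)
      ultimately show ?thesis using cond[OF S] by simp
    qed simp
  qed (use X fin in auto)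
  then obtain f where f: "inj_on f X" "\<And>x. x \<in> X \<Longrightarrow> f x \<in> ?N x" by blast
  define Y where "Y = {x \<in> X. f x \<in> range Inl}"
  have "card (X - Y) \<le> card (Inr ` {..<d} :: ('b + nat) set)"
  proof (rule card_inj_on_le)
    show "inj_on f (X - Y)" using f(1) by (rule inj_on_subset) auto
    show "f ` (X - Y) \<subseteq> Inr ` {..<d}" using f(2) by (force simp: Y_def)
  qed auto
  then have "card (X - Y) \<le> d" by (simp add: card_image)
  moreover have "card X = card Y + card (X - Y)"
    using X by (intro card_split) (auto simp: Y_def)
  moreover have "inj_on (\<lambda>x. projl (f x)) Y"
    by (rule inj_onI) (use f(1) in \<open>auto simp: Y_def inj_on_def\<close>)
  moreover have "projl (f x) \<in> N x" if "x \<in> Y" for x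
    using f(2)[of x] that by (auto simp: Y_def)
  moreover have "Y \<subseteq> X" by (auto simp: Y_def)
  ultimately show ?thesis
    by (intro exI[of _ "\<lambda>x. projl (f x)"] exI[of _ Y]) auto
qed

text \<open>A single one of the sets is already large enough for Hall's condition, so this serves
  wherever a greedy choice would be made.\<close>

lemma distinct_representatives:
  assumes X: "finite X" and "\<And>x. x \<in> X \<Longrightarrow> finite (N x)" and le: "\<And>x. x \<in> X \<Longrightarrow> card X \<le> card (N x)"
  shows "\<exists>f. inj_on f X \<and> (\<forall>x\<in>X. f x \<in> N x)"
proof (rule hall)
  fix S assume S: "S \<subseteq> X"
  show "card S \<le> card (\<Union>(N ` S))"
  proof (cases "S = {}")
    case False
    then obtain x where x: "x \<in> S" by auto
    have "card S \<le> card X" using S X by (simp add: card_mono)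
    also have "\<dots> \<le> card (N x)" using le x S by auto
    also have "\<dots> \<le> card (\<Union>(N ` S))"
      by (rule card_mono) (use x S assms in \<open>auto intro: finite_subset\<close>)
    finally show ?thesis .
  qed simp
qed (use assms in auto)

text \<open>Single vertices are paths. Excluding the empty list makes every \<open>hd\<close> and
  \<open>last\<close> an end vertex and \<open>length ps\<close> the true number of paths.\<close>

definition path_system :: "('a \<Rightarrow> 'a \<Rightarrow> bool) \<Rightarrow> 'a list list \<Rightarrow> bool" where
  "path_system G ps \<longleftrightarrow>
    distinct (concat ps) \<and> [] \<notin> set ps \<and> (\<forall>p\<in>set ps. successively G p)"

lemma successively_key_mono:
  fixes key :: "'a \<Rightarrow> 'k::preorder"
  assumes "successively G p" "p \<noteq> []" "\<And>u v. G u v \<Longrightarrow> key u \<le> key v"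
  shows "key (hd p) \<le> key (last p)"
  using assms(1,2)
proof (induction p)
  case (Cons a p)
  show ?case
  proof (cases p)
    case (Cons b q)
    then have "G a b" "successively G p" using Cons.prems by auto
    then have "key a \<le> key b" "key b \<le> key (last p)" using Cons.IH assms(3) Cons by auto
    then show ?thesis using Cons by (auto intro: order_trans)
  qed auto
qed auto

lemma successively_split: "successively G (xs @ x # y # ys) \<Longrightarrow> G x y"
  by (simp add: successively_append_iff)

text \<open>The components of \<open>M\<close> are paths or directed cycles, and the increasing
  \<open>key\<close> rules out the cycles. So each arc merges two different paths and lowers their
  number by one.\<close>

lemma path_system_of_matching:
  fixes key :: "'a \<Rightarrow> 'k::linorder"
  assumes "finite M" "finite V" "M \<subseteq> V \<times> V" "single_valued M" "single_valued (M\<inverse>)"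
    and "\<And>u v. (u, v) \<in> M \<Longrightarrow> key u < key v"
  shows "\<exists>ps. path_system (\<lambda>u v. (u, v) \<in> M) ps \<and> set (concat ps) = V \<and> length ps + card M = card V"
  using assms(1,3-6)
proof (induction M rule: finite_induct)
  case empty
  obtain xs where xs: "set xs = V" "distinct xs" using finite_distinct_list assms(2) by blast
  have *: "concat (map (\<lambda>x. [x]) xs) = xs" by simp
  show ?case
    by (rule exI[of _ "map (\<lambda>x. [x]) xs"]) (use xs in \<open>auto simp: path_system_def distinct_card * simp del: concat_map_singleton\<close>)
next
  case (insert e M)
  obtain u v where e: "e = (u, v)" by force
  have sv: "single_valued M" "single_valued (M\<inverse>)"
    using insert.prems(2,3) by (auto simp: single_valued_def)
  then obtain ps where ps: "path_system (\<lambda>u v. (u, v) \<in> M) ps" "set (concat ps) = V"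
    "length ps + card M = card V"
    using insert.IH insert.prems by auto
  have "u \<in> set (concat ps)" "v \<in> set (concat ps)" using insert.prems(1) e ps(2) by auto
  then obtain p q where p: "p \<in> set ps" "u \<in> set p" and q: "q \<in> set ps" "v \<in> set q"
    by (auto simp only: set_concat)
  have sp: "successively (\<lambda>u v. (u, v) \<in> M) p" "successively (\<lambda>u v. (u, v) \<in> M) q" "p \<noteq> []" "q \<noteq> []"
    using ps(1) p q by (auto simp: path_system_def)
  have nu: "(u, w) \<notin> M" for w
    using insert.prems(2) insert.hyps(2) by (auto simp: single_valued_def e)
  have nv: "(w, v) \<notin> M" for w
    using insert.prems(3) insert.hyps(2) by (auto simp: single_valued_def e)
  have lp: "last p = u"
  proof -
    obtain xs ys where xy: "p = xs @ u # ys" using p(2) by (meson split_list)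
    have "ys = []"
    proof (cases ys)
      case (Cons y zs)
      then show ?thesis using sp(1) xy nu successively_split by fastforce
    qed
    with xy show ?thesis by simp
  qed
  have hq: "hd q = v"
  proof -
    obtain xs ys where xy: "q = xs @ v # ys" using q(2) by (meson split_list)
    have "xs = []"
    proof (cases xs rule: rev_cases)
      case (snoc zs y)
      then show ?thesis using sp(2) xy nv successively_split by fastforce
    qed
    with xy show ?thesis by simp
  qed
  \<comment> \<open>Joining a path to itself would close a directed cycle, along which
    \<open>key\<close> cannot keep increasing.\<close>
  have "p \<noteq> q"
  proof
    assume "p = q"
    then have "key v \<le> key u"
      using successively_key_mono[OF sp(1,3), of key] lp hq insert.prems(4) by force
    moreover have "key u < key v" using insert.prems(4) e by auto
    ultimately show False by simp
  qed
  then have qr: "q \<in> set (remove1 p ps)" using q(1) by simp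
  define R where "R = remove1 q (remove1 p ps)"
  have ms: "mset ps = add_mset p (add_mset q (mset R))"
  proof -
    have "mset ps = add_mset p (mset (remove1 p ps))" using p(1) by simp
    also have "mset (remove1 p ps) = add_mset q (mset R)" unfolding R_def
      using qr by (subst mset_remove1[of q]) (simp del: mset_remove1)
    finally show ?thesis .
  qed
  let ?ps = "(p @ q) # R"
  have msc: "mset (concat ?ps) = mset (concat ps)"
    by (simp add: mset_concat sum_mset_sum_list[symmetric] ms)
  have set: "set ps = insert p (insert q (set R))"
    by (metis ms set_mset_mset set_mset_add_mset_insert)
  have len: "length ps = Suc (Suc (length R))"
    by (metis ms size_mset size_add_mset)
  have "distinct (concat ?ps)"
    using mset_eq_imp_distinct_iff[OF msc] ps(1) by (simp add: path_system_def)
  moreover have "set (concat ?ps) = V"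
    using mset_eq_setD[OF msc] ps(2) by simp
  moreover have "successively (\<lambda>u v. (u, v) \<in> insert e M) r" if "r \<in> set ps" for r
    using ps(1) that by (auto simp: path_system_def intro: successively_mono)
  moreover have "[] \<notin> set ps" using ps(1) by (simp add: path_system_def)
  ultimately have "path_system (\<lambda>u v. (u, v) \<in> insert e M) ?ps" "set (concat ?ps) = V"
    using set sp(3,4) lp hq e p(1) q(1)
    by (auto simp: path_system_def successively_append_iff)
  moreover have "length ?ps + card (insert e M) = card V"
    using ps(3) len insert.hyps by simp
  ultimately show ?case by blast
qed

section \<open>Path covers with few paths\<close>

lemma path_system_mono:
  "path_system G ps \<Longrightarrow> (\<And>u v. G u v \<Longrightarrow> G' u v) \<Longrightarrow> path_system G' ps"
  unfolding path_system_def using successively_mono by metis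

text \<open>
  The arcs inside a block only go upwards, so a permutation that uses them has no cycle inside a
  block. In Hall's condition let \<open>T\<close> be the set of vertices not reached from \<open>S\<close> by \<open>A\<close>: the
  only vertices of \<open>S \<inter> T\<close> that can fail to be reached are the least ones of their blocks, and
  for \<open>b \<in> S \<inter> T\<close> the mutual neighbourhood of \<open>b\<close> is disjoint from \<open>S \<union> T\<close> and makes up for them.
\<close>

lemma permutation_step:
  fixes V :: "nat set" and \<beta> :: "nat \<Rightarrow> nat"
  assumes V: "finite V"
    and cond: "\<And>b. b \<in> V \<Longrightarrow>
      card (\<beta> ` {v \<in> V. \<not> (A b v \<and> A v b)}) \<le> card {v \<in> V. A b v \<and> A v b}"
  shows "\<exists>\<sigma>. bij_betw \<sigma> V V \<and> (\<forall>u\<in>V. A u (\<sigma> u) \<or> (\<beta> u = \<beta> (\<sigma> u) \<and> u < \<sigma> u))"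
proof -
  let ?N = "\<lambda>u. {v \<in> V. A u v \<or> (\<beta> u = \<beta> v \<and> u < v)}"
  have "\<exists>f. inj_on f V \<and> (\<forall>x\<in>V. f x \<in> ?N x)"
  proof (rule hall)
    fix S assume S: "S \<subseteq> V"
    define T where "T = {v \<in> V. \<forall>u\<in>S. \<not> A u v}"
    define X where "X = S \<inter> T"
    define X' where "X' = {x \<in> X. \<exists>y\<in>X. \<beta> y = \<beta> x \<and> y < x}"
    have fin: "finite S" "finite T" "finite X" "finite X'"
      using S V by (auto simp: T_def X_def X'_def intro: finite_subset)
    have sub: "(V - T) \<union> X' \<subseteq> \<Union> (?N ` S)"
      by (auto simp: T_def X'_def X_def)
    have fU: "finite (\<Union> (?N ` S))" using fin V by auto
    show "card S \<le> card (\<Union> (?N ` S))"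
    proof (cases "X = {}")
      case True
      then have "S \<subseteq> \<Union> (?N ` S)" using sub S by (auto simp: X_def)
      then show ?thesis using fU by (rule card_mono[rotated])
    next
      case False
      then obtain b where b: "b \<in> X" by auto
      have bV: "b \<in> V" "b \<in> S" "b \<in> T" using b S by (auto simp: X_def)
      define I where "I = {v \<in> V. A b v \<and> A v b}"
      have I: "I \<inter> S = {}" "I \<inter> T = {}" "I \<subseteq> V"
        using bV by (auto simp: I_def T_def)
      have "card (X - X') \<le> card (\<beta> ` {v \<in> V. \<not> (A b v \<and> A v b)})"
      proof (rule card_inj_on_le)
        show "inj_on \<beta> (X - X')"
        proof (rule inj_onI, rule ccontr)
          fix x y assume xy: "x \<in> X - X'" "y \<in> X - X'" "\<beta> x = \<beta> y" "x \<noteq> y"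
          then have "x < y \<or> y < x" by auto
          then show False using xy by (auto simp: X'_def)
        qed
        show "\<beta> ` (X - X') \<subseteq> \<beta> ` {v \<in> V. \<not> (A b v \<and> A v b)}"
          using S I by (auto simp: X_def I_def)
      qed (use V in auto)
      then have 1: "card (X - X') \<le> card I" using cond[OF bV(1)] by (simp add: I_def)
      have "card X = card X' + card (X - X')"
        using fin by (intro card_split) (auto simp: X'_def)
      moreover have "card S = card (S - T) + card X"
        using card_split[of S X] fin by (simp add: X_def Diff_Int)
      moreover have "card ((S - T) \<union> I \<union> X') = card (S - T) + card I + card X'"
        using fin I V by (subst card_Un_disjoint; (subst card_Un_disjoint)?)
          (auto simp: X'_def X_def intro: finite_subset)
      moreover have "card ((S - T) \<union> I \<union> X') \<le> card (\<Union> (?N ` S))"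
        by (rule card_mono[OF fU]) (use sub I S in auto)
      ultimately show ?thesis using 1 by linarith
    qed
  qed (use V in auto)
  then obtain f where f: "inj_on f V" "\<And>x. x \<in> V \<Longrightarrow> f x \<in> ?N x" by blast
  then have "f ` V \<subseteq> V" by auto
  with f(1) have "bij_betw f V V" by (simp add: V endo_inj_surj bij_betw_def)
  with f show ?thesis by blast
qed

text \<open>The next permutation is sought after deleting from \<open>E\<close> all arcs of the
  earlier ones. At each vertex at most \<open>k\<close> out-arcs and \<open>k\<close> in-arcs
  vanish, which costs up to \<open>2 * k\<close> on either side of the condition; hence the
  \<open>4 * k\<close>. Deletion destroys symmetry, which is why \<open>permutation_step\<close>
  counts mutual neighbours. Arcs inside a block may be used repeatedly.\<close>

lemma permutation_family:
  fixes V :: "nat set" and \<beta> :: "nat \<Rightarrow> nat"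
  assumes V: "finite V" and sym: "\<And>u v. u \<in> V \<Longrightarrow> v \<in> V \<Longrightarrow> E u v \<Longrightarrow> E v u"
    and cond: "\<And>b. b \<in> V \<Longrightarrow> card (\<beta> ` {v \<in> V. \<not> E b v}) + 4 * k \<le> card {v \<in> V. E b v}"
  shows "\<exists>\<sigma>. (\<forall>t<k. bij_betw (\<sigma> t) V V) \<and>
    (\<forall>t<k. \<forall>u\<in>V. E u (\<sigma> t u) \<or> (\<beta> u = \<beta> (\<sigma> t u) \<and> u < \<sigma> t u)) \<and>
    (\<forall>t<k. \<forall>s<t. \<forall>u\<in>V. \<sigma> s u = \<sigma> t u \<longrightarrow> \<beta> u = \<beta> (\<sigma> t u))"
  using cond
proof (induction k)
  case (Suc k)
  have "\<exists>\<sigma>. (\<forall>t<k. bij_betw (\<sigma> t) V V) \<and>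
    (\<forall>t<k. \<forall>u\<in>V. E u (\<sigma> t u) \<or> (\<beta> u = \<beta> (\<sigma> t u) \<and> u < \<sigma> t u)) \<and>
    (\<forall>t<k. \<forall>s<t. \<forall>u\<in>V. \<sigma> s u = \<sigma> t u \<longrightarrow> \<beta> u = \<beta> (\<sigma> t u))"
  proof (rule Suc.IH)
    fix b assume "b \<in> V"
    then show "card (\<beta> ` {v \<in> V. \<not> E b v}) + 4 * k \<le> card {v \<in> V. E b v}" using Suc.prems[of b] by simp
  qed
  then obtain \<sigma> where \<sigma>': "\<forall>t<k. bij_betw (\<sigma> t) V V"
    "\<forall>t<k. \<forall>u\<in>V. E u (\<sigma> t u) \<or> (\<beta> u = \<beta> (\<sigma> t u) \<and> u < \<sigma> t u)"
    "\<forall>t<k. \<forall>s<t. \<forall>u\<in>V. \<sigma> s u = \<sigma> t u \<longrightarrow> \<beta> u = \<beta> (\<sigma> t u)" by (elim exE conjE)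
  note \<sigma> = \<sigma>'[rule_format]
  define A where "A u v \<longleftrightarrow> E u v \<and> (\<forall>s<k. \<sigma> s u \<noteq> v)" for u v
  have "\<exists>\<tau>. bij_betw \<tau> V V \<and> (\<forall>u\<in>V. A u (\<tau> u) \<or> (\<beta> u = \<beta> (\<tau> u) \<and> u < \<tau> u))"
  proof (rule permutation_step[OF V])
    fix b assume b: "b \<in> V"
    define R where "R = (\<lambda>s. \<sigma> s b) ` {..<k} \<union> (\<lambda>s. inv_into V (\<sigma> s) b) ` {..<k}"
    have "card R \<le> card ((\<lambda>s. \<sigma> s b) ` {..<k}) + card ((\<lambda>s. inv_into V (\<sigma> s) b) ` {..<k})"
      unfolding R_def by (rule card_Un_le)
    also have "\<dots> \<le> k + k"
      using card_image_le[of "{..<k}" "\<lambda>s. \<sigma> s b"] card_image_le[of "{..<k}" "\<lambda>s. inv_into V (\<sigma> s) b"]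
      by simp
    finally have R: "card R \<le> 2 * k" by simp
    have arith: "a \<le> b + 2 * k \<Longrightarrow> c \<le> d + 2 * k \<Longrightarrow> b + 4 * Suc k \<le> c \<Longrightarrow> a \<le> d" for a b c d :: nat
      by simp
    have fR: "finite R" by (simp add: R_def)
    have AE: "A b v \<and> A v b" if "v \<in> V" "E b v" "v \<notin> R" for v
    proof -
      have "\<sigma> s v \<noteq> b" if "s < k" for s
      proof
        assume "\<sigma> s v = b"
        then have "inv_into V (\<sigma> s) b = v"
          using \<sigma>(1)[OF that] \<open>v \<in> V\<close> by (auto simp: bij_betw_def)
        then show False using \<open>v \<notin> R\<close> that by (auto simp: R_def)
      qed
      moreover have "\<sigma> s b \<noteq> v" if "s < k" for s using that \<open>v \<notin> R\<close> by (auto simp: R_def)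
      ultimately show ?thesis using that sym b by (auto simp: A_def)
    qed
    have "{v \<in> V. E b v} \<subseteq> {v \<in> V. A b v \<and> A v b} \<union> R" using AE by auto
    then have "card {v \<in> V. E b v} \<le> card ({v \<in> V. A b v \<and> A v b} \<union> R)"
      using V fR by (intro card_mono) auto
    also have "\<dots> \<le> card {v \<in> V. A b v \<and> A v b} + 2 * k"
      using card_Un_le[of "{v \<in> V. A b v \<and> A v b}" R] R by linarith
    finally have 1: "card {v \<in> V. E b v} \<le> card {v \<in> V. A b v \<and> A v b} + 2 * k" .
    have "\<beta> ` {v \<in> V. \<not> (A b v \<and> A v b)} \<subseteq> \<beta> ` {v \<in> V. \<not> E b v} \<union> \<beta> ` R" using AE by auto
    then have "card (\<beta> ` {v \<in> V. \<not> (A b v \<and> A v b)}) \<le> card (\<beta> ` {v \<in> V. \<not> E b v} \<union> \<beta> ` R)"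
      using V fR by (intro card_mono) auto
    also have "\<dots> \<le> card (\<beta> ` {v \<in> V. \<not> E b v}) + 2 * k"
      using card_Un_le[of "\<beta> ` {v \<in> V. \<not> E b v}" "\<beta> ` R"] card_image_le[OF fR, of \<beta>] R by linarith
    finally show "card (\<beta> ` {v \<in> V. \<not> (A b v \<and> A v b)}) \<le> card {v \<in> V. A b v \<and> A v b}"
      using 1 Suc.prems[OF b] by (rule arith)
  qed
  then obtain \<tau> where \<tau>: "bij_betw \<tau> V V"
    "\<And>u. u \<in> V \<Longrightarrow> A u (\<tau> u) \<or> (\<beta> u = \<beta> (\<tau> u) \<and> u < \<tau> u)" by blast
  let ?\<sigma> = "\<sigma>(k := \<tau>)"
  have bij: "bij_betw (?\<sigma> t) V V" if "t < Suc k" for t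
    using that \<sigma>(1) \<tau>(1) by (auto simp: less_Suc_eq)
  have arcs: "E u (?\<sigma> t u) \<or> (\<beta> u = \<beta> (?\<sigma> t u) \<and> u < ?\<sigma> t u)" if "t < Suc k" "u \<in> V" for t u
    using that \<sigma>(2) \<tau>(2) by (auto simp: less_Suc_eq A_def)
  have new: "\<beta> u = \<beta> (?\<sigma> t u)" if "t < Suc k" "s < t" "u \<in> V" "?\<sigma> s u = ?\<sigma> t u" for t s u
    using that \<sigma>(3)[of t s u] \<tau>(2)[of u] by (auto simp: less_Suc_eq A_def)
  show ?case
    by (rule exI[of _ ?\<sigma>], intro conjI allI impI ballI, erule bij, erule (1) arcs, erule (3) new)
qed auto

section \<open>Moments of a random layering of the blocks\<close>

text \<open>Redrawing the value at \<open>b\<close> preserves the uniform distribution: exchanging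
  \<open>f b\<close> with the fresh value \<open>a\<close> is an involution on the pairs
  \<open>(f, a)\<close>.\<close>

lemma sum_PiE_resample:
  fixes h :: "('i \<Rightarrow> nat) \<Rightarrow> real"
  assumes "finite I" "b \<in> I" "L > 0"
    and "\<And>f. f \<in> PiE I (\<lambda>_. {..<L}) \<Longrightarrow> (\<Sum>a<L. h (f(b := a))) = 0"
  shows "(\<Sum>f\<in>PiE I (\<lambda>_. {..<L}). h f) = 0"
proof -
  let ?F = "PiE I (\<lambda>_. {..<L})"
  have fin: "finite ?F" using assms by (intro finite_PiE) auto
  have bij: "bij_betw (\<lambda>(f, a). (f(b := a), f b)) (?F \<times> {..<L}) (?F \<times> {..<L})"
    by (rule bij_betwI[where g = "\<lambda>(f, a). (f(b := a), f b)"])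
      (use assms(2) in \<open>auto simp: PiE_iff extensional_def\<close>)
  have "0 = (\<Sum>f\<in>?F. \<Sum>a<L. h (f(b := a)))" using assms(4) by simp
  also have "\<dots> = (\<Sum>x\<in>?F \<times> {..<L}. h (fst (case x of (f, a) \<Rightarrow> (f(b := a), f b))))"
    by (simp add: sum.cartesian_product case_prod_unfold)
  also have "\<dots> = (\<Sum>x\<in>?F \<times> {..<L}. h (fst x))"
    by (rule sum.reindex_bij_betw[OF bij, of "\<lambda>x. h (fst x)"])
  also have "\<dots> = (\<Sum>f\<in>?F. \<Sum>a<L. h f)" by (subst sum.cartesian_product) (simp add: case_prod_unfold)
  also have "\<dots> = real L * (\<Sum>f\<in>?F. h f)" by (simp add: sum_distrib_left)
  finally show ?thesis using assms(3) by simp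
qed

text \<open>Here \<open>f\<close> is a layering of the blocks and \<open>g\<close> gives the
  successor or predecessor of a layer. An arc between the blocks \<open>b\<close> and
  \<open>c\<close> survives with probability \<open>1 / L\<close> and then weighs \<open>L\<close>;
  subtracting 1 centres the weight, whatever the layer of \<open>c\<close> is.\<close>

definition layer_dev :: "nat \<Rightarrow> (nat \<Rightarrow> nat) \<Rightarrow> 'i \<Rightarrow> ('i \<Rightarrow> nat) \<Rightarrow> 'i \<Rightarrow> real" where
  "layer_dev L g c f b = (if f b = g (f c) then real L else 0) - 1"

lemma abs_layer_dev: "L > 0 \<Longrightarrow> \<bar>layer_dev L g c f b\<bar> \<le> real L"
  by (auto simp: layer_dev_def)

lemma sum_layer_dev:
  assumes "g (f c) < L" "b \<noteq> c"
  shows "(\<Sum>a<L. layer_dev L g c (f(b := a)) b) = 0"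
  using assms by (simp add: layer_dev_def sum_subtractf sum.delta)

text \<open>Deviations at different blocks are uncorrelated, so only pairs with
  \<open>b s = b t\<close> contribute, and each \<open>t\<close> has at most \<open>r\<close> such
  partners.\<close>

lemma layering_second_moment:
  fixes b :: "'t \<Rightarrow> 'i"
  assumes I: "finite I" "c \<in> I" and L: "L > 0" and g: "\<And>a. a < L \<Longrightarrow> g a < L"
    and T: "finite T" "\<And>t. t \<in> T \<Longrightarrow> b t \<in> I - {c}"
    and r: "\<And>i. card {t \<in> T. b t = i} \<le> r"
  shows "(\<Sum>f\<in>PiE I (\<lambda>_. {..<L}). (\<Sum>t\<in>T. layer_dev L g c f (b t))\<^sup>2)
    \<le> real (card (PiE I (\<lambda>_. {..<L}))) * real (card T) * real r * (real L)\<^sup>2"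
proof -
  let ?F = "PiE I (\<lambda>_. {..<L})" and ?\<chi> = "layer_dev L g c"
  have pair: "(\<Sum>f\<in>?F. ?\<chi> f (b t) * ?\<chi> f (b s)) \<le> (if b s = b t then real (card ?F) * (real L)\<^sup>2 else 0)"
    if t: "t \<in> T" and s: "s \<in> T" for t s
  proof (cases "b s = b t")
    case True
    have "?\<chi> f (b t) * ?\<chi> f (b t) \<le> (real L)\<^sup>2" for f
      using abs_layer_dev[OF L, of g c f "b t"] by (metis abs_le_square_iff abs_of_nat power2_eq_square)
    then have "(\<Sum>f\<in>?F. ?\<chi> f (b t) * ?\<chi> f (b t)) \<le> (\<Sum>f\<in>?F. (real L)\<^sup>2)" by (intro sum_mono)
    then show ?thesis using True by simp
  next
    case False
    \<comment> \<open>The layer of block \<open>b t\<close> is redrawn, which affects neither block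
      \<open>c\<close> nor the other factor.\<close>
    have "(\<Sum>f\<in>?F. ?\<chi> f (b t) * ?\<chi> f (b s)) = 0"
    proof (rule sum_PiE_resample[OF I(1) _ L])
      show "b t \<in> I" using T t by auto
      fix f assume f: "f \<in> ?F"
      have "f c < L" using f I by auto
      moreover have "b t \<noteq> c" using T t by auto
      moreover have "?\<chi> (f(b t := a)) (b s) = ?\<chi> f (b s)" for a
        using False \<open>b t \<noteq> c\<close> by (auto simp: layer_dev_def)
      ultimately show "(\<Sum>a<L. ?\<chi> (f(b t := a)) (b t) * ?\<chi> (f(b t := a)) (b s)) = 0"
        using sum_layer_dev[of g f c L "b t"] g by (simp add: sum_distrib_right[symmetric])
    qed
    then show ?thesis using False by simp
  qed
  have "(\<Sum>f\<in>?F. (\<Sum>t\<in>T. ?\<chi> f (b t))\<^sup>2) = (\<Sum>f\<in>?F. \<Sum>t\<in>T. \<Sum>s\<in>T. ?\<chi> f (b t) * ?\<chi> f (b s))"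
    by (simp add: power2_eq_square sum_product)
  also have "\<dots> = (\<Sum>t\<in>T. \<Sum>s\<in>T. \<Sum>f\<in>?F. ?\<chi> f (b t) * ?\<chi> f (b s))"
    by (subst sum.swap, intro sum.cong refl, subst sum.swap) simp
  also have "\<dots> \<le> (\<Sum>t\<in>T. \<Sum>s\<in>T. if b s = b t then real (card ?F) * (real L)\<^sup>2 else 0)"
    by (intro sum_mono pair)
  also have "\<dots> = (\<Sum>t\<in>T. real (card {s \<in> T. b s = b t}) * (real (card ?F) * (real L)\<^sup>2))"
    using T(1) by (simp add: sum.If_cases Int_def conj_commute)
  also have "\<dots> \<le> (\<Sum>t\<in>T. real r * (real (card ?F) * (real L)\<^sup>2))"
    by (intro sum_mono mult_right_mono) (use r in auto)
  also have "\<dots> = real (card ?F) * real (card T) * real r * (real L)\<^sup>2" by (simp add: mult_ac)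
  finally show ?thesis .
qed

text \<open>The elementary bound \<open>am\<close> takes the place of the Cauchy-Schwarz inequality.
  For fixed \<open>\<theta>\<close>, \<open>r\<close> and \<open>L\<close> the second error term
  vanishes as \<open>k\<close> grows.\<close>

lemma layering_first_moment:
  fixes b :: "'t \<Rightarrow> 'i"
  assumes I: "finite I" "c \<in> I" and L: "L > 0" and g: "\<And>a. a < L \<Longrightarrow> g a < L"
    and T: "finite T" "\<And>t. t \<in> T \<Longrightarrow> b t \<in> I - {c}" "card T \<le> k"
    and r: "\<And>i. card {t \<in> T. b t = i} \<le> r" and k: "k > 0" and \<theta>: "\<theta> > 0"
  shows "(\<Sum>f\<in>PiE I (\<lambda>_. {..<L}). \<bar>(\<Sum>t\<in>T. layer_dev L g c f (b t)) / real k\<bar>)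
    \<le> real (card (PiE I (\<lambda>_. {..<L}))) * (\<theta> + real r * (real L)\<^sup>2 / (real k * \<theta>))"
proof -
  let ?F = "PiE I (\<lambda>_. {..<L})" and ?Y = "\<lambda>f. \<Sum>t\<in>T. layer_dev L g c f (b t)"
  have am: "\<bar>y\<bar> \<le> \<theta> + y\<^sup>2 / \<theta>" for y :: real
  proof -
    have "0 \<le> (\<bar>y\<bar> - \<theta> / 2)\<^sup>2 + 3 * \<theta>\<^sup>2 / 4" by simp
    then have "\<bar>y\<bar> * \<theta> \<le> \<theta> * \<theta> + y\<^sup>2" by (simp add: power2_eq_square algebra_simps)
    then show ?thesis using \<theta> by (simp add: field_simps)
  qed
  have "(\<Sum>f\<in>?F. \<bar>?Y f / real k\<bar>) \<le> (\<Sum>f\<in>?F. \<theta> + (?Y f / real k)\<^sup>2 / \<theta>)"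
    by (intro sum_mono am)
  also have "\<dots> = real (card ?F) * \<theta> + (\<Sum>f\<in>?F. (?Y f)\<^sup>2) / ((real k)\<^sup>2 * \<theta>)"
    by (simp add: sum.distrib power_divide sum_divide_distrib[of _ _ "(real k)\<^sup>2 * \<theta>"])
  also have "(\<Sum>f\<in>?F. (?Y f)\<^sup>2) \<le> real (card ?F) * real (card T) * real r * (real L)\<^sup>2"
    by (rule layering_second_moment) (use assms in auto)
  also have "\<dots> \<le> real (card ?F) * real k * real r * (real L)\<^sup>2"
    using T(3) by (intro mult_mono) auto
  finally have "(\<Sum>f\<in>?F. \<bar>?Y f / real k\<bar>) \<le>
      real (card ?F) * \<theta> + real (card ?F) * real k * real r * (real L)\<^sup>2 / ((real k)\<^sup>2 * \<theta>)"
    using \<theta> k by (simp add: divide_right_mono)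
  also have "\<dots> = real (card ?F) * (\<theta> + real r * (real L)\<^sup>2 / (real k * \<theta>))"
    using \<theta> k by (simp add: field_simps power2_eq_square)
  finally show ?thesis .
qed

text \<open>
  The average of \<open>k\<close> permutations that share no arc between blocks is a doubly stochastic matrix
  with small entries between blocks. In a random assignment of the blocks to \<open>L\<close> layers, keeping
  only the arcs inside a block or from one layer to the next, and giving the latter weight \<open>L\<close>,
  nearly preserves row and column sums. The remaining digraph is acyclic, so a nearly perfect
  matching of out-copies with in-copies is a path system with few paths.
\<close>

lemma path_cover:
  fixes V :: "nat set" and \<beta> :: "nat \<Rightarrow> nat"
  assumes V: "finite V" and sym: "\<And>u v. u \<in> V \<Longrightarrow> v \<in> V \<Longrightarrow> E u v \<Longrightarrow> E v u"
    and E\<beta>: "\<And>u v. u \<in> V \<Longrightarrow> v \<in> V \<Longrightarrow> E u v \<Longrightarrow> \<beta> u \<noteq> \<beta> v"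
    and r: "\<And>i. card {v \<in> V. \<beta> v = i} \<le> r"
    and cond: "\<And>b. b \<in> V \<Longrightarrow> card (\<beta> ` {v \<in> V. \<not> E b v}) + 4 * k \<le> card {v \<in> V. E b v}"
    and k: "k > 0" and L: "L > 0" and \<theta>: "\<theta> > 0"
  shows "\<exists>ps. path_system (\<lambda>u v. E u v \<or> (\<beta> u = \<beta> v \<and> u \<noteq> v)) ps \<and> set (concat ps) = V \<and>
    real (length ps) \<le> real (card V) * (1 / real L + 2 * (\<theta> + real r * (real L)\<^sup>2 / (real k * \<theta>)))"
proof -
  have "\<exists>\<sigma>. (\<forall>t<k. bij_betw (\<sigma> t) V V) \<and>
    (\<forall>t<k. \<forall>u\<in>V. E u (\<sigma> t u) \<or> (\<beta> u = \<beta> (\<sigma> t u) \<and> u < \<sigma> t u)) \<and>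
    (\<forall>t<k. \<forall>s<t. \<forall>u\<in>V. \<sigma> s u = \<sigma> t u \<longrightarrow> \<beta> u = \<beta> (\<sigma> t u))"
    by (rule permutation_family[OF V]) (use sym cond in auto)
  then obtain \<sigma> where \<sigma>': "\<forall>t<k. bij_betw (\<sigma> t) V V"
    "\<forall>t<k. \<forall>u\<in>V. E u (\<sigma> t u) \<or> (\<beta> u = \<beta> (\<sigma> t u) \<and> u < \<sigma> t u)"
    "\<forall>t<k. \<forall>s<t. \<forall>u\<in>V. \<sigma> s u = \<sigma> t u \<longrightarrow> \<beta> u = \<beta> (\<sigma> t u)" by (elim exE conjE)
  note \<sigma> = \<sigma>'[rule_format]
  \<comment> \<open>Different permutations send \<open>u\<close> to different vertices outside its
    block. Hence another block is hit for at most \<open>r\<close> values of \<open>t\<close>, which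
    is the multiplicity bound of the moment estimates.\<close>
  have neq: "\<sigma> s u \<noteq> \<sigma> t u" if "t < k" "s < k" "s \<noteq> t" "u \<in> V" "\<beta> (\<sigma> t u) \<noteq> \<beta> u" for s t u
  proof
    assume eq: "\<sigma> s u = \<sigma> t u"
    have "s < t \<or> t < s" using that by auto
    then show False using \<sigma>(3)[of t s u] \<sigma>(3)[of s t u] that eq by auto
  qed
  define \<tau> where "\<tau> t = inv_into V (\<sigma> t)" for t
  have \<tau>: "\<tau> t v \<in> V" "\<sigma> t (\<tau> t v) = v" if "t < k" "v \<in> V" for t v
    using \<sigma>(1)[OF that(1)] that(2) by (auto simp: \<tau>_def bij_betw_def inv_into_into f_inv_into_f)
  have \<tau>\<sigma>: "\<tau> t (\<sigma> t u) = u" if "t < k" "u \<in> V" for t u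
    using \<sigma>(1)[OF that(1)] that(2) by (auto simp: \<tau>_def bij_betw_def)
  have \<sigma>V: "\<sigma> t u \<in> V" if "t < k" "u \<in> V" for t u
    using \<sigma>(1)[OF that(1)] that(2) by (auto simp: bij_betw_def)
  define I where "I = \<beta> ` V"
  define F where "F = PiE I (\<lambda>_. {..<L})"
  have finI: "finite I" using V by (simp add: I_def)
  have finF: "finite F" using finI by (auto simp: F_def intro: finite_PiE)
  have cardF: "card F > 0"
  proof -
    have "(\<lambda>i\<in>I. 0) \<in> F" using L by (auto simp: F_def)
    then show ?thesis using finF by (auto simp: card_gt_0_iff)
  qed
  \<comment> \<open>The wrap-around keeps \<open>nxt\<close> inside the layers, so that the
    deviations have mean 0; the arcs out of the last layer are not kept, and \<open>Z\<close>
    accounts for this loss. The truncation \<open>prv 0 = 0\<close> can only overestimate column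
    sums, which is the harmless direction.\<close>
  define nxt where "nxt a = (if Suc a < L then Suc a else 0)" for a
  define prv where "prv a = a - Suc 0" for a :: nat
  define T where "T u = {t. t < k \<and> \<beta> (\<sigma> t u) \<noteq> \<beta> u}" for u
  define T' where "T' v = {t. t < k \<and> \<beta> (\<tau> t v) \<noteq> \<beta> v}" for v
  define Y where "Y u f = (\<Sum>t\<in>T u. layer_dev L nxt (\<beta> u) f (\<beta> (\<sigma> t u))) / real k" for u f
  define Y' where "Y' v f = (\<Sum>t\<in>T' v. layer_dev L prv (\<beta> v) f (\<beta> (\<tau> t v))) / real k" for v f
  define Z where "Z u f = (if f (\<beta> u) = L - 1 then 1 else 0 :: real)" for u f
  define B where "B = \<theta> + real r * (real L)\<^sup>2 / (real k * \<theta>)"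
  have Y: "(\<Sum>f\<in>F. \<bar>Y u f\<bar>) \<le> real (card F) * B" if u: "u \<in> V" for u
    unfolding F_def B_def Y_def
  proof (rule layering_first_moment)
    fix i
    have "inj_on (\<lambda>t. \<sigma> t u) {t \<in> T u. \<beta> (\<sigma> t u) = i}"
    proof (rule inj_onI, rule ccontr)
      fix s t assume "s \<in> {t \<in> T u. \<beta> (\<sigma> t u) = i}" "t \<in> {t \<in> T u. \<beta> (\<sigma> t u) = i}" "\<sigma> s u = \<sigma> t u" "s \<noteq> t"
      then show False using neq[of t s u] u by (auto simp: T_def)
    qed
    then have "card {t \<in> T u. \<beta> (\<sigma> t u) = i} \<le> card {v \<in> V. \<beta> v = i}"
      by (rule card_inj_on_le) (use V u \<sigma>V in \<open>auto simp: T_def\<close>)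
    then show "card {t \<in> T u. \<beta> (\<sigma> t u) = i} \<le> r" using r[of i] by simp
  next
    have "T u \<subseteq> {..<k}" by (auto simp: T_def)
    then show "card (T u) \<le> k" using card_mono[of "{..<k}" "T u"] by simp
  qed (use finI L k \<theta> u \<sigma>V in \<open>auto simp: nxt_def I_def T_def\<close>)
  have Y': "(\<Sum>f\<in>F. \<bar>Y' u f\<bar>) \<le> real (card F) * B" if u: "u \<in> V" for u
    unfolding F_def B_def Y'_def
  proof (rule layering_first_moment)
    fix i
    have "inj_on (\<lambda>t. \<tau> t u) {t \<in> T' u. \<beta> (\<tau> t u) = i}"
    proof (rule inj_onI, rule ccontr)
      fix s t assume st: "s \<in> {t \<in> T' u. \<beta> (\<tau> t u) = i}" "t \<in> {t \<in> T' u. \<beta> (\<tau> t u) = i}" "\<tau> s u = \<tau> t u" "s \<noteq> t"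
      then have "\<sigma> s (\<tau> t u) = \<sigma> t (\<tau> t u)" using \<tau>(2)[of s u] \<tau>(2)[of t u] u by (auto simp: T'_def)
      then show False using neq[of t s "\<tau> t u"] u st \<tau>[of t u] by (auto simp: T'_def)
    qed
    then have "card {t \<in> T' u. \<beta> (\<tau> t u) = i} \<le> card {v \<in> V. \<beta> v = i}"
      by (rule card_inj_on_le) (use V u \<tau> in \<open>auto simp: T'_def\<close>)
    then show "card {t \<in> T' u. \<beta> (\<tau> t u) = i} \<le> r" using r[of i] by simp
  next
    have "T' u \<subseteq> {..<k}" by (auto simp: T'_def)
    then show "card (T' u) \<le> k" using card_mono[of "{..<k}" "T' u"] by simp
  qed (use finI L k \<theta> u \<tau> in \<open>auto simp: prv_def I_def T'_def\<close>)
  have Z: "(\<Sum>f\<in>F. Z u f) = real (card F) * (1 / real L)" if u: "u \<in> V" for u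
  proof -
    have "(\<Sum>f\<in>F. real L * Z u f - 1) = 0"
      unfolding F_def
    proof (rule sum_PiE_resample[OF finI _ L])
      show "\<beta> u \<in> I" using u by (simp add: I_def)
      show "(\<Sum>a<L. real L * Z u (f(\<beta> u := a)) - 1) = 0" for f
        using L by (simp add: Z_def sum_subtractf sum.delta if_distrib[of "(*) _"] cong: if_cong)
    qed
    then show ?thesis using L by (simp add: sum_subtractf sum_distrib_left[symmetric] field_simps)
  qed
  define D where "D = real (card V) * (1 / real L + 2 * B)"
  define tot where "tot f = (\<Sum>u\<in>V. Z u f + \<bar>Y u f\<bar> + \<bar>Y' u f\<bar>)" for f
  have "(\<Sum>f\<in>F. tot f) = (\<Sum>u\<in>V. \<Sum>f\<in>F. Z u f + \<bar>Y u f\<bar> + \<bar>Y' u f\<bar>)"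
    unfolding tot_def by (rule sum.swap)
  also have "\<dots> \<le> (\<Sum>u\<in>V. real (card F) * (1 / real L + 2 * B))"
  proof (rule sum_mono)
    fix u assume u: "u \<in> V"
    have "(\<Sum>f\<in>F. Z u f + \<bar>Y u f\<bar> + \<bar>Y' u f\<bar>) \<le>
        real (card F) * (1 / real L) + real (card F) * B + real (card F) * B"
      unfolding sum.distrib using Y[OF u] Y'[OF u] Z[OF u] by linarith
    also have "\<dots> = real (card F) * (1 / real L + 2 * B)" by algebra
    finally show "(\<Sum>f\<in>F. Z u f + \<bar>Y u f\<bar> + \<bar>Y' u f\<bar>) \<le> real (card F) * (1 / real L + 2 * B)" .
  qed
  also have "\<dots> = (\<Sum>f\<in>F. D)" by (simp add: D_def)
  \<comment> \<open>Some layering has a total error no larger than the average.\<close>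
  finally obtain f where f: "f \<in> F" "tot f \<le> D"
    using cardF by (metis (no_types, lifting) card_gt_0_iff linorder_not_le sum_strict_mono)
  have fL: "f (\<beta> u) < L" if "u \<in> V" for u using f that by (auto simp: F_def I_def)
  define N where "N u = {v \<in> V. (\<beta> u = \<beta> v \<and> u < v) \<or> (E u v \<and> f (\<beta> v) = Suc (f (\<beta> u)))}" for u
  define W where "W t u = (if \<beta> (\<sigma> t u) = \<beta> u then 1
      else if f (\<beta> (\<sigma> t u)) = Suc (f (\<beta> u)) then real L else 0)" for t u
  have W0: "W t u \<ge> 0" for t u by (simp add: W_def)
  have row: "1 - Z u f - \<bar>Y u f\<bar> \<le> (\<Sum>t<k. W t u) / real k" if u: "u \<in> V" for u
  proof (cases "f (\<beta> u) = L - 1")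
    case True
    then have "1 - Z u f - \<bar>Y u f\<bar> \<le> 0" by (simp add: Z_def)
    also have "0 \<le> (\<Sum>t<k. W t u) / real k" by (simp add: W0 sum_nonneg)
    finally show ?thesis .
  next
    case False
    then have n: "nxt (f (\<beta> u)) = Suc (f (\<beta> u))" using fL[OF u] by (auto simp: nxt_def)
    have "(\<Sum>t<k. W t u) = (\<Sum>t<k. 1 + (if t \<in> T u then layer_dev L nxt (\<beta> u) f (\<beta> (\<sigma> t u)) else 0))"
      by (intro sum.cong refl) (auto simp: W_def T_def layer_dev_def n)
    also have "\<dots> = real k + (\<Sum>t\<in>T u. layer_dev L nxt (\<beta> u) f (\<beta> (\<sigma> t u)))"
      by (simp add: sum.distrib sum.If_cases) (auto simp: T_def Int_def intro!: sum.cong)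
    finally have "(\<Sum>t<k. W t u) / real k = 1 + Y u f" using k by (simp add: Y_def field_simps)
    then show ?thesis using False abs_ge_minus_self[of "Y u f"] by (simp add: Z_def)
  qed
  have col: "(\<Sum>t<k. W t (\<tau> t v)) / real k \<le> 1 + \<bar>Y' v f\<bar>" if v: "v \<in> V" for v
  proof -
    have "(\<Sum>t<k. W t (\<tau> t v)) \<le> (\<Sum>t<k. 1 + (if t \<in> T' v then layer_dev L prv (\<beta> v) f (\<beta> (\<tau> t v)) else 0))"
      by (intro sum_mono) (use v in \<open>auto simp: W_def T'_def layer_dev_def prv_def \<tau>\<close>)
    also have "\<dots> = real k + (\<Sum>t\<in>T' v. layer_dev L prv (\<beta> v) f (\<beta> (\<tau> t v)))"
      by (simp add: sum.distrib sum.If_cases) (auto simp: T'_def Int_def intro!: sum.cong)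
    finally have "(\<Sum>t<k. W t (\<tau> t v)) / real k \<le> 1 + Y' v f" using k by (simp add: Y'_def field_simps)
    then show ?thesis by simp
  qed
  \<comment> \<open>Weighted double counting: the rows in \<open>S\<close> carry weight at least
    \<open>card S\<close> minus their errors, all of it lies in columns belonging to
    \<open>?NS\<close>, and a column carries at most 1 plus its error.\<close>
  have hall: "card S \<le> card (\<Union>(N ` S)) + nat \<lfloor>D\<rfloor>" if S: "S \<subseteq> V" for S
  proof -
    let ?NS = "\<Union>(N ` S)"
    have fS: "finite S" "finite ?NS" "?NS \<subseteq> V" using S V by (auto simp: N_def intro: finite_subset)
    have step: "(\<Sum>u\<in>S. W t u) \<le> (\<Sum>v\<in>?NS. W t (\<tau> t v))" if t: "t < k" for t
    proof -
      let ?S = "{u \<in> S. W t u \<noteq> 0}"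
      have inj: "inj_on (\<sigma> t) ?S" using \<sigma>(1)[OF t] S by (auto simp: bij_betw_def intro: inj_on_subset)
      have "(\<Sum>u\<in>S. W t u) = (\<Sum>u\<in>?S. W t u)" by (rule sum.mono_neutral_right) (use fS in auto)
      also have "\<dots> = (\<Sum>u\<in>?S. W t (\<tau> t (\<sigma> t u)))" by (intro sum.cong refl) (use S \<tau>\<sigma>[OF t] in auto)
      also have "\<dots> = (\<Sum>v\<in>\<sigma> t ` ?S. W t (\<tau> t v))" by (simp add: sum.reindex[OF inj])
      also have "\<dots> \<le> (\<Sum>v\<in>?NS. W t (\<tau> t v))"
      proof (rule sum_mono2)
        have "\<sigma> t u \<in> N u" if "u \<in> ?S" for u
          using that S \<sigma>V[OF t, of u] \<sigma>(2)[OF t, of u] E\<beta>[of u "\<sigma> t u"]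
          by (auto simp: N_def W_def split: if_splits)
        then show "\<sigma> t ` ?S \<subseteq> ?NS" by blast
      qed (use fS W0 in auto)
      finally show ?thesis .
    qed
    have "real (card S) - (\<Sum>u\<in>S. Z u f + \<bar>Y u f\<bar>) = (\<Sum>u\<in>S. 1 - Z u f - \<bar>Y u f\<bar>)"
      by (simp add: sum_subtractf sum.distrib)
    also have "\<dots> \<le> (\<Sum>u\<in>S. (\<Sum>t<k. W t u) / real k)" by (intro sum_mono row) (use S in auto)
    also have "\<dots> = (\<Sum>t<k. \<Sum>u\<in>S. W t u) / real k"
      by (subst sum.swap) (simp add: sum_divide_distrib)
    also have "\<dots> \<le> (\<Sum>t<k. \<Sum>v\<in>?NS. W t (\<tau> t v)) / real k"
      by (intro divide_right_mono sum_mono step) auto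
    also have "\<dots> = (\<Sum>v\<in>?NS. (\<Sum>t<k. W t (\<tau> t v)) / real k)"
      by (subst sum.swap) (simp add: sum_divide_distrib)
    also have "\<dots> \<le> (\<Sum>v\<in>?NS. 1 + \<bar>Y' v f\<bar>)" by (intro sum_mono col) (use fS in auto)
    also have "\<dots> = real (card ?NS) + (\<Sum>v\<in>?NS. \<bar>Y' v f\<bar>)" by (simp add: sum.distrib)
    also have "(\<Sum>v\<in>?NS. \<bar>Y' v f\<bar>) \<le> (\<Sum>v\<in>V. \<bar>Y' v f\<bar>)" by (rule sum_mono2) (use V fS in auto)
    finally have "real (card S) \<le> real (card ?NS) + ((\<Sum>u\<in>S. Z u f + \<bar>Y u f\<bar>) + (\<Sum>v\<in>V. \<bar>Y' v f\<bar>))"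
      by simp
    also have "(\<Sum>u\<in>S. Z u f + \<bar>Y u f\<bar>) \<le> (\<Sum>u\<in>V. Z u f + \<bar>Y u f\<bar>)"
      by (rule sum_mono2) (use V S in \<open>auto simp: Z_def\<close>)
    also have "(\<Sum>u\<in>V. Z u f + \<bar>Y u f\<bar>) + (\<Sum>v\<in>V. \<bar>Y' v f\<bar>) = tot f"
      by (simp add: tot_def sum.distrib)
    finally have "real (card S) \<le> real (card ?NS) + D" using f(2) by simp
    then have "int (card S) - int (card ?NS) \<le> \<lfloor>D\<rfloor>" by (simp add: le_floor_iff)
    then show ?thesis by linarith
  qed
  obtain h Q where h: "Q \<subseteq> V" "card V \<le> card Q + nat \<lfloor>D\<rfloor>" "inj_on h Q" "\<forall>x\<in>Q. h x \<in> N x"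
    using hall_defect[OF V _ hall] V by (auto simp: N_def)
  define M where "M = (\<lambda>u. (u, h u)) ` Q"
  \<comment> \<open>Vertices are ordered by layer first and by number second; both kinds of kept
    arcs go upwards in this order.\<close>
  define key where "key v = f (\<beta> v) * Suc (Max V) + v" for v
  have finQ: "finite Q" using h V by (auto intro: finite_subset)
  have MN: "u \<in> V \<and> v \<in> N u" if "(u, v) \<in> M" for u v using that h by (auto simp: M_def)
  have "\<exists>ps. path_system (\<lambda>u v. (u, v) \<in> M) ps \<and> set (concat ps) = V \<and> length ps + card M = card V"
  proof (rule path_system_of_matching)
    show "M \<subseteq> V \<times> V" using MN by (auto simp: N_def)
    show "single_valued M" by (auto simp: M_def single_valued_def)
    show "single_valued (M\<inverse>)" using h(3) by (auto simp: M_def single_valued_def inj_on_def)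
    show "key u < key v" if "(u, v) \<in> M" for u v
    proof -
      have u: "u \<in> V" "v \<in> N u" using MN[OF that] by auto
      then have "u \<le> Max V" using V by simp
      then show ?thesis using u by (auto simp: N_def key_def)
    qed
  qed (use finQ V in \<open>auto simp: M_def\<close>)
  then obtain ps where ps: "path_system (\<lambda>u v. (u, v) \<in> M) ps" "set (concat ps) = V" "length ps + card M = card V"
    by blast
  have "card M = card Q" unfolding M_def by (rule card_image) (auto simp: inj_on_def)
  then have "length ps \<le> nat \<lfloor>D\<rfloor>" using ps(3) h(2) by linarith
  moreover have "D \<ge> 0" using \<theta> by (simp add: D_def B_def)
  ultimately have "real (length ps) \<le> D" by linarith
  moreover have "path_system (\<lambda>u v. E u v \<or> (\<beta> u = \<beta> v \<and> u \<noteq> v)) ps"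
    by (rule path_system_mono[OF ps(1)]) (use MN in \<open>auto simp: N_def\<close>)
  ultimately show ?thesis using ps(2) by (auto simp: D_def B_def)
qed

section \<open>Concentration for random orderings\<close>

text \<open>Expectation for a uniformly random ordering, written as a finite sum so that exposing
  the first entry is a mere regrouping.\<close>

definition perm_avg :: "'a set \<Rightarrow> ('a list \<Rightarrow> real) \<Rightarrow> real" where
  "perm_avg A f = (\<Sum>xs\<in>permutations_of_set A. f xs) / fact (card A)"

lemma perm_avg_mono:
  "(\<And>xs. xs \<in> permutations_of_set A \<Longrightarrow> f xs \<le> g xs) \<Longrightarrow> perm_avg A f \<le> perm_avg A g"
  by (auto simp: perm_avg_def intro!: divide_right_mono sum_mono)

lemma perm_avg_cong:
  "(\<And>xs. xs \<in> permutations_of_set A \<Longrightarrow> f xs = g xs) \<Longrightarrow> perm_avg A f = perm_avg A g"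
  by (auto simp: perm_avg_def intro!: sum.cong)

lemma perm_avg_const [simp]: "finite A \<Longrightarrow> perm_avg A (\<lambda>_. c) = c"
  by (simp add: perm_avg_def)

lemma perm_avg_sum: "perm_avg A (\<lambda>xs. \<Sum>i\<in>I. f i xs) = (\<Sum>i\<in>I. perm_avg A (f i))"
  unfolding perm_avg_def sum_divide_distrib[symmetric] by (subst sum.swap) simp

lemma perm_avg_cmult: "perm_avg A (\<lambda>xs. c * f xs) = c * perm_avg A f"
  by (simp add: perm_avg_def sum_distrib_left[symmetric])

lemma perm_avg_Cons:
  assumes "finite A" "A \<noteq> {}"
  shows "perm_avg A f = (\<Sum>x\<in>A. perm_avg (A - {x}) (\<lambda>xs. f (x # xs))) / real (card A)"
proof -
  have "(\<Sum>xs\<in>permutations_of_set A. f xs) = (\<Sum>x\<in>A. \<Sum>xs\<in>(#) x ` permutations_of_set (A - {x}). f xs)"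
    unfolding permutations_of_set_nonempty[OF assms(2)]
    by (rule sum.UNION_disjoint) (use assms in auto)
  also have "\<dots> = (\<Sum>x\<in>A. \<Sum>xs\<in>permutations_of_set (A - {x}). f (x # xs))"
    by (rule sum.cong[OF refl], subst sum.reindex) (auto simp: inj_on_def)
  finally have eq: "(\<Sum>xs\<in>permutations_of_set A. f xs) = \<dots>" .
  have fact: "fact (card A) = real (card A) * fact (card (A - {x}))" if "x \<in> A" for x
    using assms that by (simp add: card_gt_0_iff fact_reduce)
  have "perm_avg A f = (\<Sum>x\<in>A. (\<Sum>xs\<in>permutations_of_set (A - {x}). f (x # xs)) / fact (card A))"
    by (simp add: perm_avg_def eq sum_divide_distrib)
  also have "\<dots> = (\<Sum>x\<in>A. perm_avg (A - {x}) (\<lambda>xs. f (x # xs)) / real (card A))"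
    by (intro sum.cong refl) (simp add: fact perm_avg_def)
  finally show ?thesis by (simp add: sum_divide_distrib)
qed

lemma exp_le_quadratic:
  assumes "\<bar>t :: real\<bar> \<le> 1"
  shows "exp t \<le> 1 + t + t\<^sup>2"
proof (cases "t \<ge> 0")
  case True
  then show ?thesis using exp_bound[of t] assms by simp
next
  case False
  define s where "s = - t"
  have s: "s > 0" using False by (simp add: s_def)
  have "1 + s + s\<^sup>2 / 2 \<le> exp s" using exp_lower_Taylor_quadratic[of s] s by simp
  moreover have pos: "0 \<le> 1 - s + s\<^sup>2" using zero_le_power2[of "s - 1/2"] by (simp add: power2_eq_square algebra_simps)
  ultimately have "(1 + s + s\<^sup>2 / 2) * (1 - s + s\<^sup>2) \<le> exp s * (1 - s + s\<^sup>2)"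
    by (rule mult_right_mono)
  moreover have "(1 + s + s\<^sup>2 / 2) * (1 - s + s\<^sup>2) = 1 + s\<^sup>2 / 2 + s ^ 3 / 2 + s ^ 4 / 2"
    by (simp add: power2_eq_square power3_eq_cube power4_eq_xxxx field_simps)
  ultimately have "1 \<le> exp s * (1 - s + s\<^sup>2)" using s by (smt (verit) zero_le_power divide_nonneg_pos)
  then have "exp (- s) * 1 \<le> exp (- s) * (exp s * (1 - s + s\<^sup>2))" by (intro mult_left_mono) auto
  also have "\<dots> = 1 - s + s\<^sup>2" by (simp add: mult.assoc[symmetric] exp_add[symmetric])
  finally show ?thesis by (simp add: s_def)
qed

text \<open>A cheap form of Hoeffding's lemma: after centring, the linear term of
  \<open>exp_le_quadratic\<close> averages out, and all deviations from the mean are at most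
  \<open>c\<close>.\<close>

lemma mean_exp_le:
  assumes A: "finite A" "A \<noteq> {}" and g: "\<And>x y. x \<in> A \<Longrightarrow> y \<in> A \<Longrightarrow> \<bar>g x - g y\<bar> \<le> c" and c: "c \<le> 1"
  shows "(\<Sum>x\<in>A. exp (g x)) / real (card A) \<le> exp ((\<Sum>x\<in>A. g x) / real (card A) + c\<^sup>2)"
proof -
  define m where "m = (\<Sum>x\<in>A. g x) / real (card A)"
  have n: "real (card A) > 0" using A by (simp add: card_gt_0_iff)
  have sm: "(\<Sum>x\<in>A. g x) = real (card A) * m" using n by (simp add: m_def)
  have dev: "\<bar>g x - m\<bar> \<le> c" if x: "x \<in> A" for x
  proof -
    have "real (card A) * (g x - m) = (\<Sum>y\<in>A. g x - g y)" by (simp add: sum_subtractf sm algebra_simps)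
    then have "real (card A) * \<bar>g x - m\<bar> \<le> (\<Sum>y\<in>A. \<bar>g x - g y\<bar>)"
      by (metis abs_mult abs_of_nat sum_abs)
    also have "\<dots> \<le> (\<Sum>y\<in>A. c)" by (intro sum_mono g x)
    finally show ?thesis using n by simp
  qed
  have "(\<Sum>x\<in>A. exp (g x - m)) \<le> (\<Sum>x\<in>A. 1 + (g x - m) + c\<^sup>2)"
  proof (rule sum_mono)
    fix x assume x: "x \<in> A"
    have "(g x - m)\<^sup>2 \<le> c\<^sup>2" using dev[OF x] by (metis abs_le_square_iff abs_of_nonneg abs_ge_zero order_trans)
    then show "exp (g x - m) \<le> 1 + (g x - m) + c\<^sup>2" using exp_le_quadratic[of "g x - m"] dev[OF x] c by simp
  qed
  also have "\<dots> = real (card A) * (1 + c\<^sup>2)" by (simp add: sum.distrib sum_subtractf sm algebra_simps)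
  also have "\<dots> \<le> real (card A) * exp (c\<^sup>2)" by (intro mult_left_mono) auto
  finally have "(\<Sum>x\<in>A. exp (g x - m)) / real (card A) \<le> exp (c\<^sup>2)" using n by (simp add: field_simps)
  moreover have "(\<Sum>x\<in>A. exp (g x)) = exp m * (\<Sum>x\<in>A. exp (g x - m))"
    by (simp add: sum_distrib_left exp_add[symmetric])
  ultimately show ?thesis
    using mult_left_mono[of "(\<Sum>x\<in>A. exp (g x - m)) / real (card A)" "exp (c\<^sup>2)" "exp m"]
    by (simp add: m_def[symmetric] exp_add)
qed

definition swap_lipschitz :: "'a set \<Rightarrow> real \<Rightarrow> ('a list \<Rightarrow> real) \<Rightarrow> bool" where
  "swap_lipschitz A c f \<longleftrightarrow> (\<forall>xs\<in>permutations_of_set A. \<forall>x\<in>A. \<forall>y\<in>A.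
    \<bar>f (map (Transposition.transpose x y) xs) - f xs\<bar> \<le> c)"

text \<open>
  Transposing \<open>x\<close> and \<open>y\<close> maps the orderings starting with \<open>x\<close> onto those starting with \<open>y\<close>,
  so exposing the first entry changes the conditional mean by at most \<open>c\<close>.
\<close>

lemma perm_avg_exp_le:
  assumes "finite A" "0 \<le> c" "c \<le> 1" "swap_lipschitz A c f"
  shows "perm_avg A (\<lambda>xs. exp (f xs)) \<le> exp (perm_avg A f + real (card A) * c\<^sup>2)"
  using assms(1,4)
proof (induction "card A" arbitrary: A f)
  case 0
  then show ?case by (simp add: perm_avg_def)
next
  case (Suc n)
  have A: "finite A" "A \<noteq> {}" using Suc by auto
  define g where "g x = perm_avg (A - {x}) (\<lambda>xs. f (x # xs))" for x
  have lip: "swap_lipschitz (A - {x}) c (\<lambda>xs. f (x # xs))" if x: "x \<in> A" for x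
    unfolding swap_lipschitz_def
  proof (intro ballI)
    fix xs y z assume *: "xs \<in> permutations_of_set (A - {x})" "y \<in> A - {x}" "z \<in> A - {x}"
    then have "x # xs \<in> permutations_of_set A" using x by (auto simp: permutations_of_set_def)
    moreover have "map (Transposition.transpose y z) (x # xs) = x # map (Transposition.transpose y z) xs"
      using * by (auto simp: Transposition.transpose_def)
    ultimately show "\<bar>f (x # map (Transposition.transpose y z) xs) - f (x # xs)\<bar> \<le> c"
      using Suc.prems(2) * unfolding swap_lipschitz_def by (metis DiffD1)
  qed
  have card: "card (A - {x}) = n" if "x \<in> A" for x using that Suc.hyps(2) A by simp
  have gdiff: "\<bar>g x - g y\<bar> \<le> c" if xy: "x \<in> A" "y \<in> A" for x y
  proof -
    let ?\<tau> = "Transposition.transpose x y"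
    have inj: "inj_on ?\<tau> (A - {x})" by (rule inj_on_subset[OF inj_transpose]) auto
    have "?\<tau> ` (A - {x}) = A - {y}"
      using xy by (auto simp: Transposition.transpose_def image_def)
    then have "permutations_of_set (A - {y}) = map ?\<tau> ` permutations_of_set (A - {x})"
      using permutations_of_set_image_inj[OF inj] by simp
    then have "(\<Sum>xs\<in>permutations_of_set (A - {y}). f (y # xs)) =
        (\<Sum>xs\<in>map ?\<tau> ` permutations_of_set (A - {x}). f (y # xs))" by (rule arg_cong)
    also have "\<dots> = (\<Sum>xs\<in>permutations_of_set (A - {x}). f (y # map ?\<tau> xs))"
      by (subst sum.reindex) (auto simp: inj_on_def inj_map_eq_map[OF inj_transpose])
    finally have "g y = (\<Sum>xs\<in>permutations_of_set (A - {x}). f (y # map ?\<tau> xs)) / fact n"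
      using xy card by (simp add: g_def perm_avg_def)
    then have "\<bar>g x - g y\<bar> = \<bar>\<Sum>xs\<in>permutations_of_set (A - {x}). f (x # xs) - f (y # map ?\<tau> xs)\<bar> / fact n"
      using xy card by (simp add: g_def perm_avg_def sum_subtractf diff_divide_distrib[symmetric])
    also have "\<dots> \<le> (\<Sum>xs\<in>permutations_of_set (A - {x}). \<bar>f (x # xs) - f (y # map ?\<tau> xs)\<bar>) / fact n"
      by (intro divide_right_mono sum_abs) auto
    also have "\<dots> \<le> (\<Sum>xs\<in>permutations_of_set (A - {x}). c) / fact n"
    proof (intro divide_right_mono sum_mono)
      fix xs assume "xs \<in> permutations_of_set (A - {x})"
      then have "x # xs \<in> permutations_of_set A" using xy by (auto simp: permutations_of_set_def)
      moreover have "map ?\<tau> (x # xs) = y # map ?\<tau> xs" by simp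
      ultimately show "\<bar>f (x # xs) - f (y # map ?\<tau> xs)\<bar> \<le> c"
        using Suc.prems(2) xy unfolding swap_lipschitz_def by (metis abs_minus_commute)
    qed auto
    also have "\<dots> = c" using A xy card by simp
    finally show ?thesis .
  qed
  have "perm_avg A (\<lambda>xs. exp (f xs)) = (\<Sum>x\<in>A. perm_avg (A - {x}) (\<lambda>xs. exp (f (x # xs)))) / real (card A)"
    by (rule perm_avg_Cons[OF A])
  also have "\<dots> \<le> (\<Sum>x\<in>A. exp (g x + real n * c\<^sup>2)) / real (card A)"
  proof (intro divide_right_mono sum_mono)
    fix x assume x: "x \<in> A"
    show "perm_avg (A - {x}) (\<lambda>xs. exp (f (x # xs))) \<le> exp (g x + real n * c\<^sup>2)"
      using Suc.hyps(1)[OF card[OF x, symmetric] _ lip[OF x]] A card[OF x] by (simp add: g_def)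
  qed auto
  also have "\<dots> = exp (real n * c\<^sup>2) * ((\<Sum>x\<in>A. exp (g x)) / real (card A))"
    by (simp add: exp_add sum_distrib_right[symmetric])
  also have "\<dots> \<le> exp (real n * c\<^sup>2) * exp ((\<Sum>x\<in>A. g x) / real (card A) + c\<^sup>2)"
    by (intro mult_left_mono mean_exp_le A gdiff assms) auto
  also have "(\<Sum>x\<in>A. g x) / real (card A) = perm_avg A f"
    unfolding g_def by (rule perm_avg_Cons[OF A, symmetric])
  finally show ?case using Suc.hyps(2)[symmetric] by (simp add: exp_add[symmetric] algebra_simps)
qed

text \<open>Chernoff's method: Markov's inequality for the exponential moment of
  \<open>- l * f\<close>.\<close>

lemma perm_lower_tail:
  assumes A: "finite A" and f: "swap_lipschitz A 2 f" and \<delta>: "0 < \<delta>" "\<delta> \<le> 1"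
  shows "real (card {xs \<in> permutations_of_set A. f xs \<le> perm_avg A f - \<delta> * real (card A)})
    \<le> fact (card A) * exp (- (\<delta>\<^sup>2 * real (card A) / 16))"
proof -
  define n where "n = real (card A)"
  \<comment> \<open>This \<open>l\<close> minimises the exponent
    \<open>4 * l\<^sup>2 - \<delta> * l\<close> per element of \<open>A\<close>, where it takes the
    value \<open>- \<delta>\<^sup>2 / 16\<close>.\<close>
  define l where "l = \<delta> / 8"
  let ?B = "{xs \<in> permutations_of_set A. f xs \<le> perm_avg A f - \<delta> * n}"
  have "swap_lipschitz A (2 * l) (\<lambda>xs. - l * f xs)"
    unfolding swap_lipschitz_def
  proof (intro ballI)
    fix xs x y assume "xs \<in> permutations_of_set A" "x \<in> A" "y \<in> A"
    then have "\<bar>f (map (Transposition.transpose x y) xs) - f xs\<bar> \<le> 2"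
      using f by (auto simp: swap_lipschitz_def)
    then have "l * \<bar>f (map (Transposition.transpose x y) xs) - f xs\<bar> \<le> l * 2"
      using \<delta> by (intro mult_left_mono) (auto simp: l_def)
    moreover have "\<bar>- l * f (map (Transposition.transpose x y) xs) - - l * f xs\<bar>
        = l * \<bar>f (map (Transposition.transpose x y) xs) - f xs\<bar>"
    proof -
      have "- l * f (map (Transposition.transpose x y) xs) - - l * f xs
          = (- l) * (f (map (Transposition.transpose x y) xs) - f xs)" by algebra
      then show ?thesis using \<delta> by (simp only: abs_mult) (simp add: l_def)
    qed
    ultimately show "\<bar>- l * f (map (Transposition.transpose x y) xs) - - l * f xs\<bar> \<le> 2 * l" by simp
  qed
  then have "perm_avg A (\<lambda>xs. exp (- l * f xs)) \<le> exp (perm_avg A (\<lambda>xs. - l * f xs) + n * (2 * l)\<^sup>2)"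
    unfolding n_def by (intro perm_avg_exp_le) (use A \<delta> in \<open>auto simp: l_def\<close>)
  then have "(\<Sum>xs\<in>permutations_of_set A. exp (- l * f xs)) \<le>
      fact (card A) * exp (- l * perm_avg A f + n * (2 * l)\<^sup>2)"
    unfolding perm_avg_cmult by (subst (asm) perm_avg_def) (simp add: field_simps)
  moreover have "(\<Sum>xs\<in>?B. exp (- l * (perm_avg A f - \<delta> * n))) \<le> (\<Sum>xs\<in>permutations_of_set A. exp (- l * f xs))"
  proof -
    have "(\<Sum>xs\<in>?B. exp (- l * (perm_avg A f - \<delta> * n))) \<le> (\<Sum>xs\<in>?B. exp (- l * f xs))"
      by (intro sum_mono) (use \<delta> in \<open>auto simp: l_def intro!: mult_left_mono\<close>)
    also have "\<dots> \<le> (\<Sum>xs\<in>permutations_of_set A. exp (- l * f xs))" by (rule sum_mono2) auto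
    finally show ?thesis .
  qed
  ultimately have "real (card ?B) * exp (- l * (perm_avg A f - \<delta> * n)) \<le>
      fact (card A) * exp (- l * perm_avg A f + n * (2 * l)\<^sup>2)" by simp
  then have "real (card ?B) * exp (- l * (perm_avg A f - \<delta> * n)) * exp (l * (perm_avg A f - \<delta> * n)) \<le>
      fact (card A) * exp (- l * perm_avg A f + n * (2 * l)\<^sup>2) * exp (l * (perm_avg A f - \<delta> * n))"
    by (intro mult_right_mono) auto
  then have "real (card ?B) \<le> fact (card A) * exp (- l * perm_avg A f + n * (2 * l)\<^sup>2 + l * (perm_avg A f - \<delta> * n))"
    by (simp add: mult.assoc exp_add[symmetric])
  also have "- l * perm_avg A f + n * (2 * l)\<^sup>2 + l * (perm_avg A f - \<delta> * n) = - (\<delta>\<^sup>2 * n / 16)"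
    by (simp add: l_def power2_eq_square field_simps)
  finally show ?thesis by (simp add: n_def)
qed

section \<open>Probabilities of prefixes and counts of blocks\<close>

text \<open>The entries are exposed one by one. Before each of the \<open>l\<close> choices fewer
  than \<open>l\<close> vertices have been removed, so at least \<open>s - l\<close> vertices of the
  required set are left among at most \<open>card A\<close>.\<close>

lemma perm_avg_prefix_ge:
  assumes "finite A" "l \<le> card A" "l \<le> s" "\<And>j. j < l \<Longrightarrow> s \<le> card (S j \<inter> A)"
  shows "((real s - real l) / real (card A)) ^ l \<le> perm_avg A (\<lambda>xs. of_bool (\<forall>j<l. xs ! j \<in> S j))"
  using assms
proof (induction l arbitrary: A S s)
  case (Suc l)
  then have A: "A \<noteq> {}" by auto
  have all: "(\<forall>j<Suc l. (x # xs) ! j \<in> S j) \<longleftrightarrow> x \<in> S 0 \<and> (\<forall>j<l. xs ! j \<in> S (Suc j))" for x xs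
    by (auto simp: less_Suc_eq_0_disj)
  let ?q = "(real s - real (Suc l)) / real (card A)"
  have q: "?q \<ge> 0" using Suc.prems by simp
  have "?q ^ Suc l \<le> (real s / real (card A)) * ?q ^ l"
    using q Suc.prems by (auto intro!: mult_right_mono divide_right_mono)
  also have "\<dots> \<le> (real (card (S 0 \<inter> A)) / real (card A)) * ?q ^ l"
    using q Suc.prems(4)[of 0] by (intro mult_right_mono divide_right_mono) auto
  finally have "?q ^ Suc l \<le> (\<Sum>x\<in>S 0 \<inter> A. ?q ^ l) / real (card A)"
    using q by (simp add: mult_right_mono divide_right_mono)
  also have "\<dots> \<le> (\<Sum>x\<in>S 0 \<inter> A. perm_avg (A - {x}) (\<lambda>xs. of_bool (\<forall>j<l. xs ! j \<in> S (Suc j)))) / real (card A)"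
  proof (intro divide_right_mono sum_mono)
    fix x assume x: "x \<in> S 0 \<inter> A"
    have c: "card (A - {x}) = card A - 1" using x Suc.prems(1) by simp
    have "?q ^ l \<le> ((real (s - 1) - real l) / real (card (A - {x}))) ^ l"
    proof (cases "l = 0")
      case False
      then have "(real s - real (Suc l)) / real (card A) \<le> (real s - real (Suc l)) / (real (card A) - 1)"
        using Suc.prems(2,3) by (intro divide_left_mono) auto
      then show ?thesis using q c Suc.prems(2,3)
        by (intro power_mono) (auto simp: of_nat_diff algebra_simps)
    qed simp
    also have "\<dots> \<le> perm_avg (A - {x}) (\<lambda>xs. of_bool (\<forall>j<l. xs ! j \<in> S (Suc j)))"
    proof (rule Suc.IH)
      fix j assume j: "j < l"
      have "S (Suc j) \<inter> (A - {x}) = S (Suc j) \<inter> A - {x}" by auto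
      then have "card (S (Suc j) \<inter> A) - 1 \<le> card (S (Suc j) \<inter> (A - {x}))"
        by (metis card_Diff1_le card_Diff_singleton_if diff_le_self order_refl)
      then show "s - 1 \<le> card (S (Suc j) \<inter> (A - {x}))" using Suc.prems(4)[of "Suc j"] j by linarith
    qed (use Suc.prems c in auto)
    finally show "?q ^ l \<le> perm_avg (A - {x}) (\<lambda>xs. of_bool (\<forall>j<l. xs ! j \<in> S (Suc j)))" .
  qed auto
  also have "(\<Sum>x\<in>S 0 \<inter> A. perm_avg (A - {x}) (\<lambda>xs. of_bool (\<forall>j<l. xs ! j \<in> S (Suc j))))
      = (\<Sum>x\<in>A. perm_avg (A - {x}) (\<lambda>xs. of_bool (\<forall>j<Suc l. (x # xs) ! j \<in> S j)))"
    unfolding all using Suc.prems(1)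
    by (intro sum.mono_neutral_cong_left) (auto simp: perm_avg_def)
  also have "\<dots> / real (card A) = perm_avg A (\<lambda>xs. of_bool (\<forall>j<Suc l. xs ! j \<in> S j))"
    by (rule perm_avg_Cons[OF Suc.prems(1) A, symmetric])
  finally show ?case .
qed simp

text \<open>Drawing without replacement: after a hit both \<open>S \<inter> A\<close> and
  \<open>A\<close> lose one element, which does not increase the ratio of their sizes.\<close>

lemma perm_avg_prefix_le:
  assumes "finite A" "l \<le> card A"
  shows "perm_avg A (\<lambda>xs. of_bool (\<forall>j<l. xs ! j \<in> S)) \<le> (real (card (S \<inter> A)) / real (card A)) ^ l"
  using assms
proof (induction l arbitrary: A)
  case (Suc l)
  then have A: "A \<noteq> {}" by auto
  have all: "(\<forall>j<Suc l. (x # xs) ! j \<in> S) \<longleftrightarrow> x \<in> S \<and> (\<forall>j<l. xs ! j \<in> S)" for x xs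
    by (auto simp: less_Suc_eq_0_disj)
  let ?q = "real (card (S \<inter> A)) / real (card A)"
  have "perm_avg A (\<lambda>xs. of_bool (\<forall>j<Suc l. xs ! j \<in> S)) =
      (\<Sum>x\<in>A. perm_avg (A - {x}) (\<lambda>xs. of_bool (\<forall>j<Suc l. (x # xs) ! j \<in> S))) / real (card A)"
    by (rule perm_avg_Cons[OF Suc.prems(1) A])
  also have "(\<Sum>x\<in>A. perm_avg (A - {x}) (\<lambda>xs. of_bool (\<forall>j<Suc l. (x # xs) ! j \<in> S)))
      = (\<Sum>x\<in>S \<inter> A. perm_avg (A - {x}) (\<lambda>xs. of_bool (\<forall>j<l. xs ! j \<in> S)))"
    unfolding all using Suc.prems(1)
    by (intro sum.mono_neutral_cong_right) (auto simp: perm_avg_def)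
  also have "\<dots> \<le> (\<Sum>x\<in>S \<inter> A. ?q ^ l)"
  proof (rule sum_mono)
    fix x assume x: "x \<in> S \<inter> A"
    have c: "card (A - {x}) = card A - 1" using x Suc.prems(1) by simp
    have "S \<inter> (A - {x}) = S \<inter> A - {x}" by auto
    then have cs: "card (S \<inter> (A - {x})) = card (S \<inter> A) - 1" using x Suc.prems(1) by simp
    have pos: "card (S \<inter> A) > 0" using x Suc.prems(1) by (auto simp: card_gt_0_iff)
    have le: "card (S \<inter> A) \<le> card A" using Suc.prems(1) by (intro card_mono) auto
    have "perm_avg (A - {x}) (\<lambda>xs. of_bool (\<forall>j<l. xs ! j \<in> S)) \<le>
        (real (card (S \<inter> (A - {x}))) / real (card (A - {x}))) ^ l"
      by (rule Suc.IH) (use Suc.prems c in auto)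
    also have "\<dots> \<le> ?q ^ l"
    proof (cases "l = 0")
      case False
      then have a: "card A \<ge> 2" using Suc.prems by simp
      show ?thesis
        by (rule power_mono) (use a c cs pos le in \<open>auto simp: of_nat_diff field_simps\<close>)
    qed simp
    finally show "perm_avg (A - {x}) (\<lambda>xs. of_bool (\<forall>j<l. xs ! j \<in> S)) \<le> ?q ^ l" .
  qed
  finally show ?case by (simp add: divide_right_mono)
qed simp

text \<open>Rotation permutes the orderings and can move any block to the front, so all blocks have
  the distribution of the first one.\<close>

lemma perm_avg_rotate:
  "perm_avg A (\<lambda>xs. f (rotate k xs)) = perm_avg A f"
proof (cases "finite A")
  case True
  have "inj_on (rotate k) (permutations_of_set A)"
    unfolding rotate_def by (rule inj_on_subset[OF inj_fn[OF inj_rotate1]]) simp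
  moreover have "rotate k ` permutations_of_set A \<subseteq> permutations_of_set A"
    by (auto simp: permutations_of_set_def)
  ultimately have "bij_betw (rotate k) (permutations_of_set A) (permutations_of_set A)"
    by (simp add: bij_betw_def endo_inj_surj)
  from sum.reindex_bij_betw[OF this, of f] show ?thesis by (simp add: perm_avg_def)
qed (simp add: perm_avg_def permutations_of_set_infinite)

text \<open>Applied with \<open>l = r\<close> and constant \<open>S\<close> to count the cliques
  inside a set, and with \<open>l = 2\<close> to count the cliques whose first two vertices link two
  given vertices.\<close>

definition block_count :: "nat \<Rightarrow> nat \<Rightarrow> (nat \<Rightarrow> 'a set) \<Rightarrow> nat set \<Rightarrow> 'a list \<Rightarrow> real" where
  "block_count r l S I xs = real (card {i \<in> I. \<forall>j<l. xs ! (i * r + j) \<in> S j})"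

lemma perm_avg_block_count:
  assumes A: "finite A" and l: "l \<le> r" and I: "\<And>i. i \<in> I \<Longrightarrow> i * r + r \<le> card A" "finite I"
  shows "perm_avg A (block_count r l S I) = real (card I) * perm_avg A (\<lambda>xs. of_bool (\<forall>j<l. xs ! j \<in> S j))"
proof -
  have "perm_avg A (block_count r l S I) =
      perm_avg A (\<lambda>xs. \<Sum>i\<in>I. of_bool (\<forall>j<l. xs ! (i * r + j) \<in> S j))"
    using I(2) by (intro perm_avg_cong) (simp add: block_count_def Int_def conj_commute)
  also have "\<dots> = (\<Sum>i\<in>I. perm_avg A (\<lambda>xs. of_bool (\<forall>j<l. xs ! (i * r + j) \<in> S j)))"
    by (rule perm_avg_sum)
  also have "\<dots> = (\<Sum>i\<in>I. perm_avg A (\<lambda>xs. of_bool (\<forall>j<l. xs ! j \<in> S j)))"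
  proof (rule sum.cong[OF refl])
    fix i assume i: "i \<in> I"
    have "perm_avg A (\<lambda>xs. of_bool (\<forall>j<l. xs ! (i * r + j) \<in> S j)) =
        perm_avg A (\<lambda>xs. of_bool (\<forall>j<l. rotate (i * r) xs ! j \<in> S j))"
    proof (rule perm_avg_cong)
      fix xs assume xs: "xs \<in> permutations_of_set A"
      have "rotate (i * r) xs ! j = xs ! (i * r + j)" if "j < l" for j
        using that I(1)[OF i] l length_finite_permutations_of_set[OF xs] by (simp add: nth_rotate)
      then show "of_bool (\<forall>j<l. xs ! (i * r + j) \<in> S j) = (of_bool (\<forall>j<l. rotate (i * r) xs ! j \<in> S j) :: real)"
        by simp
    qed
    then show "perm_avg A (\<lambda>xs. of_bool (\<forall>j<l. xs ! (i * r + j) \<in> S j)) =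
        perm_avg A (\<lambda>xs. of_bool (\<forall>j<l. xs ! j \<in> S j))"
      using perm_avg_rotate[of A "\<lambda>xs. of_bool (\<forall>j<l. xs ! j \<in> S j)" "i * r"] by simp
  qed
  finally show ?thesis by simp
qed

text \<open>A transposition changes entries only in the at most two blocks that hold
  \<open>x\<close> and \<open>y\<close>.\<close>

lemma swap_lipschitz_block_count:
  assumes A: "finite A" and l: "l \<le> r" and r: "r > 0" and I: "\<And>i. i \<in> I \<Longrightarrow> i * r + r \<le> card A" "finite I"
  shows "swap_lipschitz A 2 (block_count r l S I)"
  unfolding swap_lipschitz_def
proof (intro ballI)
  fix xs x y assume xs: "xs \<in> permutations_of_set A" and "x \<in> A" "y \<in> A"
  let ?\<tau> = "Transposition.transpose x y"
  have d: "distinct xs" "set xs = A" "length xs = card A"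
    using xs by (auto simp: permutations_of_set_def distinct_card)
  obtain p q where p: "p < length xs" "xs ! p = x" and q: "q < length xs" "xs ! q = y"
    using \<open>x \<in> A\<close> \<open>y \<in> A\<close> d by (metis in_set_conv_nth)
  define X where "X = {i \<in> I. \<forall>j<l. xs ! (i * r + j) \<in> S j}"
  define Y where "Y = {i \<in> I. \<forall>j<l. map ?\<tau> xs ! (i * r + j) \<in> S j}"
  define B where "B = {p div r, q div r}"
  have same: "map ?\<tau> xs ! (i * r + j) = xs ! (i * r + j)" if "i \<in> I" "i \<notin> B" "j < l" for i j
  proof -
    have lt: "i * r + j < length xs" using I(1)[OF that(1)] l that d by simp
    have "(i * r + j) div r = i" using that l r by simp
    then have "i * r + j \<noteq> p" "i * r + j \<noteq> q" using that by (auto simp: B_def)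
    then have "xs ! (i * r + j) \<noteq> x" "xs ! (i * r + j) \<noteq> y"
      using nth_eq_iff_index_eq[OF d(1)] lt p q by metis+
    then show ?thesis using lt by (simp add: Transposition.transpose_def)
  qed
  have fin: "finite X" "finite Y" "finite B" using I by (auto simp: X_def Y_def B_def)
  have B: "card B \<le> 2" by (simp add: B_def card_insert_if)
  have "X \<subseteq> Y \<union> B" "Y \<subseteq> X \<union> B" using same by (auto simp: X_def Y_def)
  then have "card X \<le> card (Y \<union> B)" "card Y \<le> card (X \<union> B)" using fin by (auto intro: card_mono)
  then have "card X \<le> card Y + 2" "card Y \<le> card X + 2"
    using card_Un_le[of Y B] card_Un_le[of X B] B by linarith+
  then show "\<bar>block_count r l S I (map ?\<tau> xs) - block_count r l S I xs\<bar> \<le> 2"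
    unfolding block_count_def X_def[symmetric] Y_def[symmetric] by linarith
qed

lemma block_count_lower_tail:
  assumes A: "finite A" and l: "l \<le> r" "l \<le> s" "l \<le> card A" and r: "r > 0"
    and I: "\<And>i. i \<in> I \<Longrightarrow> i * r + r \<le> card A" "finite I"
    and S: "\<And>j. j < l \<Longrightarrow> s \<le> card (S j \<inter> A)" and \<delta>: "0 < \<delta>" "\<delta> \<le> 1"
  shows "real (card {xs \<in> permutations_of_set A. block_count r l S I xs \<le>
      real (card I) * ((real s - real l) / real (card A)) ^ l - \<delta> * real (card A)})
    \<le> fact (card A) * exp (- (\<delta>\<^sup>2 * real (card A) / 16))"
proof -
  let ?f = "block_count r l S I"
  have "real (card I) * ((real s - real l) / real (card A)) ^ l \<le> perm_avg A ?f"
    using perm_avg_prefix_ge[of A l s S] assms by (simp add: perm_avg_block_count mult_left_mono)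
  then have "{xs \<in> permutations_of_set A. ?f xs \<le> real (card I) * ((real s - real l) / real (card A)) ^ l - \<delta> * real (card A)}
      \<subseteq> {xs \<in> permutations_of_set A. ?f xs \<le> perm_avg A ?f - \<delta> * real (card A)}" by auto
  then have "card {xs \<in> permutations_of_set A. ?f xs \<le> real (card I) * ((real s - real l) / real (card A)) ^ l - \<delta> * real (card A)}
      \<le> card {xs \<in> permutations_of_set A. ?f xs \<le> perm_avg A ?f - \<delta> * real (card A)}"
    by (intro card_mono) auto
  also have "real \<dots> \<le> fact (card A) * exp (- (\<delta>\<^sup>2 * real (card A) / 16))"
    by (rule perm_lower_tail[OF A swap_lipschitz_block_count \<delta>]) (use assms in auto)
  finally show ?thesis by simp
qed

section \<open>Cycles from absorbers and bridges\<close>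

text \<open>For symmetric \<open>G\<close> a list of two adjacent vertices also qualifies; only
  lengths of at least 3 are used later.\<close>

definition is_cycle :: "('a \<Rightarrow> 'a \<Rightarrow> bool) \<Rightarrow> 'a list \<Rightarrow> bool" where
  "is_cycle G xs \<longleftrightarrow> xs \<noteq> [] \<and> distinct xs \<and> successively G xs \<and> G (last xs) (hd xs)"

lemma successively_concat_map:
  assumes "\<And>t. t < k \<Longrightarrow> q t \<noteq> [] \<and> successively G (q t)"
    and "\<And>t. Suc t < k \<Longrightarrow> G (last (q t)) (hd (q (Suc t)))" and "k > 0"
  shows "successively G (concat (map q [0..<k])) \<and> concat (map q [0..<k]) \<noteq> [] \<and>
    hd (concat (map q [0..<k])) = hd (q 0) \<and> last (concat (map q [0..<k])) = last (q (k - 1))"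
  using assms
proof (induction k)
  case (Suc k)
  show ?case
  proof (cases "k = 0")
    case True
    then show ?thesis using Suc.prems(1)[of 0] by simp
  next
    case False
    let ?c = "concat (map q [0..<k])"
    have IH: "successively G ?c" "?c \<noteq> []" "hd ?c = hd (q 0)" "last ?c = last (q (k - 1))"
      using Suc.IH Suc.prems False by auto
    have g: "G (last (q (k - 1))) (hd (q k))" using Suc.prems(2)[of "k - 1"] False by simp
    have "concat (map q [0..<Suc k]) = ?c @ q k" by simp
    then show ?thesis using IH g Suc.prems(1)[of k] by (simp add: successively_append_iff)
  qed
qed simp

lemma distinct_concat_map:
  assumes "\<And>t. t < k \<Longrightarrow> distinct (q t)"
    and "\<And>s t. s < k \<Longrightarrow> t < k \<Longrightarrow> s \<noteq> t \<Longrightarrow> set (q s) \<inter> set (q t) = {}"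
  shows "distinct (concat (map q [0..<k]))"
  using assms
proof (induction k)
  case (Suc k)
  have "set (q s) \<inter> set (q k) = {}" if "s < k" for s using Suc.prems(2)[of s k] that by simp
  moreover have "set (concat (map q [0..<k])) = (\<Union>s<k. set (q s))" by auto
  ultimately have "set (concat (map q [0..<k])) \<inter> set (q k) = {}" by blast
  moreover have "distinct (concat (map q [0..<k]))" by (rule Suc.IH) (use Suc.prems in auto)
  ultimately show ?case using Suc.prems(1)[of k] by simp
qed simp

lemma length_concat_map_upt: "length (concat (map q [0..<k])) = (\<Sum>t<k. length (q t))"
  by (induction k) auto

lemma is_cycle_concat:
  assumes "k > 0" and "\<And>t. t < k \<Longrightarrow> q t \<noteq> [] \<and> successively G (q t) \<and> distinct (q t)"
    and "\<And>t. t < k \<Longrightarrow> G (last (q t)) (hd (q (Suc t mod k)))"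
    and "\<And>s t. s < k \<Longrightarrow> t < k \<Longrightarrow> s \<noteq> t \<Longrightarrow> set (q s) \<inter> set (q t) = {}"
  shows "is_cycle G (concat (map q [0..<k]))"
proof -
  have "G (last (q t)) (hd (q (Suc t)))" if "Suc t < k" for t using assms(3)[of t] that by simp
  moreover have "G (last (q (k - 1))) (hd (q 0))" using assms(1) assms(3)[of "k - 1"] by simp
  moreover have "distinct (concat (map q [0..<k]))" by (rule distinct_concat_map) (use assms in auto)
  ultimately show ?thesis
    using successively_concat_map[of k q G] assms by (auto simp: is_cycle_def)
qed

lemma path_system_truncate:
  assumes "path_system G ps" "t \<le> length (concat ps)"
  shows "\<exists>qs. path_system G qs \<and> set (concat qs) \<subseteq> set (concat ps) \<and> length (concat qs) = t \<and> length qs \<le> length ps"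
  using assms
proof (induction ps arbitrary: t)
  case Nil
  then show ?case by (intro exI[of _ "[]"]) (auto simp: path_system_def)
next
  case (Cons p ps)
  have p: "distinct p" "successively G p" "p \<noteq> []" "path_system G ps" "set p \<inter> set (concat ps) = {}"
    using Cons.prems(1) by (auto simp: path_system_def)
  consider "t = 0" | "0 < t" "t \<le> length p" | "length p < t" by linarith
  then show ?case
  proof cases
    case 1
    then show ?thesis by (intro exI[of _ "[]"]) (auto simp: path_system_def)
  next
    case 2
    have "successively G (take t p)"
      using p(2) by (metis append_take_drop_id successively_append_iff)
    then show ?thesis using 2 p
      by (intro exI[of _ "[take t p]"]) (auto simp: path_system_def dest: in_set_takeD)
  next
    case 3
    have "t - length p \<le> length (concat ps)" using Cons.prems(2) by simp
    from Cons.IH[OF p(4) this]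
    obtain qs where qs: "path_system G qs" "set (concat qs) \<subseteq> set (concat ps)"
      "length (concat qs) = t - length p" "length qs \<le> length ps" by blast
    then have "path_system G (p # qs)" using p by (auto simp: path_system_def)
    then show ?thesis using qs 3 by (intro exI[of _ "p # qs"]) auto
  qed
qed

text \<open>In the application \<open>\<beta>\<close> numbers the cliques of the random factor, and
  \<open>x i\<close>, \<open>y i\<close> are the first two vertices of clique \<open>i\<close>,
  hence adjacent through the factor.\<close>

locale block_graph =
  fixes V :: "nat set" and H :: "nat \<Rightarrow> nat \<Rightarrow> bool" and \<beta> x y :: "nat \<Rightarrow> nat" and m :: nat
  assumes finite_V: "finite V"
    and H_sym: "H u v \<Longrightarrow> H v u" and H_V: "H u v \<Longrightarrow> u \<in> V" and H_irrefl: "\<not> H u u"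
    and heads: "i < m \<Longrightarrow> x i \<in> V \<and> y i \<in> V \<and> x i \<noteq> y i \<and> \<beta> (x i) = i \<and> \<beta> (y i) = i"
begin

definition G :: "nat \<Rightarrow> nat \<Rightarrow> bool" where
  "G u v \<longleftrightarrow> H u v \<or> (\<beta> u = \<beta> v \<and> u \<noteq> v)"

text \<open>A bridge \<open>i\<close> joins \<open>p\<close> to \<open>q\<close> by the path \<open>p, x i, y i, q\<close>.\<close>

definition bridges :: "nat \<Rightarrow> nat \<Rightarrow> nat set" where
  "bridges p q = {i. i < m \<and> H p (x i) \<and> H q (y i)}"

lemma heads_neq:
  assumes "i < m" "i' < m" "i \<noteq> i'"
  shows "x i \<noteq> x i'" "x i \<noteq> y i'" "y i \<noteq> x i'" "y i \<noteq> y i'"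
  using heads[OF assms(1)] heads[OF assms(2)] assms(3) by metis+

lemma card_heads:
  assumes I: "I \<subseteq> {..<m}"
  shows "card (x ` I \<union> y ` I) = 2 * card I"
proof -
  have fin: "finite I" using I finite_subset by blast
  have "inj_on x I" "inj_on y I" by (rule inj_on_inverseI[of _ \<beta>]; use heads I in auto)+
  moreover have "x i \<noteq> y i'" if "i \<in> I" "i' \<in> I" for i i'
    using that I heads[of i] heads_neq(2)[of i i'] by (cases "i = i'") auto
  then have "x ` I \<inter> y ` I = {}" by blast
  ultimately show ?thesis
    using fin by (subst card_Un_disjoint) (auto simp: card_image)
qed

lemma bridges_subset: "bridges p q \<subseteq> {..<m}"
  by (auto simp: bridges_def)

lemma finite_bridges [simp]: "finite (bridges p q)"
  by (simp add: bridges_def)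

lemma choose_bridges:
  assumes "finite X" and "\<And>t. t \<in> X \<Longrightarrow> card X + card D \<le> card (bridges (e t) (h t))" and D: "finite D"
  shows "\<exists>j. inj_on j X \<and> (\<forall>t\<in>X. j t \<in> bridges (e t) (h t) - D)"
proof (rule distinct_representatives)
  fix t assume "t \<in> X"
  then show "card X \<le> card (bridges (e t) (h t) - D)"
    using assms(2)[of t] diff_card_le_card_Diff[OF D, of "bridges (e t) (h t)"] by linarith
qed (use assms in auto)

text \<open>The cycle runs through \<open>p 0\<close>, bridge \<open>j 0\<close>,
  \<open>p 1\<close>, bridge \<open>j 1\<close> and so on. Different bridges are disjoint because
  they lie in different blocks. For \<open>k = 1\<close> the single bridge closes the only
  path.\<close>

lemma is_cycle_linked:
  assumes k: "k > 0"
    and p: "\<And>t. t < k \<Longrightarrow> p t \<noteq> [] \<and> successively G (p t) \<and> distinct (p t)"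
    and disj: "\<And>s t. s < k \<Longrightarrow> t < k \<Longrightarrow> s \<noteq> t \<Longrightarrow> set (p s) \<inter> set (p t) = {}"
    and inj: "inj_on j {..<k}"
    and j: "\<And>t. t < k \<Longrightarrow> j t \<in> bridges (last (p t)) (hd (p (Suc t mod k)))"
    and out: "\<And>s t. s < k \<Longrightarrow> t < k \<Longrightarrow> x (j s) \<notin> set (p t) \<and> y (j s) \<notin> set (p t)"
  shows "is_cycle G (concat (map (\<lambda>t. p t @ [x (j t), y (j t)]) [0..<k]))"
proof (rule is_cycle_concat[OF k])
  fix t assume t: "t < k"
  have jt: "j t < m" "H (last (p t)) (x (j t))" "H (hd (p (Suc t mod k))) (y (j t))"
    using j[OF t] by (auto simp: bridges_def)
  have Gs: "G (last (p t)) (x (j t))" "G (x (j t)) (y (j t))" "G (y (j t)) (hd (p (Suc t mod k)))"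
    using jt heads[OF jt(1)] H_sym by (auto simp: G_def)
  show "p t @ [x (j t), y (j t)] \<noteq> [] \<and> successively G (p t @ [x (j t), y (j t)]) \<and> distinct (p t @ [x (j t), y (j t)])"
    using p[OF t] Gs heads[OF jt(1)] out[OF t t] by (auto simp: successively_append_iff)
  have "p (Suc t mod k) \<noteq> []" using p k by simp
  then show "G (last (p t @ [x (j t), y (j t)])) (hd (p (Suc t mod k) @ [x (j (Suc t mod k)), y (j (Suc t mod k))]))"
    using Gs by simp
next
  fix s t assume st: "s < k" "t < k" "s \<noteq> t"
  have "j s \<noteq> j t" using inj st by (auto simp: inj_on_def)
  moreover have "j s < m" "j t < m" using j st by (auto simp: bridges_def)
  ultimately have "{x (j s), y (j s)} \<inter> {x (j t), y (j t)} = {}"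
    using heads_neq[of "j s" "j t"] by auto
  then show "set (p s @ [x (j s), y (j s)]) \<inter> set (p t @ [x (j t), y (j t)]) = {}"
    using disj[OF st] out st by auto
qed

lemma set_linked:
  assumes "\<And>t. t < k \<Longrightarrow> set (p t) \<subseteq> V" "\<And>t. t < k \<Longrightarrow> j t < m"
  shows "set (concat (map (\<lambda>t. p t @ [x (j t), y (j t)]) [0..<k])) \<subseteq> V"
  using assms heads by fastforce

text \<open>
  A cycle of length \<open>3 k + s\<close> with \<open>s < 3\<close>: \<open>k\<close> bridges link a path on \<open>s + 1\<close> vertices and
  \<open>k - 1\<close> single vertices.
\<close>

lemma short_cycle:
  assumes C: "\<And>p q. p \<in> V \<Longrightarrow> q \<in> V \<Longrightarrow> C \<le> card (bridges p q)"
    and deg: "v \<in> V" "card {u \<in> V. H v u} \<ge> 2"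
    and l: "3 \<le> l" "l \<le> C" "9 \<le> C"
  shows "\<exists>xs. is_cycle G xs \<and> set xs \<subseteq> V \<and> length xs = l"
proof -
  obtain u w where uw: "H v u" "H v w" "u \<noteq> w"
  proof -
    have "\<not> card {u \<in> V. H v u} \<le> 1" using deg by simp
    then show ?thesis using that finite_V by (auto simp: card_le_Suc0_iff_eq)
  qed
  have d: "distinct [u, v, w]" "{u, v, w} \<subseteq> V" 
    using uw H_irrefl H_V[of v] H_V[OF H_sym[OF uw(1)]] H_V[OF H_sym[OF uw(2)]] by auto
  define k where "k = l div 3"
  define s where "s = l mod 3"
  have ks: "l = 3 * k + s" "s < 3" "k > 0" using l by (auto simp: k_def s_def)
  have Cm: "C \<le> m"
    using C[OF deg(1) deg(1)] card_mono[OF _ bridges_subset[of v v]] by simp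
  \<comment> \<open>This guarantees room for the vertices \<open>z t\<close> outside
    \<open>u\<close>, \<open>v\<close>, \<open>w\<close>.\<close>
  have "2 * m \<le> card V"
  proof -
    have "card (x ` {..<m} \<union> y ` {..<m}) = 2 * m" using card_heads[of "{..<m}"] by simp
    moreover have "card (x ` {..<m} \<union> y ` {..<m}) \<le> card V"
      by (rule card_mono[OF finite_V]) (use heads in auto)
    ultimately show ?thesis by simp
  qed
  moreover have "card (V - {u, v, w}) = card V - 3" using d by (subst card_Diff_subset) auto
  ultimately have "k \<le> card (V - {u, v, w})" using Cm ks l by linarith
  then obtain Z where Z: "Z \<subseteq> V - {u, v, w}" "card Z = k" using obtain_subset_with_card_n by metis
  then obtain z where z: "bij_betw z {..<k} Z"
    using finite_V by (metis bij_betw_from_nat_into_finite finite_Diff finite_subset lessThan_atLeast0 ex_bij_betw_nat_finite)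
  have zV: "z t \<in> V - {u, v, w}" if "t < k" for t using z Z that by (auto simp: bij_betw_def)
  have zi: "z t \<noteq> z t'" if "t < k" "t' < k" "t \<noteq> t'" for t t' using z that by (auto simp: bij_betw_def inj_on_def)
  define p where "p t = (if t = 0 then take (Suc s) [u, v, w] else [z t])" for t
  have sub: "set (p 0) \<subseteq> {u, v, w}" by (auto simp: p_def dest: in_set_takeD)
  define D where "D = \<beta> ` ({u, v, w} \<union> z ` {..<k})"
  have cD: "card D \<le> k + 3"
  proof -
    have "card D \<le> card ({u, v, w} \<union> z ` {..<k})" unfolding D_def by (rule card_image_le) simp
    also have "\<dots> \<le> card {u, v, w} + card (z ` {..<k})" by (rule card_Un_le)
    also have "\<dots> \<le> 3 + k" using card_image_le[of "{..<k}" z] by (intro add_mono) (auto simp: card_insert_if)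
    finally show ?thesis by simp
  qed
  have pV: "set (p t) \<subseteq> V" if "t < k" for t using zV[OF that] sub d by (auto simp: p_def)
  have pne: "p t \<noteq> []" for t by (simp add: p_def)
  \<comment> \<open>Avoiding the blocks in \<open>D\<close> keeps the bridges off the paths. As
    \<open>k \<le> C / 3\<close>, the demand \<open>k + (k + 3) \<le> C\<close> follows from
    \<open>9 \<le> C\<close>.\<close>
  have "\<exists>j. inj_on j {..<k} \<and> (\<forall>t\<in>{..<k}. j t \<in> bridges (last (p t)) (hd (p (Suc t mod k))) - D)"
  proof (rule choose_bridges)
    fix t assume "t \<in> {..<k}"
    then have "last (p t) \<in> V" "hd (p (Suc t mod k)) \<in> V"
      using pV[of t] pV[of "Suc t mod k"] pne[of t] pne[of "Suc t mod k"] ks by auto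
    then show "card {..<k} + card D \<le> card (bridges (last (p t)) (hd (p (Suc t mod k))))"
      using C[of "last (p t)" "hd (p (Suc t mod k))"] cD ks l by simp
  qed (auto simp: D_def)
  then obtain j where j: "inj_on j {..<k}" "\<And>t. t < k \<Longrightarrow> j t \<in> bridges (last (p t)) (hd (p (Suc t mod k))) - D"
    by auto
  have jm: "j t < m" if "t < k" for t using j(2)[OF that] by (auto simp: bridges_def)
  have "s = 0 \<or> s = 1 \<or> s = 2" using ks by auto
  then have p0: "p 0 \<noteq> [] \<and> successively G (p 0) \<and> distinct (p 0) \<and> length (p 0) = Suc s"
    using d(1) uw H_sym by (auto simp: p_def G_def numeral_2_eq_2)
  have "is_cycle G (concat (map (\<lambda>t. p t @ [x (j t), y (j t)]) [0..<k]))"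
  proof (rule is_cycle_linked)
    show "p t \<noteq> [] \<and> successively G (p t) \<and> distinct (p t)" if "t < k" for t
      using p0 by (cases "t = 0") (auto simp: p_def)
    show "set (p s) \<inter> set (p t) = {}" if "s < k" "t < k" "s \<noteq> t" for s t
      using sub zV[of s] zV[of t] zi[OF that] that by (cases "s = 0"; cases "t = 0") (auto simp: p_def)
    show "x (j s) \<notin> set (p t) \<and> y (j s) \<notin> set (p t)" if "s < k" "t < k" for s t
    proof -
      have "j s \<notin> \<beta> ` set (p t)"
        using j(2)[OF that(1)] sub that(2) by (cases "t = 0") (auto simp: D_def p_def)
      then show ?thesis using heads[OF jm[OF that(1)]] by force
    qed
  qed (use ks j in auto)
  moreover have "length (concat (map (\<lambda>t. p t @ [x (j t), y (j t)]) [0..<k])) = l"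
  proof -
    have "(\<Sum>t<k. length (p t @ [x (j t), y (j t)])) = (\<Sum>t<k. length (p t) + 2)" by simp
    also have "\<dots> = (\<Sum>t<k. length (p t)) + 2 * k" by (simp only: sum.distrib) simp
    also have "(\<Sum>t<k. length (p t)) = (\<Sum>t\<in>insert 0 {1..<k}. length (p t))"
      by (rule sum.cong) (use ks in auto)
    also have "\<dots> = Suc s + (k - 1)" using p0 by (simp add: p_def)
    finally show ?thesis using ks unfolding length_concat_map_upt by linarith
  qed
  moreover have "set (concat (map (\<lambda>t. p t @ [x (j t), y (j t)]) [0..<k])) \<subseteq> V"
    by (rule set_linked) (use pV jm in auto)
  ultimately show ?thesis by blast
qed

text \<open>
  The first \<open>a\<close> head pairs \<open>x t, y t\<close> are the absorbers. Linked by bridges they form a cycle on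
  \<open>4 a\<close> vertices, and each of the few paths covering the rest is inserted between \<open>x t\<close> and
  \<open>y t\<close> for some \<open>t\<close> of its own. Truncating the path system gives every length.
\<close>

lemma long_cycle:
  assumes C: "\<And>p q. p \<in> V \<Longrightarrow> q \<in> V \<Longrightarrow> 2 * a \<le> card (bridges p q)"
    and K: "\<And>p q. p \<in> V \<Longrightarrow> q \<in> V \<Longrightarrow> K \<le> card (bridges p q \<inter> {..<a})"
    and a: "0 < a" "a \<le> m"
    and r: "\<And>i. card {v \<in> V. \<beta> v = i} \<le> r"
    and cond: "\<And>b. b \<in> V \<Longrightarrow> card (\<beta> ` {v \<in> V. \<not> H b v}) + 4 * k + 4 * a + r + 1 \<le> card {v \<in> V. H b v}"
    and k: "k > 0" and L: "L > 0" and \<theta>: "\<theta> > 0"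
    and few: "real (card V) * (1 / real L + 2 * (\<theta> + real r * (real L)\<^sup>2 / (real k * \<theta>))) < real K + 1"
    and l: "4 * a \<le> l" "l \<le> card V"
  shows "\<exists>xs. is_cycle G xs \<and> set xs \<subseteq> V \<and> length xs = l"
proof -
  have lt: "t < m" if "t < a" for t using that a by simp
  \<comment> \<open>Consecutive absorbers are linked by bridges that are not absorbers themselves:
    \<open>a\<close> bridges to choose and \<open>a\<close> forbidden indices explain the bound
    \<open>2 * a\<close>.\<close>
  have "\<exists>j. inj_on j {..<a} \<and> (\<forall>t\<in>{..<a}. j t \<in> bridges (y t) (x (Suc t mod a)) - {..<a})"
  proof (rule choose_bridges)
    fix t assume "t \<in> {..<a}"
    then have "y t \<in> V" "x (Suc t mod a) \<in> V"
      using heads[OF lt, of t] heads[OF lt, of "Suc t mod a"] a(1) by auto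
    then show "card {..<a} + card {..<a} \<le> card (bridges (y t) (x (Suc t mod a)))"
      using C by (simp add: mult_2[symmetric])
  qed auto
  then obtain j where j: "inj_on j {..<a}" "\<And>t. t < a \<Longrightarrow> j t \<in> bridges (y t) (x (Suc t mod a)) - {..<a}"
    by auto
  have jm: "j t < m" "a \<le> j t" if "t < a" for t using j(2)[OF that] by (auto simp: bridges_def)
  define I where "I = {..<a} \<union> j ` {..<a}"
  have I: "I \<subseteq> {..<m}" using a jm by (auto simp: I_def)
  have cI: "card I = 2 * a"
    unfolding I_def using j(1) jm by (subst card_Un_disjoint) (fastforce simp: card_image)+
  define U where "U = x ` I \<union> y ` I"
  have UV: "U \<subseteq> V" using I heads by (auto simp: U_def)
  have finI: "finite I" by (simp add: I_def)
  have cU: "card U = 4 * a" using card_heads[OF I] cI by (simp add: U_def)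
  define W where "W = V - U"
  have W: "finite W" "W \<subseteq> V" using finite_V by (auto simp: W_def)
  have cW: "card W = card V - 4 * a" using card_split[OF finite_V UV] cU by (simp add: W_def)
  \<comment> \<open>Edges of \<open>H\<close> inside a block are dropped, as
    \<open>path_cover\<close> demands; such pairs stay adjacent in \<open>G\<close> through the
    block.\<close>
  define E where "E u v \<longleftrightarrow> H u v \<and> \<beta> u \<noteq> \<beta> v" for u v
  have "\<exists>ps. path_system (\<lambda>u v. E u v \<or> (\<beta> u = \<beta> v \<and> u \<noteq> v)) ps \<and> set (concat ps) = W \<and>
    real (length ps) \<le> real (card W) * (1 / real L + 2 * (\<theta> + real r * (real L)\<^sup>2 / (real k * \<theta>)))"
  proof (rule path_cover[OF W(1)])
    fix i
    have "card {v \<in> W. \<beta> v = i} \<le> card {v \<in> V. \<beta> v = i}" by (rule card_mono) (use finite_V W in auto)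
    then show "card {v \<in> W. \<beta> v = i} \<le> r" using r[of i] by simp
  next
    \<comment> \<open>Passing from \<open>V\<close> and \<open>H\<close> to \<open>W\<close> and
      \<open>E\<close> costs \<open>b\<close> at most the \<open>4 * a\<close> vertices of
      \<open>U\<close> and the \<open>r\<close> vertices of its own block as neighbours, and adds at
      most its own block to the blocks containing non-neighbours.\<close>
    fix b assume "b \<in> W"
    then have b: "b \<in> V" using W by auto
    let ?P = "{v \<in> V. \<beta> v = \<beta> b}"
    have "\<beta> ` {v \<in> W. \<not> E b v} \<subseteq> insert (\<beta> b) (\<beta> ` {v \<in> V. \<not> H b v})"
      using W by (auto simp: E_def)
    then have "card (\<beta> ` {v \<in> W. \<not> E b v}) \<le> card (insert (\<beta> b) (\<beta> ` {v \<in> V. \<not> H b v}))"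
      using finite_V by (intro card_mono) auto
    also have "\<dots> \<le> card (\<beta> ` {v \<in> V. \<not> H b v}) + 1" using finite_V by (simp add: card_insert_if)
    finally have 1: "card (\<beta> ` {v \<in> W. \<not> E b v}) \<le> card (\<beta> ` {v \<in> V. \<not> H b v}) + 1" .
    have "{v \<in> V. H b v} \<subseteq> {v \<in> W. E b v} \<union> (U \<union> ?P)" by (auto simp: W_def E_def)
    then have "card {v \<in> V. H b v} \<le> card ({v \<in> W. E b v} \<union> (U \<union> ?P))"
      using finite_V W UV by (intro card_mono) (auto intro: finite_subset)
    also have "\<dots> \<le> card {v \<in> W. E b v} + card (U \<union> ?P)" by (rule card_Un_le)
    also have "card (U \<union> ?P) \<le> card U + card ?P" by (rule card_Un_le)
    finally have "card {v \<in> V. H b v} \<le> card {v \<in> W. E b v} + (4 * a + r)" using cU r[of "\<beta> b"] by simp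
    then show "card (\<beta> ` {v \<in> W. \<not> E b v}) + 4 * k \<le> card {v \<in> W. E b v}"
      using 1 cond[OF b] by linarith
  qed (use k L \<theta> H_sym in \<open>auto simp: E_def\<close>)
  then obtain ps where ps: "path_system (\<lambda>u v. E u v \<or> (\<beta> u = \<beta> v \<and> u \<noteq> v)) ps" "set (concat ps) = W"
    "real (length ps) \<le> real (card W) * (1 / real L + 2 * (\<theta> + real r * (real L)\<^sup>2 / (real k * \<theta>)))"
    by blast
  have "real (card W) * (1 / real L + 2 * (\<theta> + real r * (real L)\<^sup>2 / (real k * \<theta>))) \<le>
      real (card V) * (1 / real L + 2 * (\<theta> + real r * (real L)\<^sup>2 / (real k * \<theta>)))"
    using \<theta> cW by (intro mult_right_mono) auto
  then have lK: "length ps \<le> K" using ps(3) few by linarith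
  have psG: "path_system G ps" by (rule path_system_mono[OF ps(1)]) (auto simp: E_def G_def)
  have "length (concat ps) = card W"
    using psG ps(2) distinct_card[of "concat ps"] by (simp add: path_system_def)
  then have "l - 4 * a \<le> length (concat ps)" using cW l by simp
  from path_system_truncate[OF psG this] obtain qs where qs: "path_system G qs" "set (concat qs) \<subseteq> W"
    "length (concat qs) = l - 4 * a" "length qs \<le> length ps"
    unfolding ps(2) by blast
  define N where "N = length qs"
  have qsn: "qs ! i \<noteq> []" "successively G (qs ! i)" "distinct (qs ! i)" "set (qs ! i) \<subseteq> W" if "i < N" for i
  proof -
    have "qs ! i \<in> set qs" using that by (simp add: N_def)
    then show "qs ! i \<noteq> []" "successively G (qs ! i)" "distinct (qs ! i)" "set (qs ! i) \<subseteq> W"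
      using qs(1,2) by (auto simp: path_system_def distinct_concat_iff)
  qed
  have qsd: "set (qs ! i) \<inter> set (qs ! i') = {}" if "i < N" "i' < N" "i \<noteq> i'" for i i'
  proof -
    have dc: "distinct (removeAll [] qs)" "\<And>ys zs. ys \<in> set qs \<Longrightarrow> zs \<in> set qs \<Longrightarrow> ys \<noteq> zs \<Longrightarrow> set ys \<inter> set zs = {}"
      using qs(1) by (auto simp: path_system_def distinct_concat_iff)
    have "removeAll [] qs = qs" using qs(1) by (simp add: path_system_def removeAll_id)
    then have "qs ! i \<noteq> qs ! i'" using dc(1) that by (simp add: N_def nth_eq_iff_index_eq)
    then show ?thesis using dc(2)[of "qs ! i" "qs ! i'"] that by (simp add: N_def)
  qed
  \<comment> \<open>There are at most \<open>K\<close> paths, and every pair of ends has at least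
    \<open>K\<close> suitable absorbers, so each path can receive an absorber of its own.\<close>
  have "\<exists>g. inj_on g {..<N} \<and> (\<forall>i\<in>{..<N}. g i \<in> bridges (hd (qs ! i)) (last (qs ! i)) \<inter> {..<a})"
  proof (rule distinct_representatives)
    fix i assume "i \<in> {..<N}"
    then have "qs ! i \<noteq> []" "set (qs ! i) \<subseteq> V" using qsn[of i] W by auto
    then have "hd (qs ! i) \<in> V" "last (qs ! i) \<in> V" by auto
    then show "card {..<N} \<le> card (bridges (hd (qs ! i)) (last (qs ! i)) \<inter> {..<a})"
      using K[of "hd (qs ! i)" "last (qs ! i)"] qs(4) lK by (simp add: N_def)
  qed auto
  then obtain g where g: "inj_on g {..<N}" "\<And>i. i < N \<Longrightarrow> g i \<in> bridges (hd (qs ! i)) (last (qs ! i))" "\<And>i. i < N \<Longrightarrow> g i < a"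
    by auto
  define s where "s t = (if t \<in> g ` {..<N} then qs ! (the_inv_into {..<N} g t) else [])" for t
  have sg: "s (g i) = qs ! i" if "i < N" for i
    using that g(1) by (simp add: s_def the_inv_into_f_f)
  have s_cases: "s t = [] \<or> (\<exists>i<N. t = g i \<and> s t = qs ! i)" for t
    using sg by (auto simp: s_def)
  define p where "p t = x t # s t @ [y t]" for t
  have hl: "hd (p t) = x t" "last (p t) = y t" for t by (auto simp: p_def)
  have sW: "set (s t) \<subseteq> W" for t
    using s_cases[of t] qsn(4) by (metis empty_set empty_subsetI)
  have UI: "x i \<in> U" "y i \<in> U" if "i \<in> I" for i using that by (auto simp: U_def)
  have tI: "t \<in> I" "j t \<in> I" if "t < a" for t using that by (auto simp: I_def)
  have out: "x i \<notin> set (s t)" "y i \<notin> set (s t)" if "i \<in> I" for i t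
    using UI[OF that] sW[of t] by (auto simp: W_def)
  have "is_cycle G (concat (map (\<lambda>t. p t @ [x (j t), y (j t)]) [0..<a]))"
  proof (rule is_cycle_linked[OF a(1) _ _ j(1)])
    fix t assume t: "t < a"
    have h: "x t \<noteq> y t" "\<beta> (x t) = \<beta> (y t)" using heads[OF lt[OF t]] by auto
    have "successively G (p t)"
    proof (cases "s t = []")
      case True
      then show ?thesis using h by (simp add: p_def G_def)
    next
      case False
      then obtain i where i: "i < N" "t = g i" "s t = qs ! i" using s_cases[of t] by auto
      then have "H (hd (qs ! i)) (x t)" "H (last (qs ! i)) (y t)" using g(2)[of i] by (auto simp: bridges_def)
      then show ?thesis using i qsn[OF i(1)] H_sym
        by (auto simp: p_def G_def successively_Cons successively_append_iff)
    qed
    moreover have "distinct (s t)" using s_cases[of t] qsn(3) by auto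
    ultimately show "p t \<noteq> [] \<and> successively G (p t) \<and> distinct (p t)"
      using out[OF tI(1)[OF t], of t] h by (auto simp: p_def)
    show "j t \<in> bridges (last (p t)) (hd (p (Suc t mod a)))" using j(2)[OF t] by (simp add: hl)
  next
    fix t t' assume t: "t < a" "t' < a" "t \<noteq> t'"
    have "set (s t) \<inter> set (s t') = {}"
      using s_cases[of t] s_cases[of t'] qsd t by fastforce
    then show "set (p t) \<inter> set (p t') = {}"
      using out[OF tI(1)[OF t(1)], of t'] out[OF tI(1)[OF t(2)], of t] heads_neq[OF lt[OF t(1)] lt[OF t(2)] t(3)]
      by (auto simp: p_def)
  next
    fix t t' assume t: "t < a" "t' < a"
    have ne: "j t \<noteq> t'" using jm(2)[OF t(1)] t by simp
    then show "x (j t) \<notin> set (p t') \<and> y (j t) \<notin> set (p t')"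
      using out[OF tI(2)[OF t(1)], of t'] heads_neq[OF jm(1)[OF t(1)] lt[OF t(2)] ne] by (auto simp: p_def)
  qed
  moreover have "length (concat (map (\<lambda>t. p t @ [x (j t), y (j t)]) [0..<a])) = l"
  proof -
    have "(\<Sum>t<a. length (s t)) = (\<Sum>t\<in>g ` {..<N}. length (s t))"
      by (rule sum.mono_neutral_right) (use g(3) in \<open>auto simp: s_def\<close>)
    also have "\<dots> = (\<Sum>i<N. length (qs ! i))" using g(1) sg by (simp add: sum.reindex)
    also have "\<dots> = length (concat qs)" by (simp add: N_def length_concat sum_list_sum_nth atLeast0LessThan)
    finally have "(\<Sum>t<a. length (s t)) = l - 4 * a" using qs(3) by simp
    moreover have "(\<Sum>t<a. length (p t @ [x (j t), y (j t)])) = (\<Sum>t<a. length (s t) + 4)"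
      by (rule sum.cong) (auto simp: p_def)
    then have "(\<Sum>t<a. length (p t @ [x (j t), y (j t)])) = (\<Sum>t<a. length (s t)) + 4 * a"
      by (simp only: sum.distrib) simp
    ultimately show ?thesis using l by (simp add: length_concat_map_upt)
  qed
  moreover have "set (concat (map (\<lambda>t. p t @ [x (j t), y (j t)]) [0..<a])) \<subseteq> V"
    by (rule set_linked) (use sW W heads lt jm in \<open>auto simp: p_def\<close>)
  ultimately show ?thesis by blast
qed

end

section \<open>Cycles and factors as digraphs\<close>

lemma cas_zip_tl:
  assumes "ws \<noteq> []" "tail D = fst" "head D = snd"
  shows "pre_digraph.cas D (hd ws) (zip ws (tl ws)) (last ws) \<and>
    pre_digraph.awalk_verts D (hd ws) (zip ws (tl ws)) = ws"
  using assms(1)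
proof (induction ws)
  case (Cons w ws)
  show ?case
  proof (cases ws)
    case Nil
    then show ?thesis by (simp add: pre_digraph.cas.simps pre_digraph.awalk_verts.simps)
  next
    case (Cons v vs)
    then show ?thesis using Cons.IH assms
      by (simp add: pre_digraph.cas.simps pre_digraph.awalk_verts.simps)
  qed
qed simp

lemma successively_zip_tl: "successively R ws \<Longrightarrow> (u, v) \<in> set (zip ws (tl ws)) \<Longrightarrow> R u v"
  by (induction R ws rule: successively.induct) auto

text \<open>Repeating the first vertex at the end gives the vertex list of a closed walk, whose arcs
  are its consecutive pairs.\<close>

lemma cycle_of_is_cycle:
  assumes D: "tail D = fst" "head D = snd" and xs: "is_cycle G xs" "set xs \<subseteq> verts D"
    and G: "\<And>u v. u \<in> set xs \<Longrightarrow> v \<in> set xs \<Longrightarrow> G u v \<Longrightarrow> (u, v) \<in> arcs D"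
  shows "\<exists>p. pre_digraph.cycle D p \<and> length p = length xs"
proof -
  define ws where "ws = xs @ [hd xs]"
  have ne: "xs \<noteq> []" "ws \<noteq> []" and hl: "hd ws = hd xs" "last ws = hd xs"
    using xs by (auto simp: ws_def is_cycle_def)
  have tl: "tl ws = tl xs @ [hd xs]" using ne by (simp add: ws_def)
  let ?p = "zip ws (tl ws)"
  have suc: "successively G ws" using xs ne by (simp add: ws_def is_cycle_def successively_append_iff)
  have "(u, v) \<in> arcs D" if "(u, v) \<in> set ?p" for u v
  proof (rule G)
    have "u \<in> set ws" "v \<in> set (tl ws)" using that by (auto dest: set_zip_leftD set_zip_rightD)
    then show "u \<in> set xs" "v \<in> set xs" using ne tl by (auto simp: ws_def dest: list.set_sel(2))
    show "G u v" using successively_zip_tl[OF suc that] .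
  qed
  then have "set ?p \<subseteq> arcs D" by auto
  moreover have "hd xs \<in> verts D" using ne xs(2) by auto
  ultimately have "pre_digraph.awalk D (hd xs) ?p (hd xs)"
    using cas_zip_tl[OF ne(2) D] by (simp add: pre_digraph.awalk_def hl)
  moreover have "distinct (tl (pre_digraph.awalk_verts D (hd xs) ?p))"
  proof -
    have "distinct (tl xs @ [hd xs])" using xs(1) ne by (cases xs) (auto simp: is_cycle_def)
    then show ?thesis using cas_zip_tl[OF ne(2) D] tl by (simp add: hl)
  qed
  moreover have len: "length ?p = length xs" using ne by (simp add: tl) (simp add: ws_def)
  moreover have "?p \<noteq> []" using len ne(1) by (metis length_0_conv)
  ultimately show ?thesis unfolding pre_digraph.cycle_def by blast
qed

lemma cas_closed_set:
  assumes "pre_digraph.cas D u p w" "u \<in> S" "\<And>e. e \<in> set p \<Longrightarrow> tail D e \<in> S \<Longrightarrow> head D e \<in> S"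
  shows "tail D ` set p \<subseteq> S \<and> w \<in> S"
  using assms
proof (induction p arbitrary: u)
  case (Cons e p)
  then show ?case by (auto simp: pre_digraph.cas.simps)
qed (simp add: pre_digraph.cas.simps)

lemma cas_append:
  "pre_digraph.cas D u (p @ q) w \<longleftrightarrow> (\<exists>v. pre_digraph.cas D u p v \<and> pre_digraph.cas D v q w)"
  by (induction p arbitrary: u) (auto simp: pre_digraph.cas.simps)

text \<open>From \<open>e\<close> on the walk stays in \<open>S\<close> until it returns to
  \<open>u\<close>; so \<open>u\<close> lies in \<open>S\<close>, and the part before
  \<open>e\<close> stays in \<open>S\<close> as well.\<close>

lemma closed_cas_closed_set:
  assumes p: "pre_digraph.cas D u p u" and e: "e \<in> set p" "tail D e \<in> S"
    and S: "\<And>e. e \<in> set p \<Longrightarrow> tail D e \<in> S \<Longrightarrow> head D e \<in> S"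
  shows "tail D ` set p \<subseteq> S"
proof -
  obtain p1 p2 where p12: "p = p1 @ e # p2" using e(1) by (meson split_list)
  then obtain v where v: "pre_digraph.cas D u p1 v" "pre_digraph.cas D v (e # p2) u"
    using p by (auto simp: cas_append)
  then have "v \<in> S" using e(2) by (simp add: pre_digraph.cas.simps)
  then have "tail D ` set (e # p2) \<subseteq> S \<and> u \<in> S"
    using cas_closed_set[OF v(2)] S p12 by auto
  moreover from this have "tail D ` set p1 \<subseteq> S"
    using cas_closed_set[OF v(1)] S p12 by auto
  ultimately show ?thesis using p12 by auto
qed

text \<open>
  From each block that meets the complement of \<open>A\<close> the cycle has to leave directly into \<open>A\<close>, and the
  heads of these arcs are distinct.
\<close>

lemma hamiltonian_block_bound:
  assumes ham: "hamiltonian D" and A: "A \<subseteq> verts D" "A \<noteq> {}" "finite A"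
    and wf: "\<And>e. e \<in> arcs D \<Longrightarrow> head D e \<in> verts D"
    and arcs: "\<And>e. e \<in> arcs D \<Longrightarrow> tail D e \<notin> A \<Longrightarrow> head D e \<notin> A \<Longrightarrow> \<beta> (tail D e) = \<beta> (head D e)"
  shows "card (\<beta> ` (verts D - A)) \<le> card A"
proof -
  obtain p where p: "pre_digraph.cycle D p" "tail D ` set p = verts D"
    using ham by (auto simp: hamiltonian_def)
  then obtain u where u: "pre_digraph.awalk D u p u" "distinct (tl (pre_digraph.awalk_verts D u p))" "p \<noteq> []"
    by (auto simp: pre_digraph.cycle_def)
  have cas: "pre_digraph.cas D u p u" and pa: "set p \<subseteq> arcs D"
    using u(1) by (auto simp: pre_digraph.awalk_def)
  have "distinct (map (head D) p)"
    using u(2,3) by (simp add: pre_digraph.awalk_verts_conv'[OF cas])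
  then have inj: "inj_on (head D) (set p)" by (simp add: distinct_map)
  have ex: "\<exists>e\<in>set p. tail D e \<notin> A \<and> \<beta> (tail D e) = i \<and> head D e \<in> A" if i: "i \<in> \<beta> ` (verts D - A)" for i
  proof (rule ccontr)
    assume no: "\<not> ?thesis"
    \<comment> \<open>Without such an arc the cycle could never leave the part of block
      \<open>i\<close> outside \<open>A\<close>, and so it would miss \<open>A\<close>.\<close>
    let ?S = "{v \<in> verts D - A. \<beta> v = i}"
    obtain v where v: "v \<in> verts D - A" "\<beta> v = i" using i by auto
    then have "v \<in> tail D ` set p" using p(2) by simp
    then obtain e where e: "e \<in> set p" "tail D e = v" by auto
    have "tail D ` set p \<subseteq> ?S"
    proof (rule closed_cas_closed_set[OF cas e(1)])
      show "tail D e \<in> ?S" using e v by simp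
      fix e' assume e': "e' \<in> set p" "tail D e' \<in> ?S"
      then have "head D e' \<notin> A" using no by auto
      then show "head D e' \<in> ?S" using arcs[of e'] wf[of e'] e' pa by auto
    qed
    then show False using p(2) A by auto
  qed
  define f where "f i = (SOME e. e \<in> set p \<and> tail D e \<notin> A \<and> \<beta> (tail D e) = i \<and> head D e \<in> A)" for i
  have f: "f i \<in> set p \<and> tail D (f i) \<notin> A \<and> \<beta> (tail D (f i)) = i \<and> head D (f i) \<in> A"
    if "i \<in> \<beta> ` (verts D - A)" for i
    unfolding f_def by (rule someI_ex) (use ex[OF that] in blast)
  show ?thesis
  proof (rule card_inj_on_le[where f = "\<lambda>i. head D (f i)"])
    show "inj_on (\<lambda>i. head D (f i)) (\<beta> ` (verts D - A))"
    proof (rule inj_onI)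
      fix i j assume ij: "i \<in> \<beta> ` (verts D - A)" "j \<in> \<beta> ` (verts D - A)" "head D (f i) = head D (f j)"
      have fi: "f i \<in> set p" "\<beta> (tail D (f i)) = i" using f[OF ij(1)] by blast+
      have fj: "f j \<in> set p" "\<beta> (tail D (f j)) = j" using f[OF ij(2)] by blast+
      have "f i = f j" by (rule inj_onD[OF inj ij(3) fi(1) fj(1)])
      then have "\<beta> (tail D (f i)) = \<beta> (tail D (f j))" by (rule arg_cong)
      then show "i = j" unfolding fi(2) fj(2) .
    qed
    show "(\<lambda>i. head D (f i)) ` \<beta> ` (verts D - A) \<subseteq> A" using f by blast
  qed (fact A(3))
qed

section \<open>Blocks of an ordering and the factor they carry\<close>

definition block_of :: "nat \<Rightarrow> 'a list \<Rightarrow> 'a \<Rightarrow> nat" where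
  "block_of r vs v = the_inv_into {..<length vs} ((!) vs) v div r"

lemma block_of_nth:
  assumes "distinct vs" "p < length vs"
  shows "block_of r vs (vs ! p) = p div r"
proof -
  have "inj_on ((!) vs) {..<length vs}" using assms by (auto simp: inj_on_def nth_eq_iff_index_eq)
  then show ?thesis using assms by (simp add: block_of_def the_inv_into_f_f)
qed

lemma block_index_less: "i < n div r \<Longrightarrow> j < r \<Longrightarrow> i * r + j < (n::nat)"
proof -
  assume "i < n div r" "j < r"
  then have "Suc i * r \<le> (n div r) * r" by (intro mult_right_mono) auto
  also have "\<dots> \<le> n" by simp
  finally show ?thesis using \<open>j < r\<close> by simp
qed

text \<open>The vertices of \<open>complete_graph r\<close> count from 1, positions in a list from
  0. Divisibility makes the last block full; an incomplete one would carry no arcs.\<close>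

lemma parcs_factor_complete:
  assumes vs: "vs \<in> permutations_of_set V" and r: "r > 0" "r dvd card V"
  shows "(u, v) \<in> parcs (factor_of_ordering (complete_graph r) vs) \<longleftrightarrow>
    u \<in> V \<and> v \<in> V \<and> block_of r vs u = block_of r vs v \<and> u \<noteq> v"
proof -
  have d: "distinct vs" "set vs = V" "length vs = card V"
    using vs by (auto simp: permutations_of_set_def distinct_card)
  have P: "(u, v) \<in> parcs (factor_of_ordering (complete_graph r) vs) \<longleftrightarrow>
      (\<exists>i j k. i < length vs div r \<and> j < r \<and> k < r \<and> j \<noteq> k \<and> u = vs ! (i * r + j) \<and> v = vs ! (i * r + k))"
    (is "?L \<longleftrightarrow> ?R")
  proof
    assume ?L
    then obtain i j k where *: "u = vs ! (i * r + (j - 1))" "v = vs ! (i * r + (k - 1))"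
      "i < length vs div r" "j \<in> {1..r}" "k \<in> {1..r}" "j \<noteq> k"
      by (auto simp: factor_of_ordering_def complete_graph_def)
    then show ?R by (intro exI[of _ i] exI[of _ "j - 1"] exI[of _ "k - 1"]) auto
  next
    assume ?R
    then obtain i j k where *: "u = vs ! (i * r + j)" "v = vs ! (i * r + k)"
      "i < length vs div r" "j < r" "k < r" "j \<noteq> k" by blast
    have c: "card (pverts (complete_graph r)) = r" by (simp add: complete_graph_def)
    have "(Suc j, Suc k) \<in> parcs (complete_graph r)" using * by (simp add: complete_graph_def)
    moreover have "(u, v) = (vs ! (i * r + (Suc j - 1)), vs ! (i * r + (Suc k - 1)))" using * by simp
    ultimately show ?L using *(3) unfolding factor_of_ordering_def Let_def c pair_pre_digraph.simps mem_Collect_eq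
      by blast
  qed
  show ?thesis
  proof
    assume "(u, v) \<in> parcs (factor_of_ordering (complete_graph r) vs)"
    then obtain i j k where *: "u = vs ! (i * r + j)" "v = vs ! (i * r + k)"
      "i < length vs div r" "j < r" "k < r" "j \<noteq> k" unfolding P by blast
    have l: "i * r + j < length vs" "i * r + k < length vs" using block_index_less * by auto
    then show "u \<in> V \<and> v \<in> V \<and> block_of r vs u = block_of r vs v \<and> u \<noteq> v"
      using * d block_of_nth[OF d(1) l(1), of r] block_of_nth[OF d(1) l(2), of r]
      by (auto simp: nth_eq_iff_index_eq)
  next
    assume uv: "u \<in> V \<and> v \<in> V \<and> block_of r vs u = block_of r vs v \<and> u \<noteq> v"
    then obtain p q where p: "p < length vs" "u = vs ! p" and q: "q < length vs" "v = vs ! q"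
      using d by (metis in_set_conv_nth)
    have pq: "p div r = q div r" "p \<noteq> q" using uv p q block_of_nth[OF d(1)] by auto
    have eq: "p = p div r * r + p mod r" by simp
    have eq': "q = p div r * r + q mod r" unfolding pq(1) by simp
    have "p div r < length vs div r" using p r d
      by (metis div_less_iff_less_mult dvd_div_mult_self)
    moreover have "p mod r \<noteq> q mod r" using eq eq' pq(2) by metis
    ultimately show "(u, v) \<in> parcs (factor_of_ordering (complete_graph r) vs)"
      unfolding P using p q eq eq' r
      by (intro exI[of _ "p div r"] exI[of _ "p mod r"] exI[of _ "q mod r"]) auto
  qed
qed

lemma card_block_of:
  assumes vs: "vs \<in> permutations_of_set V" and r: "r > 0"
  shows "card {v \<in> V. block_of r vs v = i} \<le> r"
proof -
  have d: "distinct vs" "set vs = V" using vs by (auto simp: permutations_of_set_def)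
  have "{v \<in> V. block_of r vs v = i} \<subseteq> (\<lambda>j. vs ! (i * r + j)) ` {..<r}"
  proof
    fix v assume "v \<in> {v \<in> V. block_of r vs v = i}"
    then obtain p where p: "p < length vs" "v = vs ! p" "p div r = i"
      using d block_of_nth[OF d(1), of _ r] by (metis (mono_tags, lifting) in_set_conv_nth mem_Collect_eq)
    then have "v = vs ! (i * r + p mod r)" by auto
    then show "v \<in> (\<lambda>j. vs ! (i * r + j)) ` {..<r}" using r by auto
  qed
  then have "card {v \<in> V. block_of r vs v = i} \<le> card ((\<lambda>j. vs ! (i * r + j)) ` {..<r})"
    by (intro card_mono) auto
  also have "\<dots> \<le> r" using card_image_le[of "{..<r}" "\<lambda>j. vs ! (i * r + j)"] by simp
  finally show ?thesis .
qed

lemma block_of_image_compl: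
  assumes vs: "vs \<in> permutations_of_set V" and r: "r > 0" "r dvd card V"
  shows "block_of r vs ` (V - N) = {..<card V div r} - {i. \<forall>j<r. vs ! (i * r + j) \<in> N}"
proof -
  have d: "distinct vs" "set vs = V" "length vs = card V"
    using vs by (auto simp: permutations_of_set_def distinct_card)
  show ?thesis
  proof (intro equalityI subsetI)
    fix i assume "i \<in> block_of r vs ` (V - N)"
    then obtain p where p: "p < length vs" "vs ! p \<notin> N" "i = block_of r vs (vs ! p)"
      using d by (metis DiffE imageE in_set_conv_nth)
    then have i: "i = p div r" using block_of_nth[OF d(1)] by simp
    then have "p = i * r + p mod r" "p mod r < r" using r by auto
    then have "\<not> (\<forall>j<r. vs ! (i * r + j) \<in> N)" using p(2) by metis
    moreover have "i < card V div r" using p r d i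
      by (metis div_less_iff_less_mult dvd_div_mult_self)
    ultimately show "i \<in> {..<card V div r} - {i. \<forall>j<r. vs ! (i * r + j) \<in> N}" by simp
  next
    fix i assume "i \<in> {..<card V div r} - {i. \<forall>j<r. vs ! (i * r + j) \<in> N}"
    then obtain j where j: "i < card V div r" "j < r" "vs ! (i * r + j) \<notin> N" by auto
    then have l: "i * r + j < length vs" using block_index_less d by metis
    then have "block_of r vs (vs ! (i * r + j)) = i" using block_of_nth[OF d(1) l] j by simp
    then show "i \<in> block_of r vs ` (V - N)" using j l d by (metis DiffI image_eqI nth_mem)
  qed
qed

text \<open>This turns the upper bound on blocks required by Hall's condition into a lower bound on
  \<open>block_count\<close>, so lower tails suffice.\<close>

lemma card_block_of_image_compl:
  assumes vs: "vs \<in> permutations_of_set V" and r: "r > 0" "r dvd card V"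
  shows "real (card (block_of r vs ` (V - N))) =
    real (card V div r) - block_count r r (\<lambda>_. N) {..<card V div r} vs"
proof -
  let ?I = "{i \<in> {..<card V div r}. \<forall>j<r. vs ! (i * r + j) \<in> N}"
  have "card {..<card V div r} = card ?I + card ({..<card V div r} - ?I)"
    by (rule card_split) auto
  moreover have "block_of r vs ` (V - N) = {..<card V div r} - ?I"
    unfolding block_of_image_compl[OF vs r] by auto
  ultimately show ?thesis by (simp add: block_count_def)
qed

lemma prob_random_factor:
  assumes "finite V"
  shows "measure_pmf.prob (random_factor F V) S = perm_avg V (\<lambda>vs. of_bool (factor_of_ordering F vs \<in> S))"
  using assms
  by (simp add: random_factor_def measure_pmf_of_set perm_avg_def vimage_def Int_def)

section \<open>Pancyclicity for typical orderings\<close>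

lemma ex1_rho:
  assumes "r \<ge> 1"
  shows "\<exists>!x::real. 0 < x \<and> x ^ r + real r * x - 1 = 0"
proof -
  let ?f = "\<lambda>x::real. x ^ r + real r * x - 1"
  have "\<exists>x\<ge>0. x \<le> 1 \<and> ?f x = 0"
    by (rule IVT') (use assms in \<open>auto simp: power_0_left intro!: continuous_intros\<close>)
  then obtain x where x: "0 \<le> x" "?f x = 0" by auto
  have "x \<noteq> 0" using x assms by (auto simp: power_0_left)
  then have "0 < x" using x by auto
  have mono: "?f y < ?f z" if "0 < y" "y < z" for y z :: real
    using that assms power_mono[of y z r] by (simp add: add_le_less_mono)
  show ?thesis
  proof (rule ex1I[of _ x])
    fix y assume y: "0 < y \<and> ?f y = 0"
    show "y = x"
    proof (rule ccontr)
      assume "y \<noteq> x"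
      then have "?f y < ?f x \<or> ?f x < ?f y" using mono y \<open>0 < x\<close> by (meson linorder_neqE_linordered_idom)
      then show False using x y by simp
    qed
  qed (use x \<open>0 < x\<close> in auto)
qed

text \<open>On the unit interval \<open>x ^ r\<close> is \<open>r\<close>-Lipschitz. This absorbs
  the shift by \<open>r / n\<close> that drawing without replacement causes in
  \<open>perm_avg_prefix_ge\<close>.\<close>

lemma power_diff_ge:
  assumes "0 \<le> h" "h \<le> x" "x \<le> (1::real)"
  shows "x ^ r - real r * h \<le> (x - h) ^ r"
proof (induction r)
  case (Suc r)
  have "x ^ Suc r - real (Suc r) * h \<le> (x - h) * (x ^ r - real r * h)"
  proof -
    have "h * x ^ r \<le> h * 1" using assms by (intro mult_left_mono power_le_one) auto
    moreover have "real r * h * x \<le> real r * h * 1" using assms by (intro mult_left_mono) auto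
    moreover have "0 \<le> real r * h * h" using assms by simp
    ultimately show ?thesis by (simp add: algebra_simps)
  qed
  also have "\<dots> \<le> (x - h) * (x - h) ^ r" using Suc assms by (intro mult_left_mono) auto
  finally show ?case by simp
qed simp

definition nbrs :: "'a pair_pre_digraph \<Rightarrow> 'a \<Rightarrow> 'a set" where
  "nbrs H u = {v. (u, v) \<in> parcs H}"

lemma out_degree_nbrs: "out_degree (with_proj H) u = card (nbrs H u)"
proof -
  have "out_degree (with_proj H) u = card (Pair u ` nbrs H u)"
    unfolding out_degree_def out_arcs_def nbrs_def by (rule arg_cong[of _ _ card]) auto
  also have "\<dots> = card (nbrs H u)" by (rule card_image) (auto simp: inj_on_def)
  finally show ?thesis .
qed

lemma min_degree_le:
  assumes "pair_graph H" "u \<in> pverts H"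
  shows "min_degree (with_proj H) \<le> card (nbrs H u)"
proof -
  interpret pair_graph H by fact
  show ?thesis
    unfolding min_degree_def out_degree_nbrs[symmetric] using assms(2) pair_finite_verts
    by (intro Min_le) auto
qed

text \<open>
  With \<open>s = d / n\<close>, at most about \<open>(n / r) (1 - s ^ r)\<close> blocks meet the non-neighbours of a
  vertex of degree \<open>d\<close>; since \<open>s \<ge> \<rho> + \<epsilon>\<close> and \<open>\<rho> ^ r + r \<rho> = 1\<close>, this is below \<open>d\<close> by at
  least \<open>\<epsilon> n\<close> up to lower order terms, and this surplus pays for the absorbers (\<open>4 a\<close> vertices)
  and for \<open>k\<close> arc-disjoint permutations.
\<close>

lemma pancyclic_of_good_ordering:
  fixes H :: "nat pair_pre_digraph" and \<epsilon> \<rho> :: real and r L d\<^sub>0 :: nat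
  defines "V \<equiv> pverts H"
  defines "n \<equiv> card V"
  defines "m \<equiv> n div r" and "c \<equiv> \<epsilon>\<^sup>2 / 4" and "\<kappa> \<equiv> \<epsilon>\<^sup>2 / 32"
  defines "\<delta> \<equiv> c * \<kappa> / (4 * real r)"
  defines "a \<equiv> nat \<lfloor>\<kappa> * real m\<rfloor>"
  assumes H: "pair_graph H" and r: "r \<ge> 2" "r dvd n" and \<rho>: "0 < \<rho>" "\<rho> ^ r + real r * \<rho> - 1 = 0"
    and \<epsilon>: "0 < \<epsilon>" "\<epsilon> \<le> 1"
    and d0: "(\<rho> + \<epsilon>) * real n \<le> real d\<^sub>0" "\<And>v. v \<in> V \<Longrightarrow> d\<^sub>0 \<le> card (nbrs H v)"
    and L: "L > 0" "1 / real L \<le> \<delta> / 4"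
    and n: "3 * real r \<le> \<kappa> * real n" "16 * real r + 8 \<le> \<epsilon> * real n"
      "64 * real r * (real L)\<^sup>2 / \<delta>\<^sup>2 \<le> \<epsilon> * real n / 32 - 1"
    and vs: "vs \<in> permutations_of_set V"
    and g1: "\<And>b. b \<in> V \<Longrightarrow> real m * ((real (card (nbrs H b)) - real r) / real n) ^ r - \<delta> * real n
      < block_count r r (\<lambda>_. nbrs H b) {..<m} vs"
    and g2: "\<And>p q. p \<in> V \<Longrightarrow> q \<in> V \<Longrightarrow> real m * ((real d\<^sub>0 - 2) / real n) ^ 2 - \<delta> * real n
      < block_count r 2 (\<lambda>j. if j = 0 then nbrs H p else nbrs H q) {..<m} vs"
    and g3: "\<And>p q. p \<in> V \<Longrightarrow> q \<in> V \<Longrightarrow> real a * ((real d\<^sub>0 - 2) / real n) ^ 2 - \<delta> * real n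
      < block_count r 2 (\<lambda>j. if j = 0 then nbrs H p else nbrs H q) {..<a} vs"
  shows "pancyclic (union (with_proj H) (with_proj (factor_of_ordering (complete_graph r) vs)))"
proof -
  interpret P: pair_graph H by fact
  have finV: "finite V" using P.pair_finite_verts by (simp add: V_def)
  have d: "distinct vs" "set vs = V" "length vs = n"
    using vs by (auto simp: permutations_of_set_def distinct_card n_def)
  define \<beta> where "\<beta> = block_of r vs"
  define x where "x i = vs ! (i * r)" for i
  define y where "y i = vs ! (i * r + 1)" for i
  have nm: "real n = real r * real m" using r(2) by (simp add: m_def flip: of_nat_mult)
  have r0: "real r > 0" "r > 0" using r by auto
  have heads: "x i \<in> V \<and> y i \<in> V \<and> x i \<noteq> y i \<and> \<beta> (x i) = i \<and> \<beta> (y i) = i" if "i < m" for i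
  proof -
    have l: "i * r < length vs" "i * r + 1 < length vs"
      using block_index_less[of i n r 0] block_index_less[of i n r 1] that r d by (auto simp: m_def)
    then have "x i \<noteq> y i" using d(1) by (simp add: x_def y_def nth_eq_iff_index_eq)
    moreover have "\<beta> (x i) = i" using block_of_nth[OF d(1) l(1), of r] r by (auto simp: x_def \<beta>_def)
    moreover have "(i * r + 1) div r = i" using r by (subst div_mult_self3) auto
    with block_of_nth[OF d(1) l(2), of r] have "\<beta> (y i) = i" unfolding y_def \<beta>_def by (rule trans)
    ultimately show ?thesis using l d by (auto simp: x_def y_def)
  qed
  interpret block_graph V "\<lambda>u v. (u, v) \<in> parcs H" \<beta> x y m
  proof
    show "(v, u) \<in> parcs H" if "(u, v) \<in> parcs H" for u v
      using P.pair_sym_arcs that by (auto simp: symmetric_def dest: symD)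
    show "u \<in> V" if "(u, v) \<in> parcs H" for u v
      using P.in_arcsD1 that by (auto simp: V_def)
    show "(u, u) \<notin> parcs H" for u using P.pair_no_loops by force
  qed (use finV heads in auto)
  have nV: "nbrs H b = {v \<in> V. (b, v) \<in> parcs H}" for b
    using H_V H_sym by (auto simp: nbrs_def)
  have npos: "real n > 0"
  proof (rule ccontr)
    assume "\<not> real n > 0"
    then show False using n(2) r by simp
  qed
  have mn: "real m \<le> real n" by (simp add: m_def)
  have m0: "real m > 0" using npos r0 by (simp add: nm zero_less_mult_iff)
  have c: "c > 0" "c \<le> \<epsilon> / 4" using \<epsilon> by (auto simp: c_def power2_eq_square mult_left_le)
  have \<kappa>: "\<kappa> > 0" "\<kappa> \<le> 1 / 32" "8 * \<kappa> = c"
    using \<epsilon> by (auto simp: \<kappa>_def c_def power2_eq_square mult_le_one)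
  have \<delta>: "\<delta> > 0" "\<delta> * real n = c * \<kappa> * real m / 4"
    using c \<kappa> r0 by (auto simp: \<delta>_def nm field_simps)
  have \<kappa>m: "3 \<le> \<kappa> * real m" using n(1) r0 by (simp add: nm mult.left_commute)
  have a: "real a \<le> \<kappa> * real m" "\<kappa> * real m / 2 \<le> real a" "3 \<le> a" "a \<le> m"
  proof -
    have 1: "real a = of_int \<lfloor>\<kappa> * real m\<rfloor>" using \<kappa>m by (simp add: a_def)
    show 2: "real a \<le> \<kappa> * real m" using 1 by simp
    show "\<kappa> * real m / 2 \<le> real a" using 1 \<kappa>m by linarith
    show "3 \<le> a" using \<kappa>m unfolding a_def by (simp add: le_nat_iff le_floor_iff)
    have "\<kappa> * real m \<le> 1 * real m" using \<kappa> by (intro mult_right_mono) auto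
    then show "a \<le> m" using 2 by linarith
  qed
  have a4: "4 * real a \<le> c * real m / 2"
  proof -
    have "c * real m = 8 * (\<kappa> * real m)" using \<kappa>(3) by (metis mult.assoc)
    then show ?thesis using a(1) by linarith
  qed
  have sq: "c \<le> ((real d\<^sub>0 - 2) / real n) ^ 2"
  proof -
    have "\<epsilon> * real n \<le> real d\<^sub>0" using d0(1) \<rho>(1) npos by (smt (verit) mult_right_mono)
    moreover have "4 \<le> \<epsilon> * real n" using n(2) r0 by linarith
    ultimately have "\<epsilon> / 2 \<le> (real d\<^sub>0 - 2) / real n" using npos by (simp add: field_simps)
    then have "(\<epsilon> / 2) ^ 2 \<le> ((real d\<^sub>0 - 2) / real n) ^ 2" using \<epsilon> by (intro power_mono) auto
    then show ?thesis by (simp add: c_def power_divide)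
  qed
  have two: "(\<forall>j<2. vs ! (i * r + j) \<in> (if j = 0 then nbrs H p else nbrs H q)) \<longleftrightarrow>
      (p, x i) \<in> parcs H \<and> (q, y i) \<in> parcs H" for i p q
    by (auto simp: less_2_cases_iff x_def y_def nbrs_def)
  have br: "block_count r 2 (\<lambda>j. if j = 0 then nbrs H p else nbrs H q) {..<m} vs = real (card (bridges p q))" for p q
    unfolding block_count_def two bridges_def by simp
  have bra: "block_count r 2 (\<lambda>j. if j = 0 then nbrs H p else nbrs H q) {..<a} vs = real (card (bridges p q \<inter> {..<a}))" for p q
  proof -
    have "{i \<in> {..<a}. (p, x i) \<in> parcs H \<and> (q, y i) \<in> parcs H} = bridges p q \<inter> {..<a}"
      using a by (auto simp: bridges_def)
    then show ?thesis unfolding block_count_def two by simp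
  qed
  have C: "4 * a \<le> card (bridges p q)" if "p \<in> V" "q \<in> V" for p q
  proof -
    note a4
    moreover have "real m * c \<le> real m * ((real d\<^sub>0 - 2) / real n) ^ 2" by (intro mult_left_mono sq) auto
    moreover have "\<delta> * real n \<le> c * real m / 2"
    proof -
      have "c * \<kappa> * real m \<le> c * (1 / 32) * real m" using c \<kappa> by (intro mult_right_mono mult_left_mono) auto
      also have "\<dots> = c * real m / 32" by simp
      finally show ?thesis using \<delta>(2) mult_nonneg_nonneg[of c "real m"] c by linarith
    qed
    ultimately have "4 * real a < real (card (bridges p q))"
      using g2[OF that] unfolding br by (simp add: mult.commute)
    then show ?thesis by linarith
  qed
  define K where "K = nat \<lfloor>c / 2 * real a\<rfloor>"
  have K_eq: "real K = of_int \<lfloor>c / 2 * real a\<rfloor>"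
    unfolding K_def using c by (intro of_nat_nat) simp
  have \<delta>a: "\<delta> * real n \<le> c / 2 * real a"
  proof -
    have "c / 2 * (\<kappa> * real m / 2) \<le> c / 2 * real a" using c a(2) by (intro mult_left_mono) auto
    moreover have "c / 2 * (\<kappa> * real m / 2) = c * \<kappa> * real m / 4" by simp
    ultimately show ?thesis using \<delta>(2) by linarith
  qed
  have K: "K \<le> card (bridges p q \<inter> {..<a})" if "p \<in> V" "q \<in> V" for p q
  proof -
    have "real a * c \<le> real a * ((real d\<^sub>0 - 2) / real n) ^ 2" by (intro mult_left_mono sq) auto
    then have "c / 2 * real a < real (card (bridges p q \<inter> {..<a}))"
      using g3[OF that] \<delta>a unfolding bra by (simp add: mult.commute)
    moreover have "real K \<le> c / 2 * real a" unfolding K_eq by (rule of_int_floor_le)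
    ultimately show ?thesis by linarith
  qed
  define k where "k = nat \<lfloor>\<epsilon> * real n / 32\<rfloor>"
  have big: "1 \<le> \<epsilon> * real n / 32"
  proof -
    have "0 \<le> 64 * real r * (real L)\<^sup>2 / \<delta>\<^sup>2" by simp
    then show ?thesis using n(3) by linarith
  qed
  have k: "real k \<le> \<epsilon> * real n / 32" "64 * real r * (real L)\<^sup>2 / \<delta>\<^sup>2 \<le> real k" "k > 0"
  proof -
    have 1: "real k = of_int \<lfloor>\<epsilon> * real n / 32\<rfloor>" using big by (simp add: k_def)
    show "real k \<le> \<epsilon> * real n / 32" unfolding 1 by (rule of_int_floor_le)
    show "64 * real r * (real L)\<^sup>2 / \<delta>\<^sup>2 \<le> real k" using 1 n(3) by linarith
    show "k > 0" using big unfolding k_def by linarith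
  qed
  \<comment> \<open>The choice \<open>\<theta> = \<delta> / 8\<close> and the size of
    \<open>k\<close> make both terms of the moment estimate at most \<open>\<delta> / 8\<close>;
    together with \<open>1 / L\<close> the sum stays below \<open>\<delta>\<close>.\<close>
  have few: "real n * (1 / real L + 2 * (\<delta> / 8 + real r * (real L)\<^sup>2 / (real k * (\<delta> / 8)))) < real K + 1"
  proof -
    define B where "B = real r * (real L)\<^sup>2 / (real k * (\<delta> / 8))"
    have "B \<le> \<delta> / 8"
    proof -
      have "64 * real r * (real L)\<^sup>2 \<le> real k * \<delta>\<^sup>2" using k(2) \<delta> by (simp add: field_simps)
      then show ?thesis unfolding B_def using \<delta> k(3) by (simp add: field_simps power2_eq_square)
    qed
    moreover have "2 * (\<delta> / 8 + B) = \<delta> / 4 + 2 * B" by simp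
    ultimately have "1 / real L + 2 * (\<delta> / 8 + B) \<le> \<delta>" using L(2) \<delta>(1) by linarith
    then have "real n * (1 / real L + 2 * (\<delta> / 8 + B)) \<le> real n * \<delta>"
      by (intro mult_left_mono) auto
    also have "\<dots> \<le> c / 2 * real a" using \<delta>a by (simp add: mult.commute)
    also have "\<dots> < real K + 1" unfolding K_eq using floor_correct[of "c / 2 * real a"] by simp
    finally show ?thesis unfolding B_def .
  qed
  have cond: "card (\<beta> ` {v \<in> V. (b, v) \<notin> parcs H}) + 4 * k + 4 * a + r + 1 \<le> card {v \<in> V. (b, v) \<in> parcs H}"
    if b: "b \<in> V" for b
  proof -
    define e where "e = real (card (nbrs H b))"
    define z where "z = e / real n"
    have en: "e = z * real n" using npos by (simp add: z_def)
    have "e \<le> real n" unfolding e_def n_def nV using finV by (auto intro: card_mono)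
    then have z1: "z \<le> 1" using npos by (simp add: z_def)
    have "(\<rho> + \<epsilon>) * real n \<le> e" using d0(1) d0(2)[OF b] by (simp add: e_def)
    then have z2: "\<rho> + \<epsilon> \<le> z" using npos by (simp add: z_def field_simps)
    have hz: "real r / real n \<le> z"
    proof -
      have "real r \<le> \<epsilon> * real n" using n(2) r0 by linarith
      then have "real r / real n \<le> \<epsilon>" using npos by (simp add: field_simps)
      then show ?thesis using z2 \<rho>(1) by linarith
    qed
    have "z ^ r - real r * (real r / real n) \<le> (z - real r / real n) ^ r"
      by (rule power_diff_ge) (use hz z1 npos in auto)
    then have "real m * (z ^ r - real r * (real r / real n)) \<le> real m * ((e - real r) / real n) ^ r"
      by (intro mult_left_mono) (auto simp: z_def diff_divide_distrib)
    moreover have "real m * (real r * (real r / real n)) = real r"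
      using m0 r0 by (simp add: nm)
    ultimately have 1: "real m * z ^ r - real r \<le> real m * ((e - real r) / real n) ^ r"
      by (simp add: right_diff_distrib)
    have set: "{v \<in> V. (b, v) \<notin> parcs H} = V - nbrs H b" by (auto simp: nbrs_def)
    have "real (card (\<beta> ` {v \<in> V. (b, v) \<notin> parcs H})) = real m - block_count r r (\<lambda>_. nbrs H b) {..<m} vs"
      unfolding set \<beta>_def m_def n_def by (rule card_block_of_image_compl) (use vs r in \<open>auto simp: n_def\<close>)
    then have 2: "real (card (\<beta> ` {v \<in> V. (b, v) \<notin> parcs H})) < real m - real m * z ^ r + real r + \<delta> * real n"
      using g1[OF b] 1 by (simp add: e_def)
    \<comment> \<open>The defining equation of \<open>\<rho>\<close> enters here:
      \<open>z ^ r + r * z - 1\<close> vanishes at \<open>\<rho>\<close> and grows with slope at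
      least \<open>r\<close>.\<close>
    have "\<rho> ^ r \<le> z ^ r" using z2 \<rho> \<epsilon> by (intro power_mono) auto
    moreover have "real r * (\<rho> + \<epsilon>) \<le> real r * z" using z2 by (intro mult_left_mono) auto
    ultimately have "real r * \<epsilon> \<le> z ^ r + real r * z - 1" using \<rho>(2) by (simp add: ring_distribs)
    then have "real m * (real r * \<epsilon>) \<le> real m * (z ^ r + real r * z - 1)" by (intro mult_left_mono) auto
    then have 3: "\<epsilon> * real n \<le> real m * z ^ r + e - real m" by (simp add: en nm algebra_simps)
    have \<epsilon>n: "\<epsilon> * real n \<ge> 0" using \<epsilon> npos by simp
    have 4: "\<delta> * real n \<le> \<epsilon> * real n / 4"
    proof -
      have "c * \<kappa> * real m / 4 \<le> \<epsilon> / 4 * 1 * real n / 4"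
        using c \<kappa> \<epsilon> mn by (intro divide_right_mono mult_mono) auto
      also have "\<dots> = \<epsilon> * real n / 16" by simp
      finally show ?thesis using \<delta>(2) \<epsilon>n by linarith
    qed
    have 5: "4 * real a \<le> \<epsilon> * real n / 8"
    proof -
      have "4 * real a \<le> c * real m / 2" by (rule a4)
      also have "\<dots> \<le> \<epsilon> / 4 * real n / 2"
        using c \<epsilon> mn by (intro divide_right_mono mult_mono) auto
      finally show ?thesis by simp
    qed
    \<comment> \<open>The surplus \<open>\<epsilon> * n\<close> is spent as follows: at most a
      quarter on \<open>\<delta> * n\<close>, and at most an eighth each on \<open>4 * k\<close>,
      \<open>4 * a\<close> and \<open>2 * r + 1\<close>.\<close>
    have "real (card (\<beta> ` {v \<in> V. (b, v) \<notin> parcs H})) + 4 * real k + 4 * real a + real r + 1 \<le> e"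
      using 2 3 4 5 k(1) n(2) \<epsilon>n by argo
    then have "real (card (\<beta> ` {v \<in> V. (b, v) \<notin> parcs H}) + 4 * k + 4 * a + r + 1) \<le> real (card {v \<in> V. (b, v) \<in> parcs H})"
      unfolding e_def nV by simp
    then show ?thesis by (simp only: of_nat_le_iff)
  qed
  have Vne: "V \<noteq> {}" using npos by (auto simp: n_def)
  then obtain v where v: "v \<in> V" by auto
  have deg2: "card {u \<in> V. (v, u) \<in> parcs H} \<ge> 2" using cond[OF v] r by linarith
  define D where "D = union (with_proj H) (with_proj (factor_of_ordering (complete_graph r) vs))"
  have vD: "verts D = V" using d by (simp add: D_def V_def[symmetric] factor_of_ordering_def Let_def)
  have cycles: "\<exists>xs. is_cycle G xs \<and> set xs \<subseteq> V \<and> length xs = l" if l: "3 \<le> l" "l \<le> n" for l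
  proof (cases "l \<le> 4 * a")
    case True
    \<comment> \<open>The bound \<open>3 \<le> a\<close> provides the \<open>9 \<le> 4 * a\<close>
      that \<open>short_cycle\<close> requires.\<close>
    show ?thesis by (rule short_cycle[of "4 * a" v]) (use C v deg2 l True a in auto)
  next
    case False
    show ?thesis
    proof (rule long_cycle[of a K r k L "\<delta> / 8"])
      show "2 * a \<le> card (bridges p q)" if "p \<in> V" "q \<in> V" for p q using C[OF that] by linarith
      show "card {v \<in> V. \<beta> v = i} \<le> r" for i unfolding \<beta>_def by (rule card_block_of[OF vs]) (use r in auto)
      show "real (card V) * (1 / real L + 2 * (\<delta> / 8 + real r * (real L)\<^sup>2 / (real k * (\<delta> / 8)))) < real K + 1"
        using few by (simp add: n_def)
    qed (use K a cond k L \<delta> l False in \<open>auto simp: n_def\<close>)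
  qed
  have arcs: "(u, w) \<in> arcs D" if "u \<in> V" "w \<in> V" "G u w" for u w
  proof -
    have "(u, w) \<in> parcs H \<or> (\<beta> u = \<beta> w \<and> u \<noteq> w)" using that(3) unfolding G_def .
    then have "(u, w) \<in> parcs H \<or> (u, w) \<in> parcs (factor_of_ordering (complete_graph r) vs)"
      using that parcs_factor_complete[OF vs r0(2), of u w] r(2) by (auto simp: \<beta>_def n_def)
    then show ?thesis by (simp add: D_def)
  qed
  have "\<exists>p. pre_digraph.cycle D p \<and> length p = l" if l: "3 \<le> l" "l \<le> n" for l
  proof -
    obtain xs where xs: "is_cycle G xs" "set xs \<subseteq> V" "length xs = l" using cycles[OF l] by blast
    have "\<exists>p. pre_digraph.cycle D p \<and> length p = length xs"
      by (rule cycle_of_is_cycle[OF _ _ xs(1)]) (use xs(2) vD arcs in \<open>auto simp: D_def\<close>)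
    then show ?thesis using xs(3) by simp
  qed
  then show ?thesis using vD by (auto simp: pancyclic_def D_def[symmetric] n_def)
qed

section \<open>Probability of a typical ordering\<close>

lemma perm_avg_of_bool_ge:
  assumes A: "finite A" and P: "\<And>xs. xs \<in> permutations_of_set A \<Longrightarrow> xs \<notin> B \<Longrightarrow> P xs"
    and B: "B \<subseteq> permutations_of_set A" "real (card B) \<le> fact (card A) * \<eta>"
  shows "1 - \<eta> \<le> perm_avg A (\<lambda>xs. of_bool (P xs))"
proof -
  have fB: "finite B" using B(1) by (rule finite_subset) simp
  have "fact (card A) = real (card B) + real (card (permutations_of_set A - B))"
    using card_split[OF finite_permutations_of_set B(1)] A
    by (metis card_permutations_of_set of_nat_add of_nat_fact)
  also have "real (card (permutations_of_set A - B)) = (\<Sum>xs\<in>permutations_of_set A - B. 1)" by simp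
  also have "\<dots> \<le> (\<Sum>xs\<in>permutations_of_set A - B. of_bool (P xs))"
    by (rule sum_mono) (use P in auto)
  also have "\<dots> \<le> (\<Sum>xs\<in>permutations_of_set A. of_bool (P xs))" by (rule sum_mono2) auto
  finally have "fact (card A) * (1 - \<eta>) \<le> (\<Sum>xs\<in>permutations_of_set A. of_bool (P xs) :: real)"
    using B(2) by (simp add: algebra_simps)
  then show ?thesis by (simp add: perm_avg_def field_simps)
qed

lemma card_UN_le_real:
  assumes "finite I" "\<And>i. i \<in> I \<Longrightarrow> real (card (B i)) \<le> X"
  shows "real (card (\<Union>i\<in>I. B i)) \<le> real (card I) * X"
proof -
  have "real (card (\<Union>i\<in>I. B i)) \<le> (\<Sum>i\<in>I. real (card (B i)))"
    using card_UN_le[OF assms(1), of B] by (metis of_nat_mono of_nat_sum)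
  also have "\<dots> \<le> (\<Sum>i\<in>I. X)" using assms(2) by (rule sum_mono)
  finally show ?thesis by simp
qed

text \<open>Union bound over \<open>n\<close> events for single neighbourhoods and
  \<open>2 * n\<^sup>2\<close> events for pairs of vertices, whose bridges are counted among all
  blocks and among the absorbers.\<close>

lemma prob_pancyclic_ge:
  fixes H :: "nat pair_pre_digraph" and \<epsilon> \<rho> :: real and r L :: nat
  defines "n \<equiv> card (pverts H)"
  defines "\<delta> \<equiv> (\<epsilon>\<^sup>2 / 4) * (\<epsilon>\<^sup>2 / 32) / (4 * real r)"
  assumes H: "pair_graph H" and r: "r \<ge> 2" "r dvd n" and \<rho>: "0 < \<rho>" "\<rho> ^ r + real r * \<rho> - 1 = 0"
    and \<epsilon>: "0 < \<epsilon>" "\<epsilon> \<le> 1"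
    and d0: "(\<rho> + \<epsilon>) * real n \<le> real (min_degree (with_proj H))"
    and L: "L > 0" "1 / real L \<le> \<delta> / 4"
    and n: "3 * real r \<le> \<epsilon>\<^sup>2 / 32 * real n" "16 * real r + 8 \<le> \<epsilon> * real n"
      "64 * real r * (real L)\<^sup>2 / \<delta>\<^sup>2 \<le> \<epsilon> * real n / 32 - 1"
  shows "measure_pmf.prob (random_factor (complete_graph r) (pverts H))
      {F. pancyclic (union (with_proj H) (with_proj F))}
    \<ge> 1 - 3 * (real n)\<^sup>2 * exp (- (\<delta>\<^sup>2 * real n / 16))"
proof -
  interpret P: pair_graph H by fact
  define V where "V = pverts H"
  have finV: "finite V" using P.pair_finite_verts by (simp add: V_def)
  have cV: "card V = n" by (simp add: V_def n_def)
  define X where "X = fact n * exp (- (\<delta>\<^sup>2 * real n / 16))"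
  define d where "d = min_degree (with_proj H)"
  define a where "a = nat \<lfloor>\<epsilon>\<^sup>2 / 32 * real (n div r)\<rfloor>"
  define m where "m = n div r"
  have dle: "d \<le> card (nbrs H v)" if "v \<in> V" for v
    using min_degree_le[OF H, of v] that by (simp add: d_def V_def)
  have nbV: "nbrs H v \<inter> V = nbrs H v" for v
    using P.in_arcsD2 by (auto simp: nbrs_def V_def)
  have npos: "real n > 0"
  proof (rule ccontr)
    assume "\<not> real n > 0"
    then show False using n(2) r by simp
  qed
  have "\<epsilon> * real n \<le> (\<rho> + \<epsilon>) * real n" using \<rho> npos by (intro mult_right_mono) auto
  then have dr: "16 * real r + 8 \<le> real d" using d0 n(2) by (simp add: d_def)
  then have dr': "r \<le> d" "2 \<le> d" by linarith+
  have \<delta>: "0 < \<delta>" "\<delta> \<le> 1"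
  proof -
    show "0 < \<delta>" using \<epsilon> r by (simp add: \<delta>_def)
    have "\<epsilon>\<^sup>2 \<le> 1" using \<epsilon> by (simp add: power_le_one)
    then have "(\<epsilon>\<^sup>2 / 4) * (\<epsilon>\<^sup>2 / 32) / (4 * real r) \<le> 1 * 1 / 1"
      using r by (intro frac_le mult_mono) auto
    then show "\<delta> \<le> 1" by (simp add: \<delta>_def)
  qed
  have rn: "r \<le> n" using r npos by (auto intro: dvd_imp_le)
  have Im: "i * r + r \<le> n" if "i < m" for i
  proof -
    have "i * r + (r - 1) < n" using block_index_less[of i n r "r - 1"] that r by (simp add: m_def)
    then show ?thesis by simp
  qed
  have am: "a \<le> m"
  proof -
    have "\<epsilon>\<^sup>2 / 32 \<le> 1" using power_le_one[of \<epsilon> 2] \<epsilon> by simp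
    then have "\<epsilon>\<^sup>2 / 32 * real m \<le> 1 * real m" by (intro mult_right_mono) auto
    moreover have "real a \<le> \<epsilon>\<^sup>2 / 32 * real m" unfolding a_def m_def by (rule of_nat_floor) simp
    ultimately show ?thesis by linarith
  qed
  define B1 where "B1 b = {vs \<in> permutations_of_set V. block_count r r (\<lambda>_. nbrs H b) {..<m} vs \<le>
    real (card {..<m}) * ((real (card (nbrs H b)) - real r) / real (card V)) ^ r - \<delta> * real (card V)}" for b
  define B2 where "B2 l pq = {vs \<in> permutations_of_set V.
    block_count r 2 (\<lambda>j. if j = 0 then nbrs H (fst pq) else nbrs H (snd pq)) {..<l} vs \<le>
    real (card {..<l}) * ((real d - real 2) / real (card V)) ^ 2 - \<delta> * real (card V)}" for l :: nat and pq
  have b1: "real (card (B1 b)) \<le> X" if b: "b \<in> V" for b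
    unfolding B1_def X_def cV[symmetric]
    by (rule block_count_lower_tail) (use finV r rn cV dle[OF b] dr' Im nbV \<delta> in auto)
  have b2: "real (card (B2 l pq)) \<le> X" if pq: "pq \<in> V \<times> V" and l: "l \<le> m" for pq l
  proof -
    have "d \<le> card ((if j = 0 then nbrs H (fst pq) else nbrs H (snd pq)) \<inter> V)" for j :: nat
      using dle pq nbV by auto
    then show ?thesis
      unfolding B2_def X_def cV[symmetric]
      by (intro block_count_lower_tail) (use finV r rn cV dr' Im l \<delta> in auto)
  qed
  define B where "B = (\<Union>b\<in>V. B1 b) \<union> (\<Union>pq\<in>V \<times> V. B2 m pq) \<union> (\<Union>pq\<in>V \<times> V. B2 a pq)"
  have X: "X \<ge> 0" by (simp add: X_def)
  have "real (card B) \<le> real (card (\<Union>b\<in>V. B1 b)) + real (card (\<Union>pq\<in>V \<times> V. B2 m pq)) + real (card (\<Union>pq\<in>V \<times> V. B2 a pq))"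
    unfolding B_def of_nat_add[symmetric] of_nat_le_iff
    by (rule order_trans[OF card_Un_le add_right_mono[OF card_Un_le]])
  also have "\<dots> \<le> real (card V) * X + real (card (V \<times> V)) * X + real (card (V \<times> V)) * X"
    by (intro add_mono card_UN_le_real) (use finV b1 b2 am in auto)
  also have "\<dots> = real n * X + 2 * (real n)\<^sup>2 * X" by (simp add: cV card_cartesian_product power2_eq_square)
  also have "real n * X \<le> (real n)\<^sup>2 * X" using X npos by (intro mult_right_mono self_le_power) auto
  finally have cB: "real (card B) \<le> fact (card V) * (3 * (real n)\<^sup>2 * exp (- (\<delta>\<^sup>2 * real n / 16)))"
    by (simp add: X_def cV)
  have good: "pancyclic (union (with_proj H) (with_proj (factor_of_ordering (complete_graph r) vs)))"
    if vs: "vs \<in> permutations_of_set V" "vs \<notin> B" for vs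
  proof (rule pancyclic_of_good_ordering[where \<epsilon> = \<epsilon> and \<rho> = \<rho> and L = L and d\<^sub>0 = d])
    fix b assume b: "b \<in> pverts H"
    then have "vs \<notin> B1 b" using vs by (auto simp: B_def V_def)
    then show "real (card (pverts H) div r) * ((real (card (nbrs H b)) - real r) / real (card (pverts H))) ^ r -
        \<epsilon>\<^sup>2 / 4 * (\<epsilon>\<^sup>2 / 32) / (4 * real r) * real (card (pverts H))
        < block_count r r (\<lambda>_. nbrs H b) {..<card (pverts H) div r} vs"
      using vs by (simp add: B1_def cV not_le) (simp add: n_def \<delta>_def m_def)
  next
    fix p q assume pq: "p \<in> pverts H" "q \<in> pverts H"
    then have "(p, q) \<in> V \<times> V" by (simp add: V_def)
    then have nB: "vs \<notin> B2 m (p, q)" "vs \<notin> B2 a (p, q)" using vs unfolding B_def by blast+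
    show "real (card (pverts H) div r) * ((real d - 2) / real (card (pverts H)))\<^sup>2 -
        \<epsilon>\<^sup>2 / 4 * (\<epsilon>\<^sup>2 / 32) / (4 * real r) * real (card (pverts H))
        < block_count r 2 (\<lambda>j. if j = 0 then nbrs H p else nbrs H q) {..<card (pverts H) div r} vs"
      using nB(1) vs by (simp add: B2_def cV not_le cong: if_cong) (simp add: n_def \<delta>_def m_def)
    show "real (nat \<lfloor>\<epsilon>\<^sup>2 / 32 * real (card (pverts H) div r)\<rfloor>) * ((real d - 2) / real (card (pverts H)))\<^sup>2 -
        \<epsilon>\<^sup>2 / 4 * (\<epsilon>\<^sup>2 / 32) / (4 * real r) * real (card (pverts H))
        < block_count r 2 (\<lambda>j. if j = 0 then nbrs H p else nbrs H q)
          {..<nat \<lfloor>\<epsilon>\<^sup>2 / 32 * real (card (pverts H) div r)\<rfloor>} vs"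
      using nB(2) vs by (simp add: B2_def cV not_le cong: if_cong) (simp add: n_def \<delta>_def a_def)
  qed (use H r \<rho> \<epsilon> d0 dle L n vs in \<open>auto simp: n_def \<delta>_def d_def V_def\<close>)
  have "1 - 3 * (real n)\<^sup>2 * exp (- (\<delta>\<^sup>2 * real n / 16)) \<le> perm_avg V (\<lambda>vs. of_bool
      (factor_of_ordering (complete_graph r) vs \<in> {F. pancyclic (union (with_proj H) (with_proj F))}))"
  proof (rule perm_avg_of_bool_ge[OF finV _ _ cB])
    show "B \<subseteq> permutations_of_set V" by (auto simp: B_def B1_def B2_def)
  qed (use good in auto)
  then show ?thesis using prob_random_factor[OF finV] by (simp add: V_def)
qed

text \<open>The condition on \<open>a\<close> inside \<open>perturbed_threshold\<close>, repeated
  literally so that unfolding both identifies them.\<close>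

definition whp_above :: "((nat, nat \<times> nat) pre_digraph \<Rightarrow> bool) \<Rightarrow> nat pair_pre_digraph \<Rightarrow> real \<Rightarrow> bool" where
  "whp_above Q F a \<longleftrightarrow> (\<forall>\<epsilon>>0. \<forall>\<eta>>0. \<exists>n\<^sub>0. \<forall>n\<ge>n\<^sub>0. card (pverts F) dvd n \<longrightarrow>
    (\<forall>H :: nat pair_pre_digraph.
      pair_graph H \<and> card (pverts H) = n \<and> real (min_degree (with_proj H)) \<ge> (a + \<epsilon>) * real n \<longrightarrow>
      measure_pmf.prob (random_factor F (pverts H))
        {\<F>. Q (union (with_proj H) (with_proj \<F>))} \<ge> 1 - \<eta>))"

text \<open>In a closed walk tails and heads form the same multiset, so the distinctness of the
  heads provided by \<open>cycle\<close> passes to the tails; as many distinct tails as vertices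
  exhaust the vertex set.\<close>

lemma hamiltonian_of_pancyclic:
  assumes "pancyclic D" "3 \<le> card (verts D)" "\<And>e. e \<in> arcs D \<Longrightarrow> tail D e \<in> verts D"
    "finite (verts D)"
  shows "hamiltonian D"
proof -
  obtain p where p: "pre_digraph.cycle D p" "length p = card (verts D)"
    using assms(1,2) unfolding pancyclic_def by (meson atLeastAtMost_iff order_refl)
  then obtain u where u: "pre_digraph.awalk D u p u" "distinct (tl (pre_digraph.awalk_verts D u p))" "p \<noteq> []"
    by (auto simp: pre_digraph.cycle_def)
  have cas: "pre_digraph.cas D u p u" and pa: "set p \<subseteq> arcs D"
    using u(1) by (auto simp: pre_digraph.awalk_def)
  have av: "pre_digraph.awalk_verts D u p = map (tail D) p @ [head D (last p)]"
    "pre_digraph.awalk_verts D u p = tail D (hd p) # map (head D) p"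
    using u(3) pre_digraph.awalk_verts_conv[of D u p] pre_digraph.awalk_verts_conv'[OF cas] by auto
  have hu: "tail D (hd p) = u" using cas u(3) by (cases p) (auto simp: pre_digraph.cas.simps)
  have lu: "head D (last p) = u"
  proof -
    have "pre_digraph.cas D u (butlast p @ [last p]) u" using cas u(3) by simp
    then show ?thesis unfolding cas_append by (auto simp: pre_digraph.cas.simps)
  qed
  have "mset (map (tail D) p) + {#u#} = {#u#} + mset (map (head D) p)"
    using arg_cong[OF trans[OF av(1)[symmetric] av(2)], of mset] hu lu by simp
  then have "mset (map (tail D) p) = mset (map (head D) p)" by simp
  moreover have "distinct (map (head D) p)" using u(2) av(2) by simp
  ultimately have "distinct (map (tail D) p)" using mset_eq_imp_distinct_iff by metis
  then have "card (tail D ` set p) = card (verts D)"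
    using p(2) distinct_card[of "map (tail D) p"] by simp
  moreover have "tail D ` set p \<subseteq> verts D" using pa assms(3) by auto
  ultimately have "tail D ` set p = verts D" using assms(4) by (intro card_subset_eq) auto
  then show ?thesis using p assms(2) by (auto simp: hamiltonian_def)
qed

lemma whp_above_pancyclic_rho:
  assumes r: "r \<ge> 2" and \<rho>: "0 < \<rho>" "\<rho> ^ r + real r * \<rho> - 1 = 0"
  shows "whp_above pancyclic (complete_graph r) \<rho>"
  unfolding whp_above_def
proof (intro allI impI)
  fix \<epsilon>' \<eta> :: real assume e: "\<epsilon>' > 0" "\<eta> > 0"
  \<comment> \<open>The constants require \<open>\<epsilon> \<le> 1\<close>, and a graph meeting the
    degree bound for \<open>\<epsilon>'\<close> meets it for every smaller value.\<close>
  define \<epsilon> where "\<epsilon> = min \<epsilon>' 1"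
  have \<epsilon>: "0 < \<epsilon>" "\<epsilon> \<le> 1" "\<epsilon> \<le> \<epsilon>'" using e by (auto simp: \<epsilon>_def)
  define \<delta> where "\<delta> = (\<epsilon>\<^sup>2 / 4) * (\<epsilon>\<^sup>2 / 32) / (4 * real r)"
  have \<delta>: "\<delta> > 0" using \<epsilon> r by (simp add: \<delta>_def)
  obtain L :: nat where L0: "4 / \<delta> < real L" using reals_Archimedean2 by blast
  have L: "L > 0" "1 / real L \<le> \<delta> / 4"
  proof -
    have "0 < 4 / \<delta>" using \<delta> by simp
    then show "L > 0" using L0 by (cases L) auto
    then show "1 / real L \<le> \<delta> / 4" using L0 \<delta> by (simp add: field_simps)
  qed
  have lin: "eventually (\<lambda>n. C \<le> q * real n) sequentially" if "q > 0" for C q :: real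
  proof -
    obtain N :: nat where "C / q < real N" using reals_Archimedean2 by blast
    then show ?thesis using that
      by (intro eventually_sequentiallyI[of N]) (auto simp: field_simps intro: order_trans[OF less_imp_le])
  qed
  have "((\<lambda>n. 3 * (real n)\<^sup>2 * exp (- (\<delta>\<^sup>2 * real n / 16))) \<longlongrightarrow> 0) sequentially"
    using \<delta> by real_asymp
  then have ev: "eventually (\<lambda>n. 3 * (real n)\<^sup>2 * exp (- (\<delta>\<^sup>2 * real n / 16)) < \<eta>) sequentially"
    using e(2) by (rule order_tendstoD(2))
  have "eventually (\<lambda>n. 3 * real r \<le> \<epsilon>\<^sup>2 / 32 * real n \<and> 16 * real r + 8 \<le> \<epsilon> * real n \<and>
      64 * real r * (real L)\<^sup>2 / \<delta>\<^sup>2 + 1 \<le> \<epsilon> / 32 * real n \<and>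
      3 * (real n)\<^sup>2 * exp (- (\<delta>\<^sup>2 * real n / 16)) < \<eta>) sequentially"
    by (intro eventually_conj lin ev) (use \<epsilon> in auto)
  then obtain n\<^sub>0 where n0: "\<And>n. n \<ge> n\<^sub>0 \<Longrightarrow> 3 * real r \<le> \<epsilon>\<^sup>2 / 32 * real n \<and> 16 * real r + 8 \<le> \<epsilon> * real n \<and>
      64 * real r * (real L)\<^sup>2 / \<delta>\<^sup>2 + 1 \<le> \<epsilon> / 32 * real n \<and>
      3 * (real n)\<^sup>2 * exp (- (\<delta>\<^sup>2 * real n / 16)) < \<eta>"
    unfolding eventually_sequentially by blast
  have cp: "card (pverts (complete_graph r)) = r" by (simp add: complete_graph_def)
  show "\<exists>n\<^sub>0. \<forall>n\<ge>n\<^sub>0. card (pverts (complete_graph r)) dvd n \<longrightarrow>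
    (\<forall>H :: nat pair_pre_digraph.
      pair_graph H \<and> card (pverts H) = n \<and> real (min_degree (with_proj H)) \<ge> (\<rho> + \<epsilon>') * real n \<longrightarrow>
      measure_pmf.prob (random_factor (complete_graph r) (pverts H))
        {\<F>. pancyclic (union (with_proj H) (with_proj \<F>))} \<ge> 1 - \<eta>)"
  proof (intro exI[of _ n\<^sub>0] allI impI, elim conjE)
    fix n and H :: "nat pair_pre_digraph"
    assume n: "n \<ge> n\<^sub>0" "card (pverts (complete_graph r)) dvd n" and H: "pair_graph H" "card (pverts H) = n"
      and deg: "(\<rho> + \<epsilon>') * real n \<le> real (min_degree (with_proj H))"
    note N = n0[OF n(1)]
    have "(\<rho> + \<epsilon>) * real n \<le> (\<rho> + \<epsilon>') * real n" using \<epsilon> by (intro mult_right_mono) auto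
    then have deg': "(\<rho> + \<epsilon>) * real (card (pverts H)) \<le> real (min_degree (with_proj H))" using deg H(2) by simp
    have "1 - 3 * (real (card (pverts H)))\<^sup>2 * exp (- (\<delta>\<^sup>2 * real (card (pverts H)) / 16)) \<le>
      measure_pmf.prob (random_factor (complete_graph r) (pverts H))
        {\<F>. pancyclic (union (with_proj H) (with_proj \<F>))}"
      unfolding \<delta>_def
      by (rule prob_pancyclic_ge[OF H(1) r _ \<rho> \<epsilon>(1,2) deg' L(1)])
        (use L(2) N H(2) n(2) cp in \<open>auto simp: \<delta>_def\<close>)
    then show "1 - \<eta> \<le> measure_pmf.prob (random_factor (complete_graph r) (pverts H))
        {\<F>. pancyclic (union (with_proj H) (with_proj \<F>))}"
      using N H(2) by simp
  qed
qed

section \<open>Thresholds\<close>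

lemma whp_aboveD:
  assumes "whp_above Q F a" "\<epsilon> > 0" "\<eta> > 0"
  shows "\<exists>n\<^sub>0. \<forall>n\<ge>n\<^sub>0. \<forall>H. card (pverts F) dvd n \<longrightarrow> pair_graph H \<longrightarrow> card (pverts H) = n \<longrightarrow>
    (a + \<epsilon>) * real n \<le> real (min_degree (with_proj H)) \<longrightarrow>
    1 - \<eta> \<le> measure_pmf.prob (random_factor F (pverts H)) {\<F>. Q (union (with_proj H) (with_proj \<F>))}"
  using assms(1)[unfolded whp_above_def, rule_format, OF assms(2,3)] by auto

lemma union_factor_complete:
  assumes H: "pair_graph H" and vs: "vs \<in> permutations_of_set (pverts H)"
    and r: "r > 0" "r dvd card (pverts H)"
  defines "D \<equiv> union (with_proj H) (with_proj (factor_of_ordering (complete_graph r) vs))"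
  shows "verts D = pverts H" "tail D = fst" "head D = snd"
    and "arcs D = parcs H \<union> {(u, v). u \<in> pverts H \<and> v \<in> pverts H \<and> block_of r vs u = block_of r vs v \<and> u \<noteq> v}"
    and "e \<in> arcs D \<Longrightarrow> tail D e \<in> verts D \<and> head D e \<in> verts D"
proof -
  interpret pair_graph H by fact
  have "set vs = pverts H" using vs by (simp add: permutations_of_set_def)
  then show v: "verts D = pverts H" by (simp add: D_def factor_of_ordering_def Let_def)
  show t: "tail D = fst" "head D = snd" by (simp_all add: D_def)
  show a: "arcs D = parcs H \<union> {(u, v). u \<in> pverts H \<and> v \<in> pverts H \<and> block_of r vs u = block_of r vs v \<and> u \<noteq> v}"
    using parcs_factor_complete[OF vs r] by (auto simp: D_def)
  show "e \<in> arcs D \<Longrightarrow> tail D e \<in> verts D \<and> head D e \<in> verts D"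
    unfolding v t a using arc_fst_in_verts arc_snd_in_verts by auto
qed

lemma hamiltonian_union_of_pancyclic:
  assumes H: "pair_graph H" and vs: "vs \<in> permutations_of_set (pverts H)"
    and r: "r > 0" "r dvd card (pverts H)" and n: "3 \<le> card (pverts H)"
    and pan: "pancyclic (union (with_proj H) (with_proj (factor_of_ordering (complete_graph r) vs)))"
  shows "hamiltonian (union (with_proj H) (with_proj (factor_of_ordering (complete_graph r) vs)))"
proof -
  interpret pair_graph H by fact
  show ?thesis
    by (rule hamiltonian_of_pancyclic[OF pan])
      (use union_factor_complete[OF H vs r] n pair_finite_verts in auto)
qed

lemma prob_union_mono:
  assumes V: "finite V" and "\<And>vs. vs \<in> permutations_of_set V \<Longrightarrow> P (factor_of_ordering F vs) \<Longrightarrow> Q (factor_of_ordering F vs)"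
  shows "measure_pmf.prob (random_factor F V) {G. P G} \<le> measure_pmf.prob (random_factor F V) {G. Q G}"
  unfolding prob_random_factor[OF V] by (rule perm_avg_mono) (use assms(2) in auto)

lemma whp_above_hamiltonian:
  assumes r: "r > 0" and pan: "whp_above pancyclic (complete_graph r) a"
  shows "whp_above hamiltonian (complete_graph r) a"
  unfolding whp_above_def
proof (intro allI impI)
  fix \<epsilon> \<eta> :: real assume e: "\<epsilon> > 0" "\<eta> > 0"
  have cp: "card (pverts (complete_graph r)) = r" by (simp add: complete_graph_def)
  have "\<exists>n\<^sub>0. \<forall>n\<ge>n\<^sub>0. \<forall>H :: nat pair_pre_digraph. r dvd n \<longrightarrow> pair_graph H \<longrightarrow> card (pverts H) = n \<longrightarrow>
      (a + \<epsilon>) * real n \<le> real (min_degree (with_proj H)) \<longrightarrow>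
      1 - \<eta> \<le> measure_pmf.prob (random_factor (complete_graph r) (pverts H))
        {\<F>. pancyclic (union (with_proj H) (with_proj \<F>))}"
    using whp_aboveD[OF pan e] unfolding cp .
  then obtain n\<^sub>0 where n0': "\<forall>n\<ge>n\<^sub>0. \<forall>H :: nat pair_pre_digraph. r dvd n \<longrightarrow> pair_graph H \<longrightarrow> card (pverts H) = n \<longrightarrow>
      (a + \<epsilon>) * real n \<le> real (min_degree (with_proj H)) \<longrightarrow>
      1 - \<eta> \<le> measure_pmf.prob (random_factor (complete_graph r) (pverts H))
        {\<F>. pancyclic (union (with_proj H) (with_proj \<F>))}" by (rule exE)
  note n0 = n0'[rule_format]
  show "\<exists>n\<^sub>0. \<forall>n\<ge>n\<^sub>0. card (pverts (complete_graph r)) dvd n \<longrightarrow>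
    (\<forall>H :: nat pair_pre_digraph.
      pair_graph H \<and> card (pverts H) = n \<and> real (min_degree (with_proj H)) \<ge> (a + \<epsilon>) * real n \<longrightarrow>
      measure_pmf.prob (random_factor (complete_graph r) (pverts H))
        {\<F>. hamiltonian (union (with_proj H) (with_proj \<F>))} \<ge> 1 - \<eta>)"
  \<comment> \<open>With fewer than 3 vertices pancyclicity holds vacuously and does not imply
    hamiltonicity, hence the 3.\<close>
  proof (intro exI[of _ "max n\<^sub>0 3"] allI impI, elim conjE)
    fix n and H :: "nat pair_pre_digraph"
    assume n: "max n\<^sub>0 3 \<le> n" "card (pverts (complete_graph r)) dvd n" and H: "pair_graph H" "card (pverts H) = n"
      and deg: "(a + \<epsilon>) * real n \<le> real (min_degree (with_proj H))"
    interpret pair_graph H by fact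
    have "1 - \<eta> \<le> measure_pmf.prob (random_factor (complete_graph r) (pverts H))
        {\<F>. pancyclic (union (with_proj H) (with_proj \<F>))}"
      by (rule n0[OF _ _ H deg]) (use n cp in auto)
    also have "\<dots> \<le> measure_pmf.prob (random_factor (complete_graph r) (pverts H))
        {\<F>. hamiltonian (union (with_proj H) (with_proj \<F>))}"
      by (rule prob_union_mono[OF pair_finite_verts])
        (use hamiltonian_union_of_pancyclic[OF H(1) _ r] n H(2) cp in auto)
    finally show "1 - \<eta> \<le> measure_pmf.prob (random_factor (complete_graph r) (pverts H))
        {\<F>. hamiltonian (union (with_proj H) (with_proj \<F>))}" .
  qed
qed

text \<open>The extremal graph of the lower bound; the initial segment \<open>{..<k}\<close> plays
  the role of the set \<open>A\<close>.\<close>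

definition join_graph :: "nat \<Rightarrow> nat \<Rightarrow> nat pair_pre_digraph" where
  "join_graph n k = \<lparr> pverts = {..<n}, parcs = {(u, v). u < n \<and> v < n \<and> u \<noteq> v \<and> (u < k \<or> v < k)} \<rparr>"

lemma pair_graph_join_graph: "pair_graph (join_graph n k)"
proof -
  have "finite {(u, v). u < n \<and> v < n \<and> u \<noteq> v \<and> (u < k \<or> v < k)}"
    by (rule finite_subset[of _ "{..<n} \<times> {..<n}"]) auto
  then show ?thesis
    by unfold_locales (auto simp: join_graph_def symmetric_def intro!: symI)
qed

lemma min_degree_join_graph:
  assumes "0 < n" "k < n"
  shows "k \<le> min_degree (with_proj (join_graph n k))"
proof -
  have "k \<le> card (nbrs (join_graph n k) u)" if u: "u < n" for u
  proof (cases "u < k")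
    case True
    then have "nbrs (join_graph n k) u = {..<n} - {u}" using u by (auto simp: nbrs_def join_graph_def)
    then show ?thesis using u assms by simp
  next
    case False
    then have "{..<k} \<subseteq> nbrs (join_graph n k) u" using u assms by (auto simp: nbrs_def join_graph_def)
    moreover have "finite (nbrs (join_graph n k) u)"
      by (rule finite_subset[of _ "{..<n}"]) (auto simp: nbrs_def join_graph_def)
    ultimately show ?thesis using card_mono[of "nbrs (join_graph n k) u" "{..<k}"] by simp
  qed
  then show ?thesis
    unfolding min_degree_def using assms
    by (subst Min_ge_iff) (auto simp: join_graph_def[of n k] out_degree_nbrs)
qed

text \<open>A Hamilton cycle forces at least \<open>n div r - k\<close> blocks inside
  \<open>{..<k}\<close>, and Markov's inequality compares this with their expected number. The
  assumption \<open>r * k < n\<close> makes the denominator positive.\<close>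

lemma prob_hamiltonian_join_graph_le:
  assumes r: "r > 0" "r dvd n" and k: "0 < k" "r * k < n"
  shows "measure_pmf.prob (random_factor (complete_graph r) {..<n})
      {F. hamiltonian (union (with_proj (join_graph n k)) (with_proj F))}
    \<le> real (n div r) * (real k / real n) ^ r / (real (n div r) - real k)"
proof -
  define m where "m = n div r"
  have nm: "n = r * m" using r by (simp add: m_def)
  have km: "k < m" "0 < n" "k < n" using k r by (auto simp: nm intro: le_less_trans[of k "r * k"])
  let ?c = "block_count r r (\<lambda>_. {..<k}) {..<m}"
  let ?H = "join_graph n k"
  have pv: "pverts ?H = {..<n}" by (simp add: join_graph_def)
  have Im: "i * r + r \<le> card {..<n}" if "i \<in> {..<m}" for i
    using mult_right_mono[of "Suc i" m r] that by (simp add: nm mult.commute)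
  have "measure_pmf.prob (random_factor (complete_graph r) {..<n})
      {F. hamiltonian (union (with_proj ?H) (with_proj F))} \<le>
      perm_avg {..<n} (\<lambda>vs. 1 / (real m - real k) * ?c vs)"
    unfolding prob_random_factor[OF finite_lessThan]
  proof (rule perm_avg_mono)
    fix vs assume vs: "vs \<in> permutations_of_set {..<n}"
    let ?D = "union (with_proj ?H) (with_proj (factor_of_ordering (complete_graph r) vs))"
    have vs': "vs \<in> permutations_of_set (pverts ?H)" "r dvd card (pverts ?H)" using vs r pv by auto
    note D = union_factor_complete[OF pair_graph_join_graph vs'(1) r(1) vs'(2)]
    have "1 \<le> 1 / (real m - real k) * ?c vs" if ham: "hamiltonian ?D"
    proof -
      have "card (block_of r vs ` (verts ?D - {..<k})) \<le> card {..<k}"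
      proof (rule hamiltonian_block_bound[OF ham])
        show "{..<k} \<subseteq> verts ?D" using km unfolding D(1) pv by auto
        show "head ?D e \<in> verts ?D" if "e \<in> arcs ?D" for e using D(5)[OF that] by blast
        show "block_of r vs (tail ?D e) = block_of r vs (head ?D e)"
          if "e \<in> arcs ?D" "tail ?D e \<notin> {..<k}" "head ?D e \<notin> {..<k}" for e
          using that unfolding D(2,3,4) by (auto simp: join_graph_def)
      qed (use k in auto)
      then have "real (card (block_of r vs ` ({..<n} - {..<k}))) \<le> real k" unfolding D(1) pv by simp
      moreover have "real (card (block_of r vs ` ({..<n} - {..<k}))) = real m - ?c vs"
        using card_block_of_image_compl[OF vs, of r "{..<k}"] r by (simp add: m_def)
      ultimately show ?thesis using km by (simp add: field_simps)
    qed
    moreover have "0 \<le> 1 / (real m - real k) * ?c vs" using km by (simp add: block_count_def)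
    ultimately show "of_bool (factor_of_ordering (complete_graph r) vs \<in>
        {F. hamiltonian (union (with_proj ?H) (with_proj F))}) \<le> 1 / (real m - real k) * ?c vs"
      by auto
  qed
  also have "\<dots> = 1 / (real m - real k) * (real m * perm_avg {..<n} (\<lambda>xs. of_bool (\<forall>j<r. xs ! j \<in> {..<k})))"
    unfolding perm_avg_cmult by (subst perm_avg_block_count) (use Im in auto)
  also have "\<dots> \<le> 1 / (real m - real k) * (real m * (real (card ({..<k} \<inter> {..<n})) / real (card {..<n})) ^ r)"
    using km by (intro mult_left_mono perm_avg_prefix_le) (auto simp: nm)
  also have "{..<k} \<inter> {..<n} = {..<k}" using km by auto
  finally show ?thesis by (simp add: m_def)
qed

lemma rho_le_of_whp_above_hamiltonian:
  assumes r: "r \<ge> 2" and \<rho>: "0 < \<rho>" "\<rho> ^ r + real r * \<rho> - 1 = 0"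
    and a: "0 \<le> a" "whp_above hamiltonian (complete_graph r) a"
  shows "\<rho> \<le> a"
proof (rule ccontr)
  assume "\<not> \<rho> \<le> a"
  \<comment> \<open>Half the gap between \<open>a\<close> and \<open>\<rho>\<close>; the other half
    leaves room for \<open>z\<close> strictly between \<open>a + \<epsilon>\<close> and
    \<open>\<rho>\<close>, which absorbs the rounding of \<open>k\<close>.\<close>
  define \<epsilon> where "\<epsilon> = (\<rho> - a) / 2"
  have \<epsilon>: "\<epsilon> > 0" using \<open>\<not> \<rho> \<le> a\<close> by (simp add: \<epsilon>_def)
  define z where "z = \<rho> - \<epsilon> / 2"
  have z: "0 < z" "z < \<rho>" "z = a + \<epsilon> + \<epsilon> / 2" using a \<epsilon> by (auto simp: z_def \<epsilon>_def field_simps)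
  have r0: "real r > 0" "r > 0" using r by auto
  have "z ^ r < \<rho> ^ r" using z r0 by (intro power_strict_mono) auto
  moreover have "real r * z < real r * \<rho>" using z r0 by simp
  ultimately have lt: "z ^ r < 1 - real r * z" using \<rho>(2) by linarith
  have zr: "0 < z ^ r" using z by simp
  \<comment> \<open>The Markov bound of \<open>prob_hamiltonian_join_graph_le\<close> with
    \<open>z * n\<close> in place of \<open>k\<close>; for \<open>n = r * m\<close> it does not
    depend on \<open>m\<close>.\<close>
  define q where "q = z ^ r / (1 - real r * z)"
  have q: "q < 1" using lt zr by (simp add: q_def)
  define \<eta> where "\<eta> = (1 - q) / 2"
  have \<eta>: "\<eta> > 0" "q < 1 - \<eta>" using q by (auto simp: \<eta>_def field_simps)
  have cp: "card (pverts (complete_graph r)) = r" by (simp add: complete_graph_def)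
  have "\<exists>n\<^sub>0. \<forall>n\<ge>n\<^sub>0. \<forall>H :: nat pair_pre_digraph. r dvd n \<longrightarrow> pair_graph H \<longrightarrow> card (pverts H) = n \<longrightarrow>
      (a + \<epsilon>) * real n \<le> real (min_degree (with_proj H)) \<longrightarrow>
      1 - \<eta> \<le> measure_pmf.prob (random_factor (complete_graph r) (pverts H))
        {\<F>. hamiltonian (union (with_proj H) (with_proj \<F>))}"
    using whp_aboveD[OF a(2) \<epsilon> \<eta>(1)] unfolding cp .
  then obtain n\<^sub>0 where n0': "\<forall>n\<ge>n\<^sub>0. \<forall>H :: nat pair_pre_digraph. r dvd n \<longrightarrow> pair_graph H \<longrightarrow> card (pverts H) = n \<longrightarrow>
      (a + \<epsilon>) * real n \<le> real (min_degree (with_proj H)) \<longrightarrow>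
      1 - \<eta> \<le> measure_pmf.prob (random_factor (complete_graph r) (pverts H))
        {\<F>. hamiltonian (union (with_proj H) (with_proj \<F>))}" by (rule exE)
  note n0 = n0'[rule_format]
  obtain N :: nat where N: "2 / \<epsilon> < real N" using reals_Archimedean2 by blast
  define m where "m = N + n\<^sub>0 + 1"
  define n where "n = r * m"
  define k where "k = nat \<lceil>(a + \<epsilon>) * real n\<rceil>"
  have "m \<le> n" using r0 by (simp add: n_def)
  then have n: "n \<ge> n\<^sub>0" "0 < n" "2 / \<epsilon> \<le> real n" using N by (auto simp: m_def)
  have pos: "0 < (a + \<epsilon>) * real n" using a \<epsilon> n by (intro mult_pos_pos) auto
  have k: "(a + \<epsilon>) * real n \<le> real k" "real k \<le> (a + \<epsilon>) * real n + 1" "0 < k"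
  proof -
    show "(a + \<epsilon>) * real n \<le> real k" unfolding k_def by (rule of_nat_ceiling)
    then show "0 < k" using pos by (cases k) auto
    have "real k = of_int \<lceil>(a + \<epsilon>) * real n\<rceil>" unfolding k_def using pos by (intro of_nat_nat) simp
    then show "real k \<le> (a + \<epsilon>) * real n + 1" using ceiling_correct[of "(a + \<epsilon>) * real n"] by linarith
  qed
  have "1 \<le> \<epsilon> / 2 * real n" using n(3) \<epsilon> by (simp add: field_simps)
  then have kz: "real k \<le> z * real n" using k(2) by (simp add: z(3) distrib_right)
  have m0: "real m > 0" by (simp add: m_def)
  have kz': "real r * real k \<le> real r * z * real n"
    using mult_left_mono[OF kz, of "real r"] by (simp add: mult.assoc)
  have "real r * z * real n < 1 * real n" using lt zr n(2) by (intro mult_strict_right_mono) auto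
  then have "real (r * k) < real n" using kz' by simp
  then have rk: "r * k < n" by (simp only: of_nat_less_iff)
  have kn: "k < n" using rk r0(2) by (metis le_less_trans mult_le_mono1 mult_1 Suc_leI One_nat_def)
  have pv: "pverts (join_graph n k) = {..<n}" by (simp add: join_graph_def)
  have "1 - \<eta> \<le> measure_pmf.prob (random_factor (complete_graph r) (pverts (join_graph n k)))
      {\<F>. hamiltonian (union (with_proj (join_graph n k)) (with_proj \<F>))}"
  proof (rule n0[of n])
    have "k \<le> min_degree (with_proj (join_graph n k))" by (rule min_degree_join_graph[OF n(2) kn])
    then show "(a + \<epsilon>) * real n \<le> real (min_degree (with_proj (join_graph n k)))" using k(1) by linarith
  qed (use n pair_graph_join_graph in \<open>auto simp: n_def join_graph_def\<close>)
  also have "\<dots> \<le> real (n div r) * (real k / real n) ^ r / (real (n div r) - real k)"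
    unfolding pv by (rule prob_hamiltonian_join_graph_le[OF r0(2) _ k(3) rk]) (simp add: n_def)
  also have "n div r = m" using r0 by (simp add: n_def)
  also have "real m * (real k / real n) ^ r / (real m - real k) \<le> real m * z ^ r / (real m * (1 - real r * z))"
  proof (rule frac_le)
    have "real k / real n \<le> z" using kz n(2) by (simp add: field_simps)
    then show "real m * (real k / real n) ^ r \<le> real m * z ^ r" by (intro mult_left_mono power_mono) auto
    show "0 < real m * (1 - real r * z)" using m0 lt zr by (intro mult_pos_pos) auto
    show "real m * (1 - real r * z) \<le> real m - real k" using kz by (simp add: n_def algebra_simps)
  qed (use m0 zr in auto)
  also have "\<dots> = q" using m0 by (simp add: q_def)
  finally show False using \<eta>(2) by linarith
qed

theorem theorem1p2:
  fixes r :: nat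
  assumes "r \<ge> 2"
  shows "(\<exists>!x::real. 0 < x \<and> x ^ r + real r * x - 1 = 0) \<and>
    alpha_star (complete_graph r) = rho r \<and> alpha_star_pan (complete_graph r) = rho r"
proof -
  have ex1: "\<exists>!x::real. 0 < x \<and> x ^ r + real r * x - 1 = 0" by (rule ex1_rho) (use assms in simp)
  then have \<rho>: "0 < rho r" "rho r ^ r + real r * rho r - 1 = 0"
    unfolding rho_def by (metis (mono_tags, lifting) theI')+
  have "2 * rho r \<le> real r * rho r" using assms \<rho>(1) by (intro mult_right_mono) auto
  then have le1: "rho r \<le> 1" using \<rho> zero_less_power[of "rho r" r] by linarith
  have r0: "r > 0" using assms by simp
  have pan: "whp_above pancyclic (complete_graph r) (rho r)" by (rule whp_above_pancyclic_rho[OF assms \<rho>])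
  \<comment> \<open>The infimum is attained at \<open>rho r\<close>. For either property the lower
    bound comes from hamiltonicity, to which the second assumption reduces it.\<close>
  have threshold: "perturbed_threshold Q (complete_graph r) = rho r"
    if "whp_above Q (complete_graph r) (rho r)"
      "\<And>a. whp_above Q (complete_graph r) a \<Longrightarrow> whp_above hamiltonian (complete_graph r) a" for Q
  proof -
    have "perturbed_threshold Q (complete_graph r) = Inf {a \<in> {0..1}. whp_above Q (complete_graph r) a}"
      by (simp only: perturbed_threshold_def whp_above_def)
    also have "\<dots> = rho r"
    proof (rule cInf_eq_minimum)
      show "rho r \<in> {a \<in> {0..1}. whp_above Q (complete_graph r) a}" using that \<rho> le1 by simp
      fix a assume "a \<in> {a \<in> {0..1}. whp_above Q (complete_graph r) a}"
      then show "rho r \<le> a" using rho_le_of_whp_above_hamiltonian[OF assms \<rho>, of a] that(2) by simp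
    qed
    finally show ?thesis .
  qed
  show ?thesis
    using ex1 threshold[of hamiltonian] threshold[of pancyclic] pan whp_above_hamiltonian[OF r0]
    by (auto simp: alpha_star_def alpha_star_pan_def)
qed

end
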